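(* Let $R$ be a (commutative noetherian) local ring, $M$ a nonzero (finitely generated) $R$-module of grade $g$, and $F$ a minimal free resolution of $M$. Write $(-)^*=\operatorname{Hom}_R(-,R)$. (1) Suppose that $M$ has finite projective dimension. Then $F$ is self-dual if and only if $M$ is totally self-dual. When this is the case, one has $(\Omega^i_R M)^*\cong\Omega^{g+1-i}_R M$ for all integers $0\le i\le g-1$. (2) Suppose that there exist two integers $m,n$ with $0\le m<g$ and $0\le n<g$ such that $(\Omega^m_R M)^*\cong\Omega^n_R M$. Then $m\ge 2$ and $n\ge2$, $g=\operatorname{pd}_R M=m+n-1$, and $F$ is self-dual.
   Context: All rings are commutative and noetherian, and all modules are finitely generated. Put $(-)^*=\operatorname{Hom}_R(-,R)$. The grade of a nonzero $R$-module $M$ is $\operatorname{grade}_R M=\inf\{i\ge 0:\operatorname{Ext}^i_R(M,R)\ne0\}$, equivalently the grade of the ideal $\operatorname{Ann}_R M$ on $R$; $\operatorname{pd}_R M$ denotes projective dimension. Let $R$ be a local ring and $F=(\cdots\xrightarrow{d_3}F_2\xrightarrow{d_2}F_1\xrightarrow{d_1}F_0\to0)$ a minimal free resolution of an $R$-module $M$. For an integer $n\ge0$, the $n$-th syzygy $\Omega^n_R M$ is the cokernel of $d_{n+1}$ (so $\Omega^0_R M= M$). $F$ is called self-dual if $\operatorname{pd}_R M<\infty$ and $F$ is isomorphic, as a complex, to $F^*=(0\to F_0^*\xrightarrow{d_1^*}F_1^*\xrightarrow{d_2^*}\cdots\xrightarrow{d_{r-1}^*}F_{r-1}^*\xrightarrow{d_r^*}F_r^*\to0)$,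 where $r=\operatorname{pd}_R M$ and $F_i^*$ is placed in homological degree $r-i$. $M$ is called totally self-dual if $M\neq0$, $\operatorname{Ext}^i_R(M,R)\cong M$ for $i=\operatorname{grade}_R M$, and $\operatorname{Ext}^i_R(M,R)=0$ for all $i\ne\operatorname{grade}_R M$. *)

theory Defs
  imports "HOL-Algebra.Module" "HOL-Algebra.Ring_Divisibility" "HOL-Library.Extended_Nat"
begin

section \<open>Modules\<close>

definition local_ring :: "('a, 'q) ring_scheme \<Rightarrow> bool" where
  "local_ring R \<longleftrightarrow> cring R \<and> (\<exists>!I. maximalideal I R)"

definition max_ideal :: "('a, 'q) ring_scheme \<Rightarrow> 'a set" where
  "max_ideal R = (THE I. maximalideal I R)"

definition zero_mod :: "('a, 'm) module \<Rightarrow> bool" where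
  "zero_mod M \<longleftrightarrow> carrier M = {\<zero>\<^bsub>M\<^esub>}"

definition mod_span :: "('a, 'q) ring_scheme \<Rightarrow> ('a, 'm) module \<Rightarrow> 'm set \<Rightarrow> 'm set" where
  "mod_span R M A = \<Inter>{N. submodule N R M \<and> A \<subseteq> N}"

definition fin_gen :: "('a, 'q) ring_scheme \<Rightarrow> ('a, 'm) module \<Rightarrow> bool" where
  "fin_gen R M \<longleftrightarrow> (\<exists>A. finite A \<and> A \<subseteq> carrier M \<and> mod_span R M A = carrier M)"

definition ideal_smult :: "('a, 'q) ring_scheme \<Rightarrow> 'a set \<Rightarrow> ('a, 'm) module \<Rightarrow> 'm set" where
  "ideal_smult R I M = mod_span R M {a \<odot>\<^bsub>M\<^esub> x | a x. a \<in> I \<and> x \<in> carrier M}"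

definition mod_hom :: "('a, 'q) ring_scheme \<Rightarrow> ('a, 'm) module \<Rightarrow> ('a, 'n) module \<Rightarrow> ('m \<Rightarrow> 'n) set" where
  "mod_hom R M N = {f. f \<in> carrier M \<rightarrow> carrier N
     \<and> (\<forall>x\<in>carrier M. \<forall>y\<in>carrier M. f (x \<oplus>\<^bsub>M\<^esub> y) = f x \<oplus>\<^bsub>N\<^esub> f y)
     \<and> (\<forall>a\<in>carrier R. \<forall>x\<in>carrier M. f (a \<odot>\<^bsub>M\<^esub> x) = a \<odot>\<^bsub>N\<^esub> f x)}"

definition mod_iso :: "('a, 'q) ring_scheme \<Rightarrow> ('a, 'm) module \<Rightarrow> ('a, 'n) module \<Rightarrow> bool" where
  "mod_iso R M N \<longleftrightarrow> (\<exists>f\<in>mod_hom R M N. bij_betw f (carrier M) (carrier N))"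

text \<open>
  The record type of modules extends that of rings, so every module carries the irrelevant
  fields \<open>mult\<close> and \<open>one\<close>; they are left undefined below.
\<close>

definition regular_mod :: "('a, 'q) ring_scheme \<Rightarrow> ('a, 'a) module" where
  "regular_mod R = \<lparr>carrier = carrier R, mult = undefined, one = undefined,
     zero = \<zero>\<^bsub>R\<^esub>, add = add R, smult = mult R\<rparr>"

definition free_mod :: "('a, 'q) ring_scheme \<Rightarrow> nat \<Rightarrow> ('a, nat \<Rightarrow> 'a) module" where
  "free_mod R n = \<lparr>carrier = {..<n} \<rightarrow>\<^sub>E carrier R, mult = undefined, one = undefined,
     zero = (\<lambda>k\<in>{..<n}. \<zero>\<^bsub>R\<^esub>),
     add = (\<lambda>u v. \<lambda>k\<in>{..<n}. u k \<oplus>\<^bsub>R\<^esub> v k),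
     smult = (\<lambda>a v. \<lambda>k\<in>{..<n}. a \<otimes>\<^bsub>R\<^esub> v k)\<rparr>"

definition Hom_mod ::
  "('a, 'q) ring_scheme \<Rightarrow> ('a, 'm) module \<Rightarrow> ('a, 'n) module \<Rightarrow> ('a, 'm \<Rightarrow> 'n) module" where
  "Hom_mod R M N = \<lparr>carrier = mod_hom R M N \<inter> extensional (carrier M),
     mult = undefined, one = undefined,
     zero = (\<lambda>x\<in>carrier M. \<zero>\<^bsub>N\<^esub>),
     add = (\<lambda>f g. \<lambda>x\<in>carrier M. f x \<oplus>\<^bsub>N\<^esub> g x),
     smult = (\<lambda>a f. \<lambda>x\<in>carrier M. a \<odot>\<^bsub>N\<^esub> f x)\<rparr>"

definition dual_mod :: "('a, 'q) ring_scheme \<Rightarrow> ('a, 'm) module \<Rightarrow> ('a, 'm \<Rightarrow> 'a) module" where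
  "dual_mod R M = Hom_mod R M (regular_mod R)"

definition quot_mod :: "('a, 'm) module \<Rightarrow> 'm set \<Rightarrow> ('a, 'm set) module" where
  "quot_mod M N = \<lparr>carrier = a_rcosets\<^bsub>M\<^esub> N, mult = undefined, one = undefined,
     zero = N,
     add = set_add M,
     smult = (\<lambda>a X. \<Union>x\<in>X. N +>\<^bsub>M\<^esub> (a \<odot>\<^bsub>M\<^esub> x))\<rparr>"

definition fg_free :: "('a, 'q) ring_scheme \<Rightarrow> ('a, 'm) module \<Rightarrow> bool" where
  "fg_free R M \<longleftrightarrow> (\<exists>n. mod_iso R M (free_mod R n))"

text \<open>Finitely generated projective: a direct summand (retract) of some \<open>R\<^sup>n\<close>.\<close>

definition fg_projective :: "('a, 'q) ring_scheme \<Rightarrow> ('a, 'm) module \<Rightarrow> bool" where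
  "fg_projective R M \<longleftrightarrow>
     (\<exists>n. \<exists>s\<in>mod_hom R M (free_mod R n). \<exists>p\<in>mod_hom R (free_mod R n) M.
        \<forall>x\<in>carrier M. p (s x) = x)"


section \<open>Complexes\<close>

text \<open>Complexes are indexed by the integers; \<open>diff C i\<close> maps degree \<open>i\<close> to degree \<open>i - 1\<close>.\<close>

record ('a, 'c) chain_complex =
  obj :: "int \<Rightarrow> ('a, 'c) module"
  diff :: "int \<Rightarrow> 'c \<Rightarrow> 'c"

definition is_complex :: "('a, 'q) ring_scheme \<Rightarrow> ('a, 'c) chain_complex \<Rightarrow> bool" where
  "is_complex R C \<longleftrightarrow> (\<forall>i. module R (obj C i)
     \<and> diff C i \<in> mod_hom R (obj C i) (obj C (i - 1))
     \<and> (\<forall>x\<in>carrier (obj C i). diff C (i - 1) (diff C i x) = \<zero>\<^bsub>obj C (i - 2)\<^esub>))"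

definition complex_iso ::
  "('a, 'q) ring_scheme \<Rightarrow> ('a, 'c) chain_complex \<Rightarrow> ('a, 'd) chain_complex \<Rightarrow> bool" where
  "complex_iso R C D \<longleftrightarrow> (\<exists>\<theta>. \<forall>i.
     \<theta> i \<in> mod_hom R (obj C i) (obj D i)
     \<and> bij_betw (\<theta> i) (carrier (obj C i)) (carrier (obj D i))
     \<and> (\<forall>x\<in>carrier (obj C i). \<theta> (i - 1) (diff C i x) = diff D i (\<theta> i x)))"

definition cycles :: "('a, 'c) chain_complex \<Rightarrow> int \<Rightarrow> 'c set" where
  "cycles C i = {x \<in> carrier (obj C i). diff C i x = \<zero>\<^bsub>obj C (i - 1)\<^esub>}"

definition boundaries :: "('a, 'c) chain_complex \<Rightarrow> int \<Rightarrow> 'c set" where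
  "boundaries C i = diff C (i + 1) ` carrier (obj C (i + 1))"

definition homology_mod :: "('a, 'c) chain_complex \<Rightarrow> int \<Rightarrow> ('a, 'c set) module" where
  "homology_mod C i = quot_mod (obj C i \<lparr>carrier := cycles C i\<rparr>) (boundaries C i)"

text \<open>
  The contravariant complex \<open>Hom(C, N)\<close>, with \<open>Hom(C\<^sub>i, N)\<close> in degree \<open>-i\<close>, and the shift of a
  complex that moves degree \<open>i\<close> to degree \<open>i + r\<close> without introducing signs.
\<close>

definition Hom_complex ::
  "('a, 'q) ring_scheme \<Rightarrow> ('a, 'c) chain_complex \<Rightarrow> ('a, 'n) module \<Rightarrow> ('a, 'c \<Rightarrow> 'n) chain_complex" where
  "Hom_complex R C N =
     \<lparr>obj = (\<lambda>j. Hom_mod R (obj C (- j)) N),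
      diff = (\<lambda>j f. \<lambda>x\<in>carrier (obj C (1 - j)). f (diff C (1 - j) x))\<rparr>"

definition shift_complex :: "int \<Rightarrow> ('a, 'c) chain_complex \<Rightarrow> ('a, 'c) chain_complex" where
  "shift_complex r C = \<lparr>obj = (\<lambda>j. obj C (j - r)), diff = (\<lambda>j. diff C (j - r))\<rparr>"


section \<open>Resolutions, Ext, grade and projective dimension\<close>

definition resolution ::
  "('a, 'q) ring_scheme \<Rightarrow> ('a, 'c) chain_complex \<Rightarrow> ('a, 'm) module \<Rightarrow> bool" where
  "resolution R P M \<longleftrightarrow> is_complex R P
     \<and> (\<forall>i<0. zero_mod (obj P i))
     \<and> (\<forall>i>0. cycles P i = boundaries P i)
     \<and> (\<exists>\<epsilon>\<in>mod_hom R (obj P 0) M. \<epsilon> ` carrier (obj P 0) = carrier M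
          \<and> {x \<in> carrier (obj P 0). \<epsilon> x = \<zero>\<^bsub>M\<^esub>} = boundaries P 0)"

definition projective_resolution ::
  "('a, 'q) ring_scheme \<Rightarrow> ('a, 'c) chain_complex \<Rightarrow> ('a, 'm) module \<Rightarrow> bool" where
  "projective_resolution R P M \<longleftrightarrow> resolution R P M \<and> (\<forall>i. fg_projective R (obj P i))"

definition minimal_free_resolution ::
  "('a, 'q) ring_scheme \<Rightarrow> ('a, 'c) chain_complex \<Rightarrow> ('a, 'm) module \<Rightarrow> bool" where
  "minimal_free_resolution R F M \<longleftrightarrow> resolution R F M
     \<and> (\<forall>i. fg_free R (obj F i))
     \<and> (\<forall>i. boundaries F i \<subseteq> ideal_smult R (max_ideal R) (obj F i))"

text \<open>
  Every finitely generated projective module is isomorphic to one whose elements are of type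
  \<open>nat \<Rightarrow> 'a\<close> (a submodule of some \<open>R\<^sup>n\<close>). For finitely generated modules over a noetherian
  ring, it is therefore no restriction that the resolutions used for \<open>Ext\<close> and for the
  projective dimension have this type.
\<close>

definition Ext_mod ::
  "('a, 'q) ring_scheme \<Rightarrow> nat \<Rightarrow> ('a, 'm) module \<Rightarrow> ('a, 'n) module
     \<Rightarrow> ('a, ((nat \<Rightarrow> 'a) \<Rightarrow> 'n) set) module" where
  "Ext_mod R i M N = homology_mod
     (Hom_complex R (SOME P :: ('a, nat \<Rightarrow> 'a) chain_complex. projective_resolution R P M) N)
     (- int i)"

text \<open>The infimum of the empty set is \<open>\<infinity>\<close>.\<close>

definition grade :: "('a, 'q) ring_scheme \<Rightarrow> ('a, 'm) module \<Rightarrow> enat" where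
  "grade R M = Inf {enat i | i. \<not> zero_mod (Ext_mod R i M (regular_mod R))}"

text \<open>The zero module gets projective dimension \<open>0\<close>.\<close>

definition proj_dim :: "('a, 'q) ring_scheme \<Rightarrow> ('a, 'm) module \<Rightarrow> enat" where
  "proj_dim R M = Inf {enat n | n. \<exists>P :: ('a, nat \<Rightarrow> 'a) chain_complex.
     projective_resolution R P M \<and> (\<forall>i>int n. zero_mod (obj P i))}"

text \<open>The \<open>n\<close>-th syzygy with respect to the resolution \<open>F\<close>: the cokernel of \<open>d\<^sub>n\<^sub>+\<^sub>1\<close>.\<close>

definition syzygy :: "('a, 'c) chain_complex \<Rightarrow> nat \<Rightarrow> ('a, 'c set) module" where
  "syzygy F n = quot_mod (obj F (int n)) (boundaries F (int n))"


section \<open>Self-duality\<close>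

definition self_dual ::
  "('a, 'q) ring_scheme \<Rightarrow> ('a, 'c) chain_complex \<Rightarrow> ('a, 'm) module \<Rightarrow> bool" where
  "self_dual R F M \<longleftrightarrow> (\<exists>r. proj_dim R M = enat r
     \<and> complex_iso R F (shift_complex (int r) (Hom_complex R F (regular_mod R))))"

definition totally_self_dual :: "('a, 'q) ring_scheme \<Rightarrow> ('a, 'm) module \<Rightarrow> bool" where
  "totally_self_dual R M \<longleftrightarrow> \<not> zero_mod M \<and> (\<exists>g. grade R M = enat g
     \<and> mod_iso R (Ext_mod R g M (regular_mod R)) M
     \<and> (\<forall>i. i \<noteq> g \<longrightarrow> zero_mod (Ext_mod R i M (regular_mod R))))"

end

(*
  Let H = Hom(F,R) and let D be H shifted so that the dual of F_0 sits in degree r.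
  Two minimal resolutions of the same module are isomorphic, because a comparison map followed by
  a comparison map back is homotopic to the identity, hence the identity modulo the maximal ideal,
  hence bijective. When F vanishes above degree r, F is therefore self-dual iff D resolves M, iff
  Ext^r(M,R) is isomorphic to M and all other Ext^i(M,R) vanish; and r = pd M forces r = g, since
  the top Ext is nonzero by minimality and Nakayama.

  For part (2), the vanishing of Ext below the grade makes F_{m-1}^*, ..., F_0^* a minimal
  resolution of (Omega^m M)^*, which must agree with the minimal resolution F_n, F_{n+1}, ... of
  Omega^n M. So F stops in degree p = m+n-1, which gives g <= p and m, n >= 2, and transposing the
  isomorphisms F_{n+j} = F_{m-1-j}^* identifies F with D (taken with r = p) in degrees below m.
  In degrees >= m-1 the complex D is exact because n < g. Hence D resolves M.
*)
theory Submission
  imports Defs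
begin

section \<open>Homomorphisms\<close>

text \<open>In part (2) the isomorphisms F_{n+j} = dual of F_{m-1-j} exist only from degree n of F
  on, and their transposes only up to degree m-1. Where the two families overlap they need not
  agree, and between m-1 and n neither may be defined, so they are never glued into an isomorphism
  of F with D. The transposes only show that D has the cokernel M, for which degrees 0 and 1 must be
  covered; this is where m >= 2 enters. The isomorphism of F with D is then produced afresh by
  uniqueness of minimal resolutions. The bounds are arithmetic: m < g <= m+n-1 forces n >= 2, and n
  < g forces m >= 2 in the same way. What ties syzygies to H is left exactness of Hom: the dual of
  Omega^i M is the module of cycles of H in degree -i. If F is isomorphic to D, these become cycles
  of F in degree g-i > 0, hence boundaries, hence a copy of Omega^{g+1-i} M; this is the last claim
  of part (1). Ext and projective dimension are defined through resolutions of one fixed element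
  type, whereas F has an arbitrary one. The homotopies that give uniqueness also remove this
  dependence.\<close>

lemma (in abelian_group) minus_eq_zero_iff:
  assumes "x \<in> carrier G" "y \<in> carrier G"
  shows "x \<ominus> y = \<zero> \<longleftrightarrow> x = y"
proof
  assume "x \<ominus> y = \<zero>"
  then have "\<ominus> (\<ominus> y) = x" using assms by (intro minus_equality) (simp_all add: a_minus_def)
  then show "x = y" using assms by simp
qed (use assms in \<open>simp add: a_minus_def r_neg\<close>)

lemma (in abelian_group) minus_zero_right:
  "x \<in> carrier G \<Longrightarrow> x \<ominus> \<zero> = x"
  using add.inv_one by (simp add: a_minus_def a_inv_def)

lemma (in abelian_group) plus_minus_cancel:
  "x \<in> carrier G \<Longrightarrow> y \<in> carrier G \<Longrightarrow> y \<oplus> (x \<ominus> y) = x"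
  by (metis a_minus_def add.inv_closed add.m_closed a_comm a_assoc l_neg r_zero a_inv_def)

lemma (in abelian_group) minus_minus_cancel:
  "x \<in> carrier G \<Longrightarrow> y \<in> carrier G \<Longrightarrow> x \<ominus> (x \<ominus> y) = y"
  by (simp add: a_minus_def minus_add r_neg flip: a_assoc)

lemma mod_homI:
  assumes "\<And>x. x \<in> carrier M \<Longrightarrow> f x \<in> carrier N"
    and "\<And>x y. x \<in> carrier M \<Longrightarrow> y \<in> carrier M \<Longrightarrow> f (x \<oplus>\<^bsub>M\<^esub> y) = f x \<oplus>\<^bsub>N\<^esub> f y"
    and "\<And>a x. a \<in> carrier R \<Longrightarrow> x \<in> carrier M \<Longrightarrow> f (a \<odot>\<^bsub>M\<^esub> x) = a \<odot>\<^bsub>N\<^esub> f x"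
  shows "f \<in> mod_hom R M N"
  using assms by (auto simp: mod_hom_def)

lemma mod_hom_closed: "f \<in> mod_hom R M N \<Longrightarrow> x \<in> carrier M \<Longrightarrow> f x \<in> carrier N"
  by (auto simp: mod_hom_def)

lemma mod_hom_add:
  "f \<in> mod_hom R M N \<Longrightarrow> x \<in> carrier M \<Longrightarrow> y \<in> carrier M \<Longrightarrow> f (x \<oplus>\<^bsub>M\<^esub> y) = f x \<oplus>\<^bsub>N\<^esub> f y"
  by (auto simp: mod_hom_def)

lemma mod_hom_smult:
  "f \<in> mod_hom R M N \<Longrightarrow> a \<in> carrier R \<Longrightarrow> x \<in> carrier M \<Longrightarrow> f (a \<odot>\<^bsub>M\<^esub> x) = a \<odot>\<^bsub>N\<^esub> f x"
  by (auto simp: mod_hom_def)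

lemma mod_hom_zero:
  assumes "module R M" "module R N" "f \<in> mod_hom R M N"
  shows "f \<zero>\<^bsub>M\<^esub> = \<zero>\<^bsub>N\<^esub>"
proof -
  interpret M: module R M by fact
  interpret N: module R N by fact
  have "f \<zero>\<^bsub>M\<^esub> = f (\<zero>\<^bsub>R\<^esub> \<odot>\<^bsub>M\<^esub> \<zero>\<^bsub>M\<^esub>)" by simp
  also have "\<dots> = \<zero>\<^bsub>R\<^esub> \<odot>\<^bsub>N\<^esub> f \<zero>\<^bsub>M\<^esub>"
    by (rule mod_hom_smult[OF assms(3)]) auto
  also have "\<dots> = \<zero>\<^bsub>N\<^esub>" using mod_hom_closed[OF assms(3)] by simp
  finally show ?thesis .
qed

lemma mod_hom_uminus:
  assumes "module R M" "module R N" "f \<in> mod_hom R M N" "x \<in> carrier M"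
  shows "f (\<ominus>\<^bsub>M\<^esub> x) = \<ominus>\<^bsub>N\<^esub> f x"
proof -
  interpret M: module R M by fact
  interpret N: module R N by fact
  have "f (\<ominus>\<^bsub>M\<^esub> x) \<oplus>\<^bsub>N\<^esub> f x = f (\<ominus>\<^bsub>M\<^esub> x \<oplus>\<^bsub>M\<^esub> x)"
    using assms(4) by (simp add: mod_hom_add[OF assms(3)])
  also have "\<dots> = \<zero>\<^bsub>N\<^esub>" using assms(4) by (simp add: M.l_neg mod_hom_zero[OF assms(1-3)])
  finally show ?thesis using assms(4) mod_hom_closed[OF assms(3)]
    by (metis N.minus_equality M.a_inv_closed)
qed

lemma mod_hom_minus:
  assumes "module R M" "module R N" "f \<in> mod_hom R M N" "x \<in> carrier M" "y \<in> carrier M"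
  shows "f (x \<ominus>\<^bsub>M\<^esub> y) = f x \<ominus>\<^bsub>N\<^esub> f y"
proof -
  interpret M: module R M by fact
  show ?thesis using assms
    by (simp add: a_minus_def mod_hom_add[OF assms(3)] mod_hom_uminus[OF assms(1-3)])
qed

lemma mod_hom_cong:
  assumes "module R M" "f \<in> mod_hom R M N" "\<And>x. x \<in> carrier M \<Longrightarrow> g x = f x"
  shows "g \<in> mod_hom R M N"
proof -
  interpret M: module R M by fact
  show ?thesis using assms(2,3) by (auto simp: mod_hom_def)
qed

lemma mod_hom_comp:
  assumes "f \<in> mod_hom R M N" "g \<in> mod_hom R N P"
  shows "(\<lambda>x. g (f x)) \<in> mod_hom R M P"
  using assms by (auto simp: mod_hom_def Pi_iff)

lemma mod_hom_ident: "(\<lambda>x. x) \<in> mod_hom R M M"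
  by (auto simp: mod_hom_def)

lemma mod_hom_const_zero:
  assumes "module R N" shows "(\<lambda>x. \<zero>\<^bsub>N\<^esub>) \<in> mod_hom R M N"
proof -
  interpret N: module R N by fact
  show ?thesis by (auto simp: mod_hom_def)
qed

lemma mod_hom_plus:
  assumes "module R N" "f \<in> mod_hom R M N" "g \<in> mod_hom R M N"
  shows "(\<lambda>x. f x \<oplus>\<^bsub>N\<^esub> g x) \<in> mod_hom R M N"
proof -
  interpret N: module R N by fact
  show ?thesis using assms(2,3)
    by (intro mod_homI)
      (simp_all add: mod_hom_closed mod_hom_add mod_hom_smult N.smult_r_distr N.a_ac)
qed

lemma mod_hom_scale:
  assumes "module R N" "f \<in> mod_hom R M N" "a \<in> carrier R"
  shows "(\<lambda>x. a \<odot>\<^bsub>N\<^esub> f x) \<in> mod_hom R M N"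
proof -
  interpret N: module R N by fact
  show ?thesis using assms(2,3)
    by (intro mod_homI)
      (simp_all add: mod_hom_closed mod_hom_add mod_hom_smult N.smult_r_distr N.R.m_comm
        flip: N.smult_assoc1)
qed

lemma mod_hom_diff:
  assumes "module R N" "f \<in> mod_hom R M N" "g \<in> mod_hom R M N"
  shows "(\<lambda>x. f x \<ominus>\<^bsub>N\<^esub> g x) \<in> mod_hom R M N"
proof -
  interpret N: module R N by fact
  show ?thesis using assms(2,3)
    by (intro mod_homI)
      (simp_all add: mod_hom_closed mod_hom_add mod_hom_smult a_minus_def N.smult_r_distr N.a_ac
        N.minus_add N.smult_r_minus)
qed

lemma mod_hom_inv_into:
  assumes "module R M" "f \<in> mod_hom R M N" "bij_betw f (carrier M) (carrier N)"
  shows "inv_into (carrier M) f \<in> mod_hom R N M"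
proof -
  interpret M: module R M by fact
  have cl: "inv_into (carrier M) f y \<in> carrier M" if "y \<in> carrier N" for y
    using that bij_betw_inv_into[OF assms(3)] by (auto simp: bij_betw_def)
  have f: "f (inv_into (carrier M) f y) = y" if "y \<in> carrier N" for y
    using that assms(3) by (simp add: bij_betw_inv_into_right)
  have eq: "inv_into (carrier M) f z = x" if "x \<in> carrier M" "z = f x" for x z
    using that assms(3) by (simp add: bij_betw_inv_into_left)
  show ?thesis
    by (rule mod_homI)
      (auto intro!: eq simp: cl f mod_hom_add[OF assms(2)] mod_hom_smult[OF assms(2)])
qed

lemma mod_iso_sym: "module R M \<Longrightarrow> mod_iso R M N \<Longrightarrow> mod_iso R N M"
  unfolding mod_iso_def using mod_hom_inv_into bij_betw_inv_into by blast

lemma mod_iso_trans: "mod_iso R M N \<Longrightarrow> mod_iso R N P \<Longrightarrow> mod_iso R M P"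
  unfolding mod_iso_def
proof (elim bexE)
  fix f g assume "f \<in> mod_hom R M N" "g \<in> mod_hom R N P"
    "bij_betw f (carrier M) (carrier N)" "bij_betw g (carrier N) (carrier P)"
  then show "\<exists>h\<in>mod_hom R M P. bij_betw h (carrier M) (carrier P)"
    using mod_hom_comp bij_betw_trans by (intro bexI[of _ "g \<circ> f"]) (auto simp: comp_def)
qed

lemma mod_iso_zero_mod:
  assumes "module R M" "module R N" "mod_iso R M N"
  shows "zero_mod M \<longleftrightarrow> zero_mod N"
proof -
  obtain f where f: "f \<in> mod_hom R M N" "bij_betw f (carrier M) (carrier N)"
    using assms(3) by (auto simp: mod_iso_def)
  note z = mod_hom_zero[OF assms(1,2) f(1)]
  interpret M: module R M by fact
  show ?thesis
  proof
    assume "zero_mod M"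
    then show "zero_mod N" using f(2) z by (auto simp: zero_mod_def bij_betw_def)
  next
    assume "zero_mod N"
    then have "f x = f \<zero>\<^bsub>M\<^esub>" if "x \<in> carrier M" for x
      using z that mod_hom_closed[OF f(1)] by (auto simp: zero_mod_def)
    then have "x = \<zero>\<^bsub>M\<^esub>" if "x \<in> carrier M" for x
      using that bij_betw_imp_inj_on[OF f(2)] M.zero_closed by (meson inj_onD)
    then show "zero_mod M" by (auto simp: zero_mod_def)
  qed
qed

section \<open>Submodules: intersections, images, preimages and spans\<close>

lemma submodule_Int:
  assumes "module R M" "\<And>N. N \<in> S \<Longrightarrow> submodule N R M" "S \<noteq> {}"
  shows "submodule (\<Inter>S) R M"
proof -
  interpret M: module R M by fact
  note E = M.submoduleE[OF assms(2)]
  have z: "\<zero>\<^bsub>M\<^esub> \<in> N" if "N \<in> S" for N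
    using submodule.axioms(1)[OF assms(2)[OF that]] subgroup.one_closed by fastforce
  show ?thesis
  proof (rule M.submoduleI)
    show "\<Inter>S \<subseteq> carrier M" using E(1) assms(3) by blast
  qed (use E(3,4,5) z in \<open>auto\<close>)
qed

lemma submodule_zero:
  assumes "module R M" "submodule N R M" shows "\<zero>\<^bsub>M\<^esub> \<in> N"
  using submodule.axioms(1)[OF assms(2)] subgroup.one_closed by fastforce

lemma submodule_minus:
  assumes "module R M" "submodule N R M" "x \<in> N" "y \<in> N" shows "x \<ominus>\<^bsub>M\<^esub> y \<in> N"
  using module.submoduleE(3,5)[OF assms(1,2)] assms(3,4) by (simp add: a_minus_def)

lemma submodule_image:
  assumes "module R M" "module R N" "f \<in> mod_hom R M N" "submodule K R M"
  shows "submodule (f ` K) R N"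
proof -
  interpret M: module R M by fact
  interpret N: module R N by fact
  note E = M.submoduleE[OF assms(4)]
  have KM: "x \<in> carrier M" if "x \<in> K" for x using E(1) that by auto
  show ?thesis
  proof (rule N.submoduleI)
    show "f ` K \<subseteq> carrier N" using KM mod_hom_closed[OF assms(3)] by auto
    show "\<zero>\<^bsub>N\<^esub> \<in> f ` K"
      using mod_hom_zero[OF assms(1-3)] submodule_zero[OF assms(1,4)] by (metis imageI)
    show "\<ominus>\<^bsub>N\<^esub> a \<in> f ` K" if a: "a \<in> f ` K" for a
    proof -
      obtain x where x: "x \<in> K" "a = f x" using a by auto
      then have "\<ominus>\<^bsub>N\<^esub> a = f (\<ominus>\<^bsub>M\<^esub> x)" using KM mod_hom_uminus[OF assms(1-3)] by simp
      then show ?thesis using E(3)[OF x(1)] by simp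
    qed
    show "a \<oplus>\<^bsub>N\<^esub> b \<in> f ` K" if ab: "a \<in> f ` K" "b \<in> f ` K" for a b
    proof -
      obtain x y where x: "x \<in> K" "a = f x" and y: "y \<in> K" "b = f y" using ab by auto
      then have "a \<oplus>\<^bsub>N\<^esub> b = f (x \<oplus>\<^bsub>M\<^esub> y)" using KM mod_hom_add[OF assms(3)] by simp
      then show ?thesis using E(5)[OF x(1) y(1)] by simp
    qed
    show "a \<odot>\<^bsub>N\<^esub> y \<in> f ` K" if ay: "a \<in> carrier R" "y \<in> f ` K" for a y
    proof -
      obtain x where x: "x \<in> K" "y = f x" using ay by auto
      then have "a \<odot>\<^bsub>N\<^esub> y = f (a \<odot>\<^bsub>M\<^esub> x)" using KM ay(1) mod_hom_smult[OF assms(3)] by simp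
      then show ?thesis using E(4)[OF ay(1) x(1)] by simp
    qed
  qed
qed

lemma submodule_vimage:
  assumes "module R M" "module R N" "f \<in> mod_hom R M N" "submodule K R N"
  shows "submodule {x \<in> carrier M. f x \<in> K} R M"
proof -
  interpret M: module R M by fact
  interpret N: module R N by fact
  note E = N.submoduleE[OF assms(4)]
  show ?thesis
    by (rule M.submoduleI)
      (use E submodule_zero[OF assms(2,4)] in \<open>auto simp: mod_hom_zero[OF assms(1-3)]
        mod_hom_uminus[OF assms(1-3)] mod_hom_add[OF assms(3)] mod_hom_smult[OF assms(3)]\<close>)
qed

lemma submodule_singleton_zero:
  assumes "module R M" shows "submodule {\<zero>\<^bsub>M\<^esub>} R M"
proof -
  interpret M: module R M by fact
  show ?thesis by (rule M.submoduleI) auto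
qed

lemma submodule_kernel:
  assumes "module R M" "module R N" "f \<in> mod_hom R M N"
  shows "submodule {x \<in> carrier M. f x = \<zero>\<^bsub>N\<^esub>} R M"
  using submodule_vimage[OF assms submodule_singleton_zero[OF assms(2)]] by simp

lemma mod_span_submodule:
  assumes "module R M" "A \<subseteq> carrier M" shows "submodule (mod_span R M A) R M"
  unfolding mod_span_def
  by (rule submodule_Int[OF assms(1)]) (use module.carrier_is_submodule assms in blast)+

lemma mod_span_superset: "A \<subseteq> mod_span R M A"
  by (auto simp: mod_span_def)

lemma mod_span_least: "submodule N R M \<Longrightarrow> A \<subseteq> N \<Longrightarrow> mod_span R M A \<subseteq> N"
  by (auto simp: mod_span_def)

lemma mod_hom_inj_onI:
  assumes "module R M" "module R N" "f \<in> mod_hom R M N"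
    and "\<And>x. x \<in> carrier M \<Longrightarrow> f x = \<zero>\<^bsub>N\<^esub> \<Longrightarrow> x = \<zero>\<^bsub>M\<^esub>"
  shows "inj_on f (carrier M)"
proof (rule inj_onI)
  interpret M: module R M by fact
  interpret N: module R N by fact
  fix x y assume xy: "x \<in> carrier M" "y \<in> carrier M" "f x = f y"
  then have "f (x \<ominus>\<^bsub>M\<^esub> y) = \<zero>\<^bsub>N\<^esub>"
    using mod_hom_closed[OF assms(3)]
    by (simp add: mod_hom_minus[OF assms(1-3)] N.minus_eq_zero_iff)
  then show "x = y" using assms(4) xy by (meson M.minus_eq_zero_iff M.minus_closed)
qed

section \<open>Quotient modules\<close>

lemma quot_mod_carrier:
  "carrier (quot_mod M B) = (\<lambda>x. B +>\<^bsub>M\<^esub> x) ` carrier M"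
  by (auto simp: quot_mod_def A_RCOSETS_def')

context
  fixes R :: "('a, 'q) ring_scheme" and M :: "('a, 'm) module" and B :: "'m set"
  assumes M: "module R M" and B: "submodule B R M"
begin

interpretation M: module R M by (rule M)

interpretation abelian_subgroup B M
proof (rule abelian_subgroupI3)
  show "additive_subgroup B M"
    using submodule.axioms(1)[OF B] by (simp add: additive_subgroup_def)
  show "abelian_group M" by unfold_locales
qed

lemma coset_eq_iff:
  assumes "x \<in> carrier M" "y \<in> carrier M"
  shows "B +>\<^bsub>M\<^esub> x = B +>\<^bsub>M\<^esub> y \<longleftrightarrow> x \<ominus>\<^bsub>M\<^esub> y \<in> B"
proof
  assume "B +>\<^bsub>M\<^esub> x = B +>\<^bsub>M\<^esub> y"
  then have "x \<in> B +>\<^bsub>M\<^esub> y" using a_rcos_self[OF assms(1)] by simp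
  then show "x \<ominus>\<^bsub>M\<^esub> y \<in> B" using a_rcos_module[OF assms(2,1)] by (simp add: a_minus_def)
next
  assume "x \<ominus>\<^bsub>M\<^esub> y \<in> B"
  then have "x \<in> B +>\<^bsub>M\<^esub> y" using assms a_rcos_module[of y x] by (simp add: a_minus_def)
  then show "B +>\<^bsub>M\<^esub> x = B +>\<^bsub>M\<^esub> y" using a_repr_independence'[OF _ assms(2)] by simp
qed

lemma quot_mod_add:
  assumes "x \<in> carrier M" "y \<in> carrier M"
  shows "(B +>\<^bsub>M\<^esub> x) \<oplus>\<^bsub>quot_mod M B\<^esub> (B +>\<^bsub>M\<^esub> y) = B +>\<^bsub>M\<^esub> (x \<oplus>\<^bsub>M\<^esub> y)"
  using a_rcos_sum[OF assms] by (simp add: quot_mod_def)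

text \<open>\<open>quot_mod\<close> takes a union over all representatives of the coset, so that
  none has to be chosen. Closure of \<open>B\<close> under scalars makes all the cosets in that
  union equal, and the union collapses.\<close>

lemma quot_mod_smult:
  assumes "a \<in> carrier R" "x \<in> carrier M"
  shows "a \<odot>\<^bsub>quot_mod M B\<^esub> (B +>\<^bsub>M\<^esub> x) = B +>\<^bsub>M\<^esub> (a \<odot>\<^bsub>M\<^esub> x)"
proof -
  have "B +>\<^bsub>M\<^esub> (a \<odot>\<^bsub>M\<^esub> y) = B +>\<^bsub>M\<^esub> (a \<odot>\<^bsub>M\<^esub> x)" if "y \<in> B +>\<^bsub>M\<^esub> x" for y
  proof -
    have y: "y \<in> carrier M" using that M.a_r_coset_subset_G[OF a_subset assms(2)] by auto
    have "y \<ominus>\<^bsub>M\<^esub> x \<in> B" using that a_rcos_module[OF assms(2) y] by (simp add: a_minus_def)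
    then have "a \<odot>\<^bsub>M\<^esub> (y \<ominus>\<^bsub>M\<^esub> x) \<in> B" using M.submoduleE(4)[OF B assms(1)] by blast
    then show ?thesis
      using assms y
      by (subst coset_eq_iff) (simp_all add: a_minus_def M.smult_r_distr M.smult_r_minus)
  qed
  then have "\<forall>y\<in>B +>\<^bsub>M\<^esub> x. B +>\<^bsub>M\<^esub> (a \<odot>\<^bsub>M\<^esub> y) = B +>\<^bsub>M\<^esub> (a \<odot>\<^bsub>M\<^esub> x)" ..
  from UN_constant_eq[OF a_rcos_self[OF assms(2)] this] show ?thesis
    by (simp add: quot_mod_def)
qed

lemma quot_mod_zero: "\<zero>\<^bsub>quot_mod M B\<^esub> = B +>\<^bsub>M\<^esub> \<zero>\<^bsub>M\<^esub>"
  using M.a_coset_add_zero[OF a_subset] by (simp add: quot_mod_def)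

lemma coset_hom: "(\<lambda>x. B +>\<^bsub>M\<^esub> x) \<in> mod_hom R M (quot_mod M B)"
  by (rule mod_homI) (simp_all add: quot_mod_add quot_mod_smult quot_mod_carrier)

lemma coset_eq_zero_iff:
  assumes "x \<in> carrier M"
  shows "B +>\<^bsub>M\<^esub> x = \<zero>\<^bsub>quot_mod M B\<^esub> \<longleftrightarrow> x \<in> B"
  unfolding quot_mod_zero using assms by (subst coset_eq_iff) (simp_all add: M.minus_zero_right)

lemma module_quot_mod: "module R (quot_mod M B)"
proof (rule moduleI)
  show "cring R" by unfold_locales
  note s = quot_mod_add quot_mod_smult quot_mod_zero quot_mod_carrier
  show "abelian_group (quot_mod M B)"
  proof (rule abelian_groupI)
    fix X assume "X \<in> carrier (quot_mod M B)"
    then obtain x where x: "x \<in> carrier M" "X = B +>\<^bsub>M\<^esub> x" by (auto simp: s)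
    then have "(B +>\<^bsub>M\<^esub> (\<ominus>\<^bsub>M\<^esub> x)) \<oplus>\<^bsub>quot_mod M B\<^esub> X = \<zero>\<^bsub>quot_mod M B\<^esub>"
      by (simp add: s M.l_neg)
    then show "\<exists>Y\<in>carrier (quot_mod M B). Y \<oplus>\<^bsub>quot_mod M B\<^esub> X = \<zero>\<^bsub>quot_mod M B\<^esub>"
      using x by (auto simp: s)
  qed (auto simp: s M.a_ac)
qed (auto simp: quot_mod_add quot_mod_smult quot_mod_carrier M.smult_l_distr M.smult_r_distr
      M.smult_assoc1)

text \<open>\<open>h\<close> evaluates \<open>f\<close> at a chosen representative; two
  representatives differ by an element of \<open>B\<close>, which \<open>f\<close> kills.\<close>

lemma quot_mod_lift:
  assumes "module R N" "f \<in> mod_hom R M N" "\<And>x. x \<in> B \<Longrightarrow> f x = \<zero>\<^bsub>N\<^esub>"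
  obtains h where "h \<in> mod_hom R (quot_mod M B) N" "\<And>x. x \<in> carrier M \<Longrightarrow> h (B +>\<^bsub>M\<^esub> x) = f x"
proof -
  interpret N: module R N by fact
  define h where "h X = f (SOME x. x \<in> carrier M \<and> X = B +>\<^bsub>M\<^esub> x)" for X
  have h: "h (B +>\<^bsub>M\<^esub> x) = f x" if x: "x \<in> carrier M" for x
  proof -
    define y where "y = (SOME y. y \<in> carrier M \<and> B +>\<^bsub>M\<^esub> x = B +>\<^bsub>M\<^esub> y)"
    have "y \<in> carrier M \<and> B +>\<^bsub>M\<^esub> x = B +>\<^bsub>M\<^esub> y"
      unfolding y_def by (rule someI[of _ x]) (use x in simp)
    then have y: "y \<in> carrier M" "x \<ominus>\<^bsub>M\<^esub> y \<in> B" using coset_eq_iff x by auto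
    have "f x \<ominus>\<^bsub>N\<^esub> f y = \<zero>\<^bsub>N\<^esub>"
      using mod_hom_minus[OF M assms(1,2) x y(1)] assms(3)[OF y(2)] by simp
    then have "f x = f y" using x y(1) mod_hom_closed[OF assms(2)] by (meson N.minus_eq_zero_iff)
    then show ?thesis by (simp add: h_def y_def)
  qed
  have "h \<in> mod_hom R (quot_mod M B) N"
    by (rule mod_homI)
      (auto simp: quot_mod_carrier quot_mod_add quot_mod_smult h mod_hom_closed[OF assms(2)]
        mod_hom_add[OF assms(2)] mod_hom_smult[OF assms(2)])
  then show thesis using that h by blast
qed

text \<open>First isomorphism theorem, with \<open>B\<close> matched to the kernel as a hypothesis
  so that exactness of a complex can be plugged in directly.\<close>

lemma quot_mod_iso:
  assumes "module R N" "f \<in> mod_hom R M N" "f ` carrier M = carrier N"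
    and "{x \<in> carrier M. f x = \<zero>\<^bsub>N\<^esub>} = B"
  shows "mod_iso R (quot_mod M B) N"
proof -
  interpret N: module R N by fact
  obtain h where h: "h \<in> mod_hom R (quot_mod M B) N"
      "\<And>x. x \<in> carrier M \<Longrightarrow> h (B +>\<^bsub>M\<^esub> x) = f x"
    using quot_mod_lift[OF assms(1,2)] assms(4) by blast
  have "X = \<zero>\<^bsub>quot_mod M B\<^esub>" if X: "X \<in> carrier (quot_mod M B)" "h X = \<zero>\<^bsub>N\<^esub>" for X
  proof -
    obtain x where x: "x \<in> carrier M" "X = B +>\<^bsub>M\<^esub> x" using X(1) by (auto simp: quot_mod_carrier)
    then have "x \<in> B" using X(2) h(2) unfolding assms(4)[symmetric] by simp
    then show ?thesis using x coset_eq_zero_iff by simp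
  qed
  then have "inj_on h (carrier (quot_mod M B))"
    by (rule mod_hom_inj_onI[OF module_quot_mod assms(1) h(1)])
  moreover have "h ` carrier (quot_mod M B) = carrier N"
    unfolding quot_mod_carrier image_image assms(3)[symmetric]
    by (rule image_cong[OF refl h(2)])
  ultimately show ?thesis using h(1) by (auto simp: mod_iso_def bij_betw_def)
qed

lemma zero_mod_quot_mod: "zero_mod (quot_mod M B) \<longleftrightarrow> carrier M = B"
proof -
  have "zero_mod (quot_mod M B) \<longleftrightarrow> (\<forall>x\<in>carrier M. B +>\<^bsub>M\<^esub> x = \<zero>\<^bsub>quot_mod M B\<^esub>)"
    using M.zero_closed by (auto simp: zero_mod_def quot_mod_carrier)
  also have "\<dots> \<longleftrightarrow> carrier M \<subseteq> B" by (auto simp: coset_eq_zero_iff)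
  finally show ?thesis using M.submoduleE(1)[OF B] by auto
qed

end

section \<open>Finite sums and dual bases\<close>

lemma mod_hom_finsum:
  assumes "module R M" "module R N" "f \<in> mod_hom R M N" "finite A" "x \<in> A \<rightarrow> carrier M"
  shows "f (\<Oplus>\<^bsub>M\<^esub>k\<in>A. x k) = (\<Oplus>\<^bsub>N\<^esub>k\<in>A. f (x k))"
proof -
  interpret M: module R M by fact
  interpret N: module R N by fact
  note [simp] = mod_hom_zero[OF assms(1-3)] mod_hom_add[OF assms(3)]
    mod_hom_closed[OF assms(3)]
  show ?thesis using assms(4,5)
  proof (induction A rule: finite_induct)
    case (insert a A)
    then have "x a \<in> carrier M" "x \<in> A \<rightarrow> carrier M" "(\<lambda>k. f (x k)) \<in> A \<rightarrow> carrier N"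
      by (auto intro!: mod_hom_closed[OF assms(3)])
    with insert show ?case by simp
  qed simp
qed

lemma finsum_submodule:
  assumes "module R M" "submodule N R M" "finite A" "\<And>k. k \<in> A \<Longrightarrow> x k \<in> N"
  shows "(\<Oplus>\<^bsub>M\<^esub>k\<in>A. x k) \<in> N"
proof -
  interpret M: module R M by fact
  note E = M.submoduleE[OF assms(2)]
  show ?thesis using assms(3,4)
  proof (induction A rule: finite_induct)
    case empty
    then show ?case using submodule_zero[OF assms(1,2)] by simp
  next
    case (insert a A)
    then have "x a \<in> carrier M" "x \<in> A \<rightarrow> carrier M" using E(1) by auto
    with insert E(5) show ?case by simp
  qed
qed

section \<open>The regular module and the free modules R^n\<close>

lemma module_regular:
  assumes "cring R" shows "module R (regular_mod R)"
proof -
  interpret R: cring R by fact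
  show ?thesis
  proof (rule moduleI)
    show "abelian_group (regular_mod R)"
      by (rule abelian_groupI)
        (auto simp: regular_mod_def R.add.m_assoc R.add.m_lcomm R.add.m_comm intro: R.l_neg)
  qed (auto simp: regular_mod_def R.l_distr R.r_distr R.m_assoc assms)
qed

lemma regular_simps [simp]:
  "carrier (regular_mod R) = carrier R"
  "\<zero>\<^bsub>regular_mod R\<^esub> = \<zero>\<^bsub>R\<^esub>"
  "x \<oplus>\<^bsub>regular_mod R\<^esub> y = x \<oplus>\<^bsub>R\<^esub> y"
  "x \<odot>\<^bsub>regular_mod R\<^esub> y = x \<otimes>\<^bsub>R\<^esub> y"
  by (simp_all add: regular_mod_def)

lemma free_mod_simps:
  "carrier (free_mod R n) = {..<n} \<rightarrow>\<^sub>E carrier R"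
  "k < n \<Longrightarrow> \<zero>\<^bsub>free_mod R n\<^esub> k = \<zero>\<^bsub>R\<^esub>"
  "k < n \<Longrightarrow> (u \<oplus>\<^bsub>free_mod R n\<^esub> v) k = u k \<oplus>\<^bsub>R\<^esub> v k"
  "k < n \<Longrightarrow> (a \<odot>\<^bsub>free_mod R n\<^esub> v) k = a \<otimes>\<^bsub>R\<^esub> v k"
  by (simp_all add: free_mod_def)

lemma free_mod_eqI:
  assumes "u \<in> carrier (free_mod R n)" "v \<in> carrier (free_mod R n)" "\<And>k. k < n \<Longrightarrow> u k = v k"
  shows "u = v"
  using assms by (intro PiE_ext[of u "{..<n}" "\<lambda>_. carrier R" v]) (auto simp: free_mod_simps(1))

lemma module_free:
  assumes "cring R" shows "module R (free_mod R n)"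
proof -
  interpret R: cring R by fact
  let ?F = "free_mod R n"
  have cl: "x k \<in> carrier R" if "x \<in> carrier ?F" "k < n" for x k
    using that by (auto simp: free_mod_simps(1))
  have mem: "restrict x {..<n} \<in> carrier ?F" if "\<And>k. k < n \<Longrightarrow> x k \<in> carrier R" for x
    using that by (simp add: free_mod_simps(1))
  have add: "x \<oplus>\<^bsub>?F\<^esub> y \<in> carrier ?F" if "x \<in> carrier ?F" "y \<in> carrier ?F" for x y
    using mem[of "\<lambda>k. x k \<oplus>\<^bsub>R\<^esub> y k"] that
      by (simp add: free_mod_def cl[unfolded free_mod_def, simplified])
  have smult: "a \<odot>\<^bsub>?F\<^esub> x \<in> carrier ?F" if "a \<in> carrier R" "x \<in> carrier ?F" for a x
    using mem[of "\<lambda>k. a \<otimes>\<^bsub>R\<^esub> x k"] that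
      by (simp add: free_mod_def cl[unfolded free_mod_def, simplified])
  have zero: "\<zero>\<^bsub>?F\<^esub> \<in> carrier ?F" using mem[of "\<lambda>_. \<zero>\<^bsub>R\<^esub>"] by (simp add: free_mod_def)
  note s = free_mod_simps(2-)
  show ?thesis
  proof (rule moduleI)
    show "abelian_group ?F"
    proof (rule abelian_groupI)
      fix x assume x: "x \<in> carrier ?F"
      let ?y = "\<lambda>k\<in>{..<n}. \<ominus>\<^bsub>R\<^esub> x k"
      have y: "?y \<in> carrier ?F" by (rule mem) (simp add: cl[OF x])
      have "?y \<oplus>\<^bsub>?F\<^esub> x = \<zero>\<^bsub>?F\<^esub>"
        by (rule free_mod_eqI[OF add[OF y x] zero]) (simp add: s cl[OF x] R.l_neg)
      then show "\<exists>y\<in>carrier ?F. y \<oplus>\<^bsub>?F\<^esub> x = \<zero>\<^bsub>?F\<^esub>" using y by blast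
    next
      fix x assume x: "x \<in> carrier ?F"
      show "\<zero>\<^bsub>?F\<^esub> \<oplus>\<^bsub>?F\<^esub> x = x"
        by (rule free_mod_eqI[of _ R n]) (simp_all add: add zero x s cl)
    next
      fix x y assume x: "x \<in> carrier ?F" and y: "y \<in> carrier ?F"
      show "x \<oplus>\<^bsub>?F\<^esub> y = y \<oplus>\<^bsub>?F\<^esub> x"
        by (rule free_mod_eqI[of _ R n]) (simp_all add: add x y s cl R.a_comm)
      fix z assume z: "z \<in> carrier ?F"
      show "x \<oplus>\<^bsub>?F\<^esub> y \<oplus>\<^bsub>?F\<^esub> z = x \<oplus>\<^bsub>?F\<^esub> (y \<oplus>\<^bsub>?F\<^esub> z)"
        by (rule free_mod_eqI[of _ R n]) (simp_all add: add x y z s cl R.a_assoc)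
    qed (fact add zero)+
  next
    fix x assume x: "x \<in> carrier ?F"
    show "\<one>\<^bsub>R\<^esub> \<odot>\<^bsub>?F\<^esub> x = x"
      by (rule free_mod_eqI[of _ R n]) (simp_all add: smult x s cl)
    fix a assume a: "a \<in> carrier R"
    show "a \<odot>\<^bsub>?F\<^esub> (x \<oplus>\<^bsub>?F\<^esub> y) = a \<odot>\<^bsub>?F\<^esub> x \<oplus>\<^bsub>?F\<^esub> a \<odot>\<^bsub>?F\<^esub> y" if y: "y \<in> carrier ?F" for y
      by (rule free_mod_eqI[of _ R n]) (simp_all add: smult add x y a s cl R.r_distr)
    fix b assume b: "b \<in> carrier R"
    show "(a \<oplus>\<^bsub>R\<^esub> b) \<odot>\<^bsub>?F\<^esub> x = a \<odot>\<^bsub>?F\<^esub> x \<oplus>\<^bsub>?F\<^esub> b \<odot>\<^bsub>?F\<^esub> x"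
      by (rule free_mod_eqI[of _ R n]) (simp_all add: smult add x a b s cl R.l_distr)
    show "(a \<otimes>\<^bsub>R\<^esub> b) \<odot>\<^bsub>?F\<^esub> x = a \<odot>\<^bsub>?F\<^esub> (b \<odot>\<^bsub>?F\<^esub> x)"
      by (rule free_mod_eqI[of _ R n]) (simp_all add: smult x a b s cl R.m_assoc)
  qed (fact assms smult)+
qed

lemma coordinate_hom: "k < n \<Longrightarrow> (\<lambda>v. v k) \<in> mod_hom R (free_mod R n) (regular_mod R)"
  by (rule mod_homI) (auto simp: free_mod_simps)

definition unit_vec :: "('a, 'q) ring_scheme \<Rightarrow> nat \<Rightarrow> nat \<Rightarrow> nat \<Rightarrow> 'a" where
  "unit_vec R n k = (\<lambda>j\<in>{..<n}. if j = k then \<one>\<^bsub>R\<^esub> else \<zero>\<^bsub>R\<^esub>)"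

lemma unit_vec_closed: "cring R \<Longrightarrow> unit_vec R n k \<in> carrier (free_mod R n)"
proof -
  assume "cring R" then interpret cring R .
  show ?thesis by (auto simp: unit_vec_def free_mod_simps)
qed

text \<open>A coordinate is a homomorphism to R, so it passes inside the sum, where a single term
  survives.\<close>

lemma free_mod_expansion:
  assumes "cring R" "v \<in> carrier (free_mod R n)"
  shows "v = (\<Oplus>\<^bsub>free_mod R n\<^esub>k\<in>{..<n}. v k \<odot>\<^bsub>free_mod R n\<^esub> unit_vec R n k)" (is "_ = ?s")
proof (rule extensionalityI[of _ "{..<n}"])
  interpret R: cring R by fact
  interpret reg: module R "regular_mod R" by (rule module_regular[OF assms(1)])
  interpret F: module R "free_mod R n" by (rule module_free[OF assms(1)])
  have v: "v k \<in> carrier R" if "k < n" for k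
    using that assms(2) by (simp add: free_mod_simps(1) PiE_iff)
  have t: "(\<lambda>k. v k \<odot>\<^bsub>free_mod R n\<^esub> unit_vec R n k) \<in> {..<n} \<rightarrow> carrier (free_mod R n)"
    using v unit_vec_closed[OF assms(1)] by (intro Pi_I F.smult_closed) simp_all
  show "v \<in> extensional {..<n}" using assms(2) by (simp add: free_mod_simps(1) PiE_iff)
  have "?s \<in> carrier (free_mod R n)" using t by (rule F.finsum_closed)
  then show "?s \<in> extensional {..<n}" by (simp add: free_mod_simps(1) PiE_iff)
  fix j assume j: "j \<in> {..<n}"
  have "?s j = (\<Oplus>\<^bsub>regular_mod R\<^esub>k\<in>{..<n}. (v k \<odot>\<^bsub>free_mod R n\<^esub> unit_vec R n k) j)"
    using j t by (intro mod_hom_finsum[OF module_free module_regular coordinate_hom] assms) auto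
  also have "\<dots> = (\<Oplus>\<^bsub>regular_mod R\<^esub>k\<in>{..<n}. if j = k then v k else \<zero>\<^bsub>regular_mod R\<^esub>)"
    using j v by (intro reg.finsum_cong') (auto simp: free_mod_simps unit_vec_def)
  also have "\<dots> = v j" using j v by (intro reg.finsum_singleton) auto
  finally show "v j = ?s j" by simp
qed

text \<open>The device that builds homomorphisms with prescribed values on generators; it serves
  both for lifting and for the retraction onto a dual module.\<close>

lemma linear_combination_hom:
  assumes "module R N" "\<And>k. k < n \<Longrightarrow> c k \<in> mod_hom R M (regular_mod R)"
    and "\<And>k. k < n \<Longrightarrow> y k \<in> carrier N"
  shows "(\<lambda>x. \<Oplus>\<^bsub>N\<^esub>k\<in>{..<n::nat}. c k x \<odot>\<^bsub>N\<^esub> y k) \<in> mod_hom R M N"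
proof -
  interpret N: module R N by fact
  have cl: "c k x \<in> carrier R" if "k < n" "x \<in> carrier M" for k x
    using mod_hom_closed[OF assms(2)] that by auto
  show ?thesis
  proof (rule mod_homI)
    fix x z assume xz: "x \<in> carrier M" "z \<in> carrier M"
    have "(\<Oplus>\<^bsub>N\<^esub>k\<in>{..<n}. c k (x \<oplus>\<^bsub>M\<^esub> z) \<odot>\<^bsub>N\<^esub> y k)
        = (\<Oplus>\<^bsub>N\<^esub>k\<in>{..<n}. c k x \<odot>\<^bsub>N\<^esub> y k \<oplus>\<^bsub>N\<^esub> c k z \<odot>\<^bsub>N\<^esub> y k)"
      using xz by (intro N.finsum_cong')
        (auto simp: cl assms(3) mod_hom_add[OF assms(2)] N.smult_l_distr)
    also have "\<dots> = (\<Oplus>\<^bsub>N\<^esub>k\<in>{..<n}. c k x \<odot>\<^bsub>N\<^esub> y k) \<oplus>\<^bsub>N\<^esub> (\<Oplus>\<^bsub>N\<^esub>k\<in>{..<n}. c k z \<odot>\<^bsub>N\<^esub> y k)"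
      using xz by (intro N.finsum_addf) (auto simp: cl assms(3))
    finally show "(\<Oplus>\<^bsub>N\<^esub>k\<in>{..<n}. c k (x \<oplus>\<^bsub>M\<^esub> z) \<odot>\<^bsub>N\<^esub> y k) = \<dots>" .
  next
    fix a x assume ax: "a \<in> carrier R" "x \<in> carrier M"
    have "(\<Oplus>\<^bsub>N\<^esub>k\<in>{..<n}. c k (a \<odot>\<^bsub>M\<^esub> x) \<odot>\<^bsub>N\<^esub> y k)
        = (\<Oplus>\<^bsub>N\<^esub>k\<in>{..<n}. a \<odot>\<^bsub>N\<^esub> (c k x \<odot>\<^bsub>N\<^esub> y k))"
      using ax by (intro N.finsum_cong')
        (auto simp: cl assms(3) mod_hom_smult[OF assms(2)] N.smult_assoc1)
    also have "\<dots> = a \<odot>\<^bsub>N\<^esub> (\<Oplus>\<^bsub>N\<^esub>k\<in>{..<n}. c k x \<odot>\<^bsub>N\<^esub> y k)"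
      using ax by (intro N.finsum_smult_ldistr[symmetric]) (auto simp: cl assms(3))
    finally show "(\<Oplus>\<^bsub>N\<^esub>k\<in>{..<n}. c k (a \<odot>\<^bsub>M\<^esub> x) \<odot>\<^bsub>N\<^esub> y k) = \<dots>" .
  qed (auto intro!: N.finsum_closed simp: cl assms(3))
qed

section \<open>Hom modules, dual bases and duals of finitely generated projectives\<close>

lemma Hom_mod_simps:
  "carrier (Hom_mod R M N) = mod_hom R M N \<inter> extensional (carrier M)"
  "x \<in> carrier M \<Longrightarrow> \<zero>\<^bsub>Hom_mod R M N\<^esub> x = \<zero>\<^bsub>N\<^esub>"
  "x \<in> carrier M \<Longrightarrow> (f \<oplus>\<^bsub>Hom_mod R M N\<^esub> g) x = f x \<oplus>\<^bsub>N\<^esub> g x"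
  "x \<in> carrier M \<Longrightarrow> (a \<odot>\<^bsub>Hom_mod R M N\<^esub> f) x = a \<odot>\<^bsub>N\<^esub> f x"
  by (simp_all add: Hom_mod_def)

text \<open>\<open>mod_hom\<close> constrains a function only on the carrier. \<open>Hom_mod\<close>
  therefore keeps only extensional functions, so that equal maps are equal elements, and a map must
  be restricted before it counts as an element.\<close>

lemma restrict_in_Hom_mod:
  "module R M \<Longrightarrow> f \<in> mod_hom R M N \<Longrightarrow> restrict f (carrier M) \<in> carrier (Hom_mod R M N)"
  using mod_hom_cong[of R M f N "restrict f (carrier M)"] by (simp add: Hom_mod_simps)

lemma Hom_mod_eqI:
  assumes "f \<in> carrier (Hom_mod R M N)" "g \<in> carrier (Hom_mod R M N)"
    and "\<And>x. x \<in> carrier M \<Longrightarrow> f x = g x"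
  shows "f = g"
  using assms by (intro extensionalityI[of _ "carrier M"]) (auto simp: Hom_mod_simps)

lemma module_Hom_mod:
  assumes M: "module R M" and N: "module R N"
  shows "module R (Hom_mod R M N)"
proof -
  interpret M: module R M by fact
  interpret N: module R N by fact
  have D: "f \<in> mod_hom R M N" if "f \<in> carrier (Hom_mod R M N)" for f
    using that by (simp add: Hom_mod_simps)
  note cl = mod_hom_closed[OF D]
  have add: "f \<oplus>\<^bsub>Hom_mod R M N\<^esub> g \<in> carrier (Hom_mod R M N)"
    if "f \<in> carrier (Hom_mod R M N)" "g \<in> carrier (Hom_mod R M N)" for f g
    using restrict_in_Hom_mod[OF M mod_hom_plus[OF N D D]] that by (simp add: Hom_mod_def)
  have smult: "a \<odot>\<^bsub>Hom_mod R M N\<^esub> f \<in> carrier (Hom_mod R M N)"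
    if "a \<in> carrier R" "f \<in> carrier (Hom_mod R M N)" for a f
    using restrict_in_Hom_mod[OF M mod_hom_scale[OF N D]] that by (simp add: Hom_mod_def)
  have zero: "\<zero>\<^bsub>Hom_mod R M N\<^esub> \<in> carrier (Hom_mod R M N)"
    using restrict_in_Hom_mod[OF M mod_hom_const_zero[OF N]] by (simp add: Hom_mod_def)
  have uminus: "(\<lambda>x\<in>carrier M. \<ominus>\<^bsub>N\<^esub> f x) \<in> carrier (Hom_mod R M N)"
    if "f \<in> carrier (Hom_mod R M N)" for f
  proof (rule restrict_in_Hom_mod[OF M mod_homI])
  qed (use D[OF that] in \<open>auto simp: mod_hom_closed mod_hom_add mod_hom_smult N.minus_add
        N.a_comm N.smult_r_minus\<close>)
  show ?thesis
  proof (rule moduleI)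
    show "cring R" by unfold_locales
    show "abelian_group (Hom_mod R M N)"
    proof (rule abelian_groupI)
      fix f assume f: "f \<in> carrier (Hom_mod R M N)"
      have "(\<lambda>x\<in>carrier M. \<ominus>\<^bsub>N\<^esub> f x) \<oplus>\<^bsub>Hom_mod R M N\<^esub> f = \<zero>\<^bsub>Hom_mod R M N\<^esub>"
        by (rule Hom_mod_eqI[OF add[OF uminus] zero]) (simp_all add: f Hom_mod_simps(2-) cl N.l_neg)
      then show "\<exists>g\<in>carrier (Hom_mod R M N). g \<oplus>\<^bsub>Hom_mod R M N\<^esub> f = \<zero>\<^bsub>Hom_mod R M N\<^esub>"
        using uminus[OF f] by blast
    next
      fix f g h
      assume f: "f \<in> carrier (Hom_mod R M N)" and g: "g \<in> carrier (Hom_mod R M N)"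
        and h: "h \<in> carrier (Hom_mod R M N)"
      show "f \<oplus>\<^bsub>Hom_mod R M N\<^esub> g \<oplus>\<^bsub>Hom_mod R M N\<^esub> h
          = f \<oplus>\<^bsub>Hom_mod R M N\<^esub> (g \<oplus>\<^bsub>Hom_mod R M N\<^esub> h)"
        by (rule Hom_mod_eqI[of _ R M N]) (simp_all add: f g h add Hom_mod_simps(2-) cl N.a_assoc)
    next
      fix f g
      assume f: "f \<in> carrier (Hom_mod R M N)" and g: "g \<in> carrier (Hom_mod R M N)"
      show "f \<oplus>\<^bsub>Hom_mod R M N\<^esub> g = g \<oplus>\<^bsub>Hom_mod R M N\<^esub> f"
        by (rule Hom_mod_eqI[of _ R M N]) (simp_all add: f g add Hom_mod_simps(2-) cl N.a_comm)
    next
      fix f assume f: "f \<in> carrier (Hom_mod R M N)"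
      show "\<zero>\<^bsub>Hom_mod R M N\<^esub> \<oplus>\<^bsub>Hom_mod R M N\<^esub> f = f"
        by (rule Hom_mod_eqI[of _ R M N]) (simp_all add: f zero add Hom_mod_simps(2-) cl)
    qed (fact add zero)+
  next
    fix a b f assume a: "a \<in> carrier R" and b: "b \<in> carrier R" and f: "f \<in> carrier (Hom_mod R M N)"
    show "(a \<oplus>\<^bsub>R\<^esub> b) \<odot>\<^bsub>Hom_mod R M N\<^esub> f
        = a \<odot>\<^bsub>Hom_mod R M N\<^esub> f \<oplus>\<^bsub>Hom_mod R M N\<^esub> b \<odot>\<^bsub>Hom_mod R M N\<^esub> f"
      by (rule Hom_mod_eqI[of _ R M N]) (simp_all add: a b f add smult Hom_mod_simps(2-) cl N.smult_l_distr)
    show "(a \<otimes>\<^bsub>R\<^esub> b) \<odot>\<^bsub>Hom_mod R M N\<^esub> f = a \<odot>\<^bsub>Hom_mod R M N\<^esub> (b \<odot>\<^bsub>Hom_mod R M N\<^esub> f)"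
      by (rule Hom_mod_eqI[of _ R M N]) (simp_all add: a b f add smult Hom_mod_simps(2-) cl N.smult_assoc1)
  next
    fix a f g assume a: "a \<in> carrier R" and f: "f \<in> carrier (Hom_mod R M N)"
      and g: "g \<in> carrier (Hom_mod R M N)"
    show "a \<odot>\<^bsub>Hom_mod R M N\<^esub> (f \<oplus>\<^bsub>Hom_mod R M N\<^esub> g)
        = a \<odot>\<^bsub>Hom_mod R M N\<^esub> f \<oplus>\<^bsub>Hom_mod R M N\<^esub> a \<odot>\<^bsub>Hom_mod R M N\<^esub> g"
      by (rule Hom_mod_eqI[of _ R M N]) (simp_all add: a f g add smult Hom_mod_simps(2-) cl N.smult_r_distr)
  next
    fix f assume f: "f \<in> carrier (Hom_mod R M N)"
    show "\<one>\<^bsub>R\<^esub> \<odot>\<^bsub>Hom_mod R M N\<^esub> f = f"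
      by (rule Hom_mod_eqI[of _ R M N]) (simp_all add: f smult Hom_mod_simps(2-) cl)
  qed (fact smult)
qed

text \<open>Linearity of evaluation is what allows sums and differences in \<open>Hom_mod\<close> to
  be computed pointwise.\<close>

lemma evaluation_hom:
  "x \<in> carrier M \<Longrightarrow> (\<lambda>f. f x) \<in> mod_hom R (Hom_mod R M N) N"
  by (rule mod_homI) (auto simp: Hom_mod_simps mod_hom_closed)

text \<open>The data of the dual basis lemma: generators together with coordinate functionals.
  Coordinates need not be unique, so this captures projective modules and replaces a basis
  throughout.\<close>

definition dual_basis ::
  "('a, 'q) ring_scheme \<Rightarrow> ('a, 'm) module \<Rightarrow> nat \<Rightarrow> (nat \<Rightarrow> 'm) \<Rightarrow> (nat \<Rightarrow> 'm \<Rightarrow> 'a) \<Rightarrow> bool" where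
  "dual_basis R P n e c \<longleftrightarrow> (\<forall>k<n. e k \<in> carrier P \<and> c k \<in> carrier (dual_mod R P))
     \<and> (\<forall>x\<in>carrier P. x = (\<Oplus>\<^bsub>P\<^esub>k\<in>{..<n}. c k x \<odot>\<^bsub>P\<^esub> e k))"

text \<open>Given a retraction \<open>p\<close> of R^n onto \<open>P\<close> with section
  \<open>s\<close>, the generators are the images of the unit vectors under \<open>p\<close> and the
  functionals are the coordinates of \<open>s\<close>.\<close>

lemma fg_projective_dual_basis:
  assumes P: "module R P" and "fg_projective R P"
  obtains n e c where "dual_basis R P n e c"
proof -
  interpret P: module R P by fact
  have cr: "cring R" by unfold_locales
  obtain n s p where s: "s \<in> mod_hom R P (free_mod R n)" and p: "p \<in> mod_hom R (free_mod R n) P"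
    and ps: "\<And>x. x \<in> carrier P \<Longrightarrow> p (s x) = x"
    using assms(2) by (auto simp: fg_projective_def)
  note F = module_free[OF cr, of n]
  interpret F: module R "free_mod R n" by (rule F)
  define e where "e k = p (unit_vec R n k)" for k
  define c where "c k = restrict (\<lambda>x. s x k) (carrier P)" for k
  note u = unit_vec_closed[OF cr, of n]
  have e: "e k \<in> carrier P" for k unfolding e_def by (rule mod_hom_closed[OF p u])
  have c: "c k \<in> carrier (dual_mod R P)" if "k < n" for k
    unfolding c_def dual_mod_def
    by (rule restrict_in_Hom_mod[OF P mod_hom_comp[OF s coordinate_hom[OF that]]])
  have "x = (\<Oplus>\<^bsub>P\<^esub>k\<in>{..<n}. c k x \<odot>\<^bsub>P\<^esub> e k)" if x: "x \<in> carrier P" for x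
  proof -
    note sx = mod_hom_closed[OF s x]
    have sk: "s x k \<in> carrier R" if "k < n" for k using sx that by (auto simp: free_mod_simps)
    have "x = p (\<Oplus>\<^bsub>free_mod R n\<^esub>k\<in>{..<n}. s x k \<odot>\<^bsub>free_mod R n\<^esub> unit_vec R n k)"
      using free_mod_expansion[OF cr sx] ps[OF x] by simp
    also have "\<dots> = (\<Oplus>\<^bsub>P\<^esub>k\<in>{..<n}. p (s x k \<odot>\<^bsub>free_mod R n\<^esub> unit_vec R n k))"
      by (rule mod_hom_finsum[OF F P p]) (auto simp: sk u)
    also have "\<dots> = (\<Oplus>\<^bsub>P\<^esub>k\<in>{..<n}. c k x \<odot>\<^bsub>P\<^esub> e k)"
      by (rule P.finsum_cong') (auto simp: sk u x e c_def mod_hom_smult[OF p] simp flip: e_def)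
    finally show ?thesis .
  qed
  then show thesis using that[of n e c] e c by (auto simp: dual_basis_def)
qed

lemma dual_basisD:
  assumes "dual_basis R P n e c"
  shows "k < n \<Longrightarrow> e k \<in> carrier P" "k < n \<Longrightarrow> c k \<in> carrier (dual_mod R P)"
    "k < n \<Longrightarrow> c k \<in> mod_hom R P (regular_mod R)"
    "k < n \<Longrightarrow> x \<in> carrier P \<Longrightarrow> c k x \<in> carrier R"
  using assms mod_hom_closed[of "c k" R P "regular_mod R" x]
  by (auto simp: dual_basis_def dual_mod_def Hom_mod_simps)

lemma dual_basis_expansion:
  assumes "dual_basis R P n e c" "x \<in> carrier P"
  shows "(\<Oplus>\<^bsub>P\<^esub>k\<in>{..<n}. c k x \<odot>\<^bsub>P\<^esub> e k) = x"
  using assms unfolding dual_basis_def by metis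

lemma dual_basis_hom_expansion:
  assumes "module R P" "module R N" "dual_basis R P n e c" "f \<in> mod_hom R P N" "x \<in> carrier P"
  shows "f x = (\<Oplus>\<^bsub>N\<^esub>k\<in>{..<n}. c k x \<odot>\<^bsub>N\<^esub> f (e k))"
proof -
  interpret P: module R P by fact
  interpret N: module R N by fact
  note D = dual_basisD[OF assms(3)]
  have "f x = f (\<Oplus>\<^bsub>P\<^esub>k\<in>{..<n}. c k x \<odot>\<^bsub>P\<^esub> e k)"
    by (simp add: dual_basis_expansion[OF assms(3,5)])
  also have "\<dots> = (\<Oplus>\<^bsub>N\<^esub>k\<in>{..<n}. f (c k x \<odot>\<^bsub>P\<^esub> e k))"
    by (rule mod_hom_finsum[OF assms(1,2,4)]) (auto simp: D assms(5))
  also have "\<dots> = (\<Oplus>\<^bsub>N\<^esub>k\<in>{..<n}. c k x \<odot>\<^bsub>N\<^esub> f (e k))"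
    by (rule N.finsum_cong')
      (auto simp: D assms(5) mod_hom_smult[OF assms(4)] mod_hom_closed[OF assms(4)])
  finally show ?thesis .
qed

text \<open>Send each generator e_k to some preimage of f(e_k) and extend by the coordinates c_k.
  The hypothesis concerns the image of \<open>q\<close> rather than surjectivity because
  \<open>q\<close> will often be a differential, whose image is a module of boundaries.\<close>

lemma fg_projective_lift:
  assumes P: "module R P" "fg_projective R P" and A: "module R A" and B: "module R B"
    and f: "f \<in> mod_hom R P B" and q: "q \<in> mod_hom R A B"
    and sub: "\<And>x. x \<in> carrier P \<Longrightarrow> f x \<in> q ` carrier A"
  obtains h where "h \<in> mod_hom R P A" "\<And>x. x \<in> carrier P \<Longrightarrow> q (h x) = f x"
proof -
  interpret A: module R A by fact
  interpret B: module R B by fact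
  obtain n e c where db: "dual_basis R P n e c" using fg_projective_dual_basis[OF P] .
  note D = dual_basisD[OF db]
  have "\<forall>k. k < n \<longrightarrow> (\<exists>a. a \<in> carrier A \<and> q a = f (e k))" using sub D(1) by force
  then obtain a where a: "\<And>k. k < n \<Longrightarrow> a k \<in> carrier A" "\<And>k. k < n \<Longrightarrow> q (a k) = f (e k)"
    by metis
  define h where "h = (\<lambda>x. \<Oplus>\<^bsub>A\<^esub>k\<in>{..<n}. c k x \<odot>\<^bsub>A\<^esub> a k)"
  have "q (h x) = f x" if x: "x \<in> carrier P" for x
  proof -
    have "q (h x) = (\<Oplus>\<^bsub>B\<^esub>k\<in>{..<n}. q (c k x \<odot>\<^bsub>A\<^esub> a k))"
      unfolding h_def by (rule mod_hom_finsum[OF A B q]) (auto simp: D x a)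
    also have "\<dots> = (\<Oplus>\<^bsub>B\<^esub>k\<in>{..<n}. c k x \<odot>\<^bsub>B\<^esub> f (e k))"
      by (rule B.finsum_cong') (auto simp: D x a mod_hom_smult[OF q] mod_hom_closed[OF f])
    also have "\<dots> = f x" using dual_basis_hom_expansion[OF P(1) B db f x] by simp
    finally show ?thesis .
  qed
  moreover have "h \<in> mod_hom R P A"
    unfolding h_def by (rule linear_combination_hom[OF A]) (auto simp: D a)
  ultimately show thesis using that by blast
qed

text \<open>The dual basis with roles exchanged: the c_k generate the dual, and evaluation at e_k
  gives the coordinates. Commutativity of R swaps the factors f(e_k) and c_k(x).\<close>

lemma dual_basis_functional:
  assumes P: "module R P" and db: "dual_basis R P n e c" and f: "f \<in> carrier (dual_mod R P)"
  shows "f = (\<Oplus>\<^bsub>dual_mod R P\<^esub>k\<in>{..<n}. f (e k) \<odot>\<^bsub>dual_mod R P\<^esub> c k)"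
proof -
  interpret P: module R P by fact
  have cr: "cring R" by unfold_locales
  note reg = module_regular[OF cr]
  interpret reg: module R "regular_mod R" by (rule reg)
  note dual = module_Hom_mod[OF P reg, folded dual_mod_def]
  interpret dual: module R "dual_mod R P" by (rule dual)
  note D = dual_basisD[OF db]
  have f': "f \<in> mod_hom R P (regular_mod R)" using f by (simp add: dual_mod_def Hom_mod_simps)
  have fe: "f (e k) \<in> carrier R" if "k < n" for k using mod_hom_closed[OF f'] D(1)[OF that] by simp
  let ?s = "\<Oplus>\<^bsub>dual_mod R P\<^esub>k\<in>{..<n}. f (e k) \<odot>\<^bsub>dual_mod R P\<^esub> c k"
  have cl: "(\<lambda>k. f (e k) \<odot>\<^bsub>dual_mod R P\<^esub> c k) \<in> {..<n} \<rightarrow> carrier (dual_mod R P)"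
    by (auto simp: fe D)
  show ?thesis
  proof (rule Hom_mod_eqI[of _ R P "regular_mod R"])
    fix x assume x: "x \<in> carrier P"
    note ev = evaluation_hom[OF x, of R "regular_mod R", folded dual_mod_def]
    have "?s x = (\<Oplus>\<^bsub>regular_mod R\<^esub>k\<in>{..<n}. (f (e k) \<odot>\<^bsub>dual_mod R P\<^esub> c k) x)"
      by (rule mod_hom_finsum[OF dual reg ev _ cl]) auto
    also have "\<dots> = (\<Oplus>\<^bsub>regular_mod R\<^esub>k\<in>{..<n}. c k x \<odot>\<^bsub>regular_mod R\<^esub> f (e k))"
      by (rule reg.finsum_cong')
        (auto simp: fe D x dual_mod_def Hom_mod_simps P.m_comm)
    also have "\<dots> = f x" using dual_basis_hom_expansion[OF P reg db f' x] by simp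
    finally show "f x = ?s x" by simp
  qed (use f dual.finsum_closed[OF cl] in \<open>simp_all flip: dual_mod_def\<close>)
qed

lemma module_dual: "module R P \<Longrightarrow> module R (dual_mod R P)"
  unfolding dual_mod_def by (intro module_Hom_mod module_regular) (auto simp: module_def)

lemma fg_projective_dual:
  assumes P: "module R P" "fg_projective R P"
  shows "fg_projective R (dual_mod R P)"
proof -
  interpret P: module R P by fact
  obtain n e c where db: "dual_basis R P n e c" using fg_projective_dual_basis[OF P] .
  note D = dual_basisD[OF db]
  define s where "s f = (\<lambda>k\<in>{..<n}. f (e k))" for f :: "'c \<Rightarrow> 'a"
  define p where "p v = (\<Oplus>\<^bsub>dual_mod R P\<^esub>k\<in>{..<n}. v k \<odot>\<^bsub>dual_mod R P\<^esub> c k)" for v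
  have s: "s \<in> mod_hom R (dual_mod R P) (free_mod R n)"
    by (rule mod_homI)
      (auto simp: s_def dual_mod_def Hom_mod_simps free_mod_def D mod_hom_def intro!: restrict_ext)
  have p: "p \<in> mod_hom R (free_mod R n) (dual_mod R P)"
    unfolding p_def by (rule linear_combination_hom[OF module_dual[OF P(1)] coordinate_hom])
      (auto simp: D)
  have ps: "p (s f) = f" if f: "f \<in> carrier (dual_mod R P)" for f
  proof -
    interpret dual: module R "dual_mod R P" by (rule module_dual[OF P(1)])
    have "f (e k) \<in> carrier R" if "k < n" for k
      using f mod_hom_closed[of f R P "regular_mod R"] D(1)[OF that]
      by (simp add: dual_mod_def Hom_mod_simps)
    then have "p (s f) = (\<Oplus>\<^bsub>dual_mod R P\<^esub>k\<in>{..<n}. f (e k) \<odot>\<^bsub>dual_mod R P\<^esub> c k)"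
      unfolding p_def by (intro dual.finsum_cong') (auto simp: s_def D)
    then show ?thesis using dual_basis_functional[OF P(1) db f] by simp
  qed
  show ?thesis unfolding fg_projective_def using s p ps by blast
qed

lemma fg_projective_separates_points:
  assumes P: "module R P" "fg_projective R P" and x: "x \<in> carrier P"
    and "\<And>f. f \<in> carrier (dual_mod R P) \<Longrightarrow> f x = \<zero>\<^bsub>R\<^esub>"
  shows "x = \<zero>\<^bsub>P\<^esub>"
proof -
  interpret P: module R P by fact
  obtain n e c where db: "dual_basis R P n e c" using fg_projective_dual_basis[OF P] .
  note D = dual_basisD[OF db]
  have "x = (\<Oplus>\<^bsub>P\<^esub>k\<in>{..<n}. c k x \<odot>\<^bsub>P\<^esub> e k)" by (simp add: dual_basis_expansion[OF db x])
  also have "\<dots> = (\<Oplus>\<^bsub>P\<^esub>k\<in>{..<n}. \<zero>\<^bsub>P\<^esub>)"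
    by (rule P.finsum_cong') (auto simp: D assms(4))
  finally show ?thesis by (simp add: P.finsum_zero)
qed

text \<open>Since every f is the sum of f(e_k) c_k, the functional \<open>\<Phi>\<close> is
  determined by its values on the c_k, and the sum of \<open>\<Phi>\<close>(c_k) e_k is a point at
  which evaluation gives the same values. Together with
  \<open>fg_projective_separates_points\<close> this is the isomorphism of P with its
  bidual.\<close>

lemma fg_projective_reflexive:
  assumes P: "module R P" "fg_projective R P"
    and \<Phi>: "\<Phi> \<in> mod_hom R (dual_mod R P) (regular_mod R)"
  obtains x where "x \<in> carrier P" "\<And>f. f \<in> carrier (dual_mod R P) \<Longrightarrow> \<Phi> f = f x"
proof -
  interpret P: module R P by fact
  have cr: "cring R" by unfold_locales
  note reg = module_regular[OF cr]
  interpret reg: module R "regular_mod R" by (rule reg)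
  note dual = module_dual[OF P(1)]
  interpret dual: module R "dual_mod R P" by (rule dual)
  obtain n e c where db: "dual_basis R P n e c" using fg_projective_dual_basis[OF P] .
  note D = dual_basisD[OF db]
  note \<Phi>c = mod_hom_closed[OF \<Phi>, simplified]
  define x where "x = (\<Oplus>\<^bsub>P\<^esub>k\<in>{..<n}. \<Phi> (c k) \<odot>\<^bsub>P\<^esub> e k)"
  have cl: "(\<lambda>k. \<Phi> (c k) \<odot>\<^bsub>P\<^esub> e k) \<in> {..<n} \<rightarrow> carrier P" using \<Phi>c D by auto
  have "\<Phi> f = f x" if f: "f \<in> carrier (dual_mod R P)" for f
  proof -
    have f': "f \<in> mod_hom R P (regular_mod R)" using f by (simp add: dual_mod_def Hom_mod_simps)
    have fe: "f (e k) \<in> carrier R" if "k < n" for k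
      using mod_hom_closed[OF f'] D(1)[OF that] by simp
    have "\<Phi> f = \<Phi> (\<Oplus>\<^bsub>dual_mod R P\<^esub>k\<in>{..<n}. f (e k) \<odot>\<^bsub>dual_mod R P\<^esub> c k)"
      using dual_basis_functional[OF P(1) db f] by simp
    also have "\<dots> = (\<Oplus>\<^bsub>regular_mod R\<^esub>k\<in>{..<n}. \<Phi> (f (e k) \<odot>\<^bsub>dual_mod R P\<^esub> c k))"
      by (rule mod_hom_finsum[OF dual reg \<Phi>]) (auto simp: fe D)
    also have "\<dots> = (\<Oplus>\<^bsub>regular_mod R\<^esub>k\<in>{..<n}. f (\<Phi> (c k) \<odot>\<^bsub>P\<^esub> e k))"
      by (rule reg.finsum_cong')
        (auto simp: fe D \<Phi>c mod_hom_smult[OF \<Phi>] mod_hom_smult[OF f'] P.m_comm)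
    also have "\<dots> = f x"
      unfolding x_def by (rule mod_hom_finsum[OF P(1) reg f' _ cl, symmetric]) auto
    finally show ?thesis .
  qed
  then show thesis using that[of x] P.finsum_closed[OF cl] by (simp add: x_def)
qed

lemma fg_free_imp_fg_projective:
  assumes "module R P" "fg_free R P" shows "fg_projective R P"
proof -
  obtain n f where f: "f \<in> mod_hom R P (free_mod R n)"
      "bij_betw f (carrier P) (carrier (free_mod R n))"
    using assms(2) by (auto simp: fg_free_def mod_iso_def)
  show ?thesis unfolding fg_projective_def
    using f mod_hom_inv_into[OF assms(1) f] bij_betw_inv_into_left[OF f(2)] by blast
qed

lemma fg_projective_free: "fg_projective R (free_mod R n)"
  unfolding fg_projective_def using mod_hom_ident[of R "free_mod R n"]
    by (intro exI[of _ n] bexI) auto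

lemma fg_projective_zero:
  assumes "module R P" "zero_mod P" shows "fg_projective R P"
proof -
  interpret P: module R P by fact
  have cr: "cring R" by unfold_locales
  show ?thesis unfolding fg_projective_def
    using mod_hom_const_zero[OF module_free[OF cr]] mod_hom_const_zero[OF assms(1)] assms(2)
    by (fastforce simp: zero_mod_def)
qed

section \<open>Nakayama's lemma\<close>

lemma local_ring_maximalideal:
  assumes "local_ring R" shows "maximalideal (max_ideal R) R"
  using assms theI'[of "\<lambda>I. maximalideal I R"] by (auto simp: local_ring_def max_ideal_def)

text \<open>Zorn's lemma on the proper ideals above \<open>J\<close>. In a noetherian ring a
  nonempty chain of ideals contains its own union, so the union is again proper.\<close>

lemma (in noetherian_ring) proper_ideal_le_maximalideal:
  assumes "ideal J R" "J \<noteq> carrier R"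
  obtains I where "maximalideal I R" "J \<subseteq> I"
proof -
  define S where "S = {I. ideal I R \<and> J \<subseteq> I \<and> I \<noteq> carrier R}"
  have "S \<noteq> {}" using assms by (auto simp: S_def)
  moreover have "\<Union>C \<in> S" if C: "C \<noteq> {}" "subset.chain S C" for C
  proof -
    have "subset.chain {I. ideal I R} C"
      using C(2) by (auto simp: subset.chain_def S_def)
    then have "\<Union>C \<in> C" by (rule ideal_chain_is_trivial[OF C(1)])
    then show ?thesis using C(2) by (auto simp: subset.chain_def)
  qed
  ultimately have "\<exists>I\<in>S. \<forall>K\<in>S. I \<subseteq> K \<longrightarrow> K = I" by (rule subset_Zorn_nonempty)
  then obtain I where I: "I \<in> S" "\<And>K. K \<in> S \<Longrightarrow> I \<subseteq> K \<Longrightarrow> K = I" by blast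
  have "maximalideal I R"
  proof (rule maximalidealI)
    show "ideal I R" "carrier R \<noteq> I" using I(1) by (auto simp: S_def)
    show "K = I \<or> K = carrier R" if "ideal K R" "I \<subseteq> K" for K
      using I(2)[of K] that I(1) by (auto simp: S_def)
  qed
  then show thesis using that I(1) by (auto simp: S_def)
qed

text \<open>Otherwise 1 - c generates a proper ideal. It lies in the only maximal ideal, as does c,
  and then so does 1.\<close>

lemma local_ring_one_minus_unit:
  assumes "noetherian_ring R" "local_ring R" "c \<in> max_ideal R"
  obtains u where "u \<in> carrier R" "u \<otimes>\<^bsub>R\<^esub> (\<one>\<^bsub>R\<^esub> \<ominus>\<^bsub>R\<^esub> c) = \<one>\<^bsub>R\<^esub>"
proof -
  interpret R: cring R using assms(2) by (simp add: local_ring_def)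
  interpret m: maximalideal "max_ideal R" R by (rule local_ring_maximalideal[OF assms(2)])
  note c = m.a_Hcarr[OF assms(3)]
  define d where "d = \<one>\<^bsub>R\<^esub> \<ominus>\<^bsub>R\<^esub> c"
  have d: "d \<in> carrier R" using c by (simp add: d_def)
  note J = R.cgenideal_ideal[OF d]
  have "PIdl\<^bsub>R\<^esub> d = carrier R"
  proof (rule ccontr)
    assume "PIdl\<^bsub>R\<^esub> d \<noteq> carrier R"
    then obtain I where I: "maximalideal I R" "PIdl\<^bsub>R\<^esub> d \<subseteq> I"
      using noetherian_ring.proper_ideal_le_maximalideal[OF assms(1) J] by metis
    have "I = max_ideal R"
      using assms(2) I(1) m.is_maximalideal by (auto simp: local_ring_def)
    then have "d \<in> max_ideal R" using I(2) R.cgenideal_self[OF d] by auto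
    then have "d \<oplus>\<^bsub>R\<^esub> c \<in> max_ideal R" using assms(3) by (rule m.a_closed)
    then have "\<one>\<^bsub>R\<^esub> \<in> max_ideal R"
      using c by (simp add: d_def a_minus_def R.a_assoc R.l_neg)
    then show False using m.one_imp_carrier m.I_notcarr by simp
  qed
  then have "\<one>\<^bsub>R\<^esub> \<in> PIdl\<^bsub>R\<^esub> d" by simp
  then show thesis using that by (auto simp: cgenideal_def d_def)
qed

lemma ideal_smult_submodule:
  assumes "module R M" "ideal I R" shows "submodule (ideal_smult R I M) R M"
proof -
  interpret M: module R M by fact
  interpret I: ideal I R by fact
  show ?thesis unfolding ideal_smult_def by (rule mod_span_submodule[OF assms(1)]) auto
qed

lemma smult_mem_ideal_smult: "a \<in> I \<Longrightarrow> x \<in> carrier M \<Longrightarrow> a \<odot>\<^bsub>M\<^esub> x \<in> ideal_smult R I M"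
  unfolding ideal_smult_def by (rule subsetD[OF mod_span_superset]) blast

lemma ideal_smult_least:
  assumes "submodule N R M" "\<And>a x. a \<in> I \<Longrightarrow> x \<in> carrier M \<Longrightarrow> a \<odot>\<^bsub>M\<^esub> x \<in> N"
  shows "ideal_smult R I M \<subseteq> N"
  unfolding ideal_smult_def using assms by (intro mod_span_least) auto

lemma mod_hom_ideal_smult:
  assumes "module R M" "module R N" "ideal I R" "f \<in> mod_hom R M N" "x \<in> ideal_smult R I M"
  shows "f x \<in> ideal_smult R I N"
proof -
  interpret I: ideal I R by fact
  interpret M: module R M by fact
  have "ideal_smult R I M \<subseteq> {x \<in> carrier M. f x \<in> ideal_smult R I N}"
    by (rule ideal_smult_least[OF submodule_vimage[OF assms(1,2,4) ideal_smult_submodule]])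
      (auto simp: assms mod_hom_smult[OF assms(4)] intro!: smult_mem_ideal_smult
        mod_hom_closed[OF assms(4)])
  then show ?thesis using assms(5) by auto
qed

text \<open>Used twice in Nakayama's lemma: with \<open>I\<close> = R it is the span of
  \<open>S\<close> and \<open>a\<close>, and with \<open>I\<close> the maximal ideal it bounds the
  maximal ideal times the module.\<close>

lemma submodule_add_multiples:
  assumes "module R M" "submodule S R M" "ideal I R" "a \<in> carrier M"
  shows "submodule {s \<oplus>\<^bsub>M\<^esub> c \<odot>\<^bsub>M\<^esub> a | s c. s \<in> S \<and> c \<in> I} R M" (is "submodule ?T R M")
proof -
  interpret M: module R M by fact
  interpret I: ideal I R by fact
  note E = M.submoduleE[OF assms(2)]
  have S: "s \<in> carrier M" if "s \<in> S" for s using E(1) that by auto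
  show ?thesis
  proof (rule M.submoduleI)
    show "?T \<subseteq> carrier M" using S assms(4) by auto
    have "\<zero>\<^bsub>M\<^esub> = \<zero>\<^bsub>M\<^esub> \<oplus>\<^bsub>M\<^esub> \<zero>\<^bsub>R\<^esub> \<odot>\<^bsub>M\<^esub> a" using assms(4) by simp
    then show "\<zero>\<^bsub>M\<^esub> \<in> ?T" using submodule_zero[OF assms(1,2)] I.zero_closed by blast
  next
    fix x assume "x \<in> ?T"
    then obtain s c where x: "x = s \<oplus>\<^bsub>M\<^esub> c \<odot>\<^bsub>M\<^esub> a" "s \<in> S" "c \<in> I" by blast
    then have "\<ominus>\<^bsub>M\<^esub> x = \<ominus>\<^bsub>M\<^esub> s \<oplus>\<^bsub>M\<^esub> (\<ominus>\<^bsub>R\<^esub> c) \<odot>\<^bsub>M\<^esub> a"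
      using assms(4) S by (simp add: M.minus_add M.smult_l_minus)
    then show "\<ominus>\<^bsub>M\<^esub> x \<in> ?T" using E(3)[OF x(2)] I.a_inv_closed[OF x(3)] by blast
    fix y assume "y \<in> ?T"
    then obtain t d where y: "y = t \<oplus>\<^bsub>M\<^esub> d \<odot>\<^bsub>M\<^esub> a" "t \<in> S" "d \<in> I" by blast
    then have "x \<oplus>\<^bsub>M\<^esub> y = (s \<oplus>\<^bsub>M\<^esub> t) \<oplus>\<^bsub>M\<^esub> (c \<oplus>\<^bsub>R\<^esub> d) \<odot>\<^bsub>M\<^esub> a"
      using x assms(4) S by (simp add: M.smult_l_distr M.a_ac)
    then show "x \<oplus>\<^bsub>M\<^esub> y \<in> ?T" using E(5)[OF x(2) y(2)] I.a_closed[OF x(3) y(3)] by blast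
  next
    fix b x assume b: "b \<in> carrier R" and "x \<in> ?T"
    then obtain s c where x: "x = s \<oplus>\<^bsub>M\<^esub> c \<odot>\<^bsub>M\<^esub> a" "s \<in> S" "c \<in> I" by blast
    then have "b \<odot>\<^bsub>M\<^esub> x = b \<odot>\<^bsub>M\<^esub> s \<oplus>\<^bsub>M\<^esub> (b \<otimes>\<^bsub>R\<^esub> c) \<odot>\<^bsub>M\<^esub> a"
      using b assms(4) S by (simp add: M.smult_r_distr M.smult_assoc1)
    then show "b \<odot>\<^bsub>M\<^esub> x \<in> ?T" using E(4)[OF b x(2)] I.I_l_closed[OF x(3) b] by blast
  qed
qed

text \<open>Formulated relative to \<open>N\<close>: the module is generated by \<open>N\<close> and
  finitely many further elements, and \<open>N\<close> fills it modulo the maximal ideal. The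
  induction discards one further generator at a time by showing that it lies in the span of
  \<open>N\<close> and the others.\<close>

lemma nakayama:
  assumes R: "noetherian_ring R" "local_ring R" and M: "module R M"
    and A: "finite A" "A \<subseteq> carrier M" "mod_span R M (N \<union> A) = carrier M"
    and N: "submodule N R M"
    and dense: "\<And>x. x \<in> carrier M \<Longrightarrow> \<exists>y\<in>N. x \<ominus>\<^bsub>M\<^esub> y \<in> ideal_smult R (max_ideal R) M"
  shows "N = carrier M"
  using A
proof (induction A rule: finite_induct)
  case empty
  then show ?case using mod_span_least[OF N, of "N \<union> {}"] module.submoduleE(1)[OF M N] by auto
next
  case (insert a A)
  interpret M: module R M by fact
  interpret m: maximalideal "max_ideal R" R by (rule local_ring_maximalideal[OF R(2)])
  have NA: "N \<union> A \<subseteq> carrier M" using insert.prems M.submoduleE(1)[OF N] by auto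
  define S where "S = mod_span R M (N \<union> A)"
  have S: "submodule S R M" unfolding S_def by (rule mod_span_submodule[OF M NA])
  note E = M.submoduleE[OF S]
  have SM: "s \<in> carrier M" if "s \<in> S" for s using E(1) that by auto
  have a: "a \<in> carrier M" using insert.prems by auto
  let ?T = "\<lambda>I. {s \<oplus>\<^bsub>M\<^esub> c \<odot>\<^bsub>M\<^esub> a | s c. s \<in> S \<and> c \<in> I}"
  have T: "submodule (?T I) R M" if "ideal I R" for I
    by (rule submodule_add_multiples[OF M S that a])
  have "x \<in> ?T (carrier R)" if "x \<in> N \<union> insert a A" for x
  proof (cases "x = a")
    case True
    then have "x = \<zero>\<^bsub>M\<^esub> \<oplus>\<^bsub>M\<^esub> \<one>\<^bsub>R\<^esub> \<odot>\<^bsub>M\<^esub> a" using a by simp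
    then show ?thesis using submodule_zero[OF M S] by blast
  next
    case False
    then have xS: "x \<in> S" using that mod_span_superset[of "N \<union> A"] by (auto simp: S_def)
    have "x = x \<oplus>\<^bsub>M\<^esub> \<zero>\<^bsub>R\<^esub> \<odot>\<^bsub>M\<^esub> a" using SM[OF xS] a by simp
    then show ?thesis using xS by blast
  qed
  then have gen: "carrier M \<subseteq> ?T (carrier R)"
    using mod_span_least[OF T[OF M.R.oneideal], of "N \<union> insert a A"] insert.prems(2) by blast
  \<comment> \<open>Every element of M is s + r a with s in S; multiplying by c in the maximal ideal
    keeps c s in S and puts the coefficient c r into the maximal ideal.\<close>
  have "ideal_smult R (max_ideal R) M \<subseteq> ?T (max_ideal R)"
  proof (rule ideal_smult_least[OF T[OF m.is_ideal]])
    fix c x assume c: "c \<in> max_ideal R" and "x \<in> carrier M"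
    then obtain s r where x: "x = s \<oplus>\<^bsub>M\<^esub> r \<odot>\<^bsub>M\<^esub> a" "s \<in> S" "r \<in> carrier R" using gen by blast
    note c' = m.a_Hcarr[OF c]
    have "c \<odot>\<^bsub>M\<^esub> x = c \<odot>\<^bsub>M\<^esub> s \<oplus>\<^bsub>M\<^esub> (c \<otimes>\<^bsub>R\<^esub> r) \<odot>\<^bsub>M\<^esub> a"
      using x c' a SM by (simp add: M.smult_r_distr M.smult_assoc1)
    then show "c \<odot>\<^bsub>M\<^esub> x \<in> ?T (max_ideal R)"
      using E(4)[OF c' x(2)] m.I_r_closed[OF c x(3)] by blast
  qed
  moreover obtain y where y: "y \<in> N" "a \<ominus>\<^bsub>M\<^esub> y \<in> ideal_smult R (max_ideal R) M"
    using dense[OF a] by blast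
  ultimately obtain s c where sc: "a \<ominus>\<^bsub>M\<^esub> y = s \<oplus>\<^bsub>M\<^esub> c \<odot>\<^bsub>M\<^esub> a" "s \<in> S" "c \<in> max_ideal R"
    by blast
  have yS: "y \<in> S" using y(1) mod_span_superset[of "N \<union> A"] by (auto simp: S_def)
  note c' = m.a_Hcarr[OF sc(3)]
  note cl = SM[OF yS] SM[OF sc(2)] c' a
  \<comment> \<open>From a = y + s + c a with y and s in S it follows that (1 - c) a lies in S, and
    1 - c is a unit.\<close>
  obtain u where u: "u \<in> carrier R" "u \<otimes>\<^bsub>R\<^esub> (\<one>\<^bsub>R\<^esub> \<ominus>\<^bsub>R\<^esub> c) = \<one>\<^bsub>R\<^esub>"
    using local_ring_one_minus_unit[OF R sc(3)] .
  have "a = y \<oplus>\<^bsub>M\<^esub> (a \<ominus>\<^bsub>M\<^esub> y)" using cl by (simp add: M.plus_minus_cancel)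
  also have "\<dots> = (y \<oplus>\<^bsub>M\<^esub> s) \<oplus>\<^bsub>M\<^esub> c \<odot>\<^bsub>M\<^esub> a" unfolding sc(1) using cl by (simp add: M.a_assoc)
  finally have a_eq: "a = (y \<oplus>\<^bsub>M\<^esub> s) \<oplus>\<^bsub>M\<^esub> c \<odot>\<^bsub>M\<^esub> a" .
  have "(\<one>\<^bsub>R\<^esub> \<ominus>\<^bsub>R\<^esub> c) \<odot>\<^bsub>M\<^esub> a = a \<oplus>\<^bsub>M\<^esub> \<ominus>\<^bsub>M\<^esub> (c \<odot>\<^bsub>M\<^esub> a)"
    using cl by (simp add: a_minus_def M.smult_l_distr M.smult_l_minus)
  also have "\<dots> = ((y \<oplus>\<^bsub>M\<^esub> s) \<oplus>\<^bsub>M\<^esub> c \<odot>\<^bsub>M\<^esub> a) \<oplus>\<^bsub>M\<^esub> \<ominus>\<^bsub>M\<^esub> (c \<odot>\<^bsub>M\<^esub> a)"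
    using a_eq by simp
  also have "\<dots> = y \<oplus>\<^bsub>M\<^esub> s" using cl by (simp add: M.a_assoc M.r_neg)
  finally have eq: "(\<one>\<^bsub>R\<^esub> \<ominus>\<^bsub>R\<^esub> c) \<odot>\<^bsub>M\<^esub> a = y \<oplus>\<^bsub>M\<^esub> s" .
  have "a = u \<odot>\<^bsub>M\<^esub> ((\<one>\<^bsub>R\<^esub> \<ominus>\<^bsub>R\<^esub> c) \<odot>\<^bsub>M\<^esub> a)" using u cl by (simp flip: M.smult_assoc1)
  also have "\<dots> \<in> S" unfolding eq using E(4,5) u(1) yS sc(2) by blast
  finally have "a \<in> S" .
  then have "N \<union> insert a A \<subseteq> S" using mod_span_superset[of "N \<union> A"] by (auto simp: S_def)
  then have "carrier M \<subseteq> S" using mod_span_least[OF S] insert.prems(2) by blast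
  then have "mod_span R M (N \<union> A) = carrier M" using E(1) by (auto simp: S_def)
  then show ?case using insert.IH NA by auto
qed

lemma nakayama_projective:
  assumes R: "noetherian_ring R" "local_ring R" and P: "module R P" "fg_projective R P"
    and N: "submodule N R P"
    and "\<And>x. x \<in> carrier P \<Longrightarrow> \<exists>y\<in>N. x \<ominus>\<^bsub>P\<^esub> y \<in> ideal_smult R (max_ideal R) P"
  shows "N = carrier P"
proof -
  interpret P: module R P by fact
  obtain n e c where db: "dual_basis R P n e c" using fg_projective_dual_basis[OF P] .
  note D = dual_basisD[OF db]
  define A where "A = e ` {..<n}"
  have sub: "N \<union> A \<subseteq> carrier P" using P.submoduleE(1)[OF N] D(1) by (auto simp: A_def)
  note S = mod_span_submodule[OF P(1) sub]
  have "x \<in> mod_span R P (N \<union> A)" if x: "x \<in> carrier P" for x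
  proof -
    have "(\<Oplus>\<^bsub>P\<^esub>k\<in>{..<n}. c k x \<odot>\<^bsub>P\<^esub> e k) \<in> mod_span R P (N \<union> A)"
    proof (rule finsum_submodule[OF P(1) S])
      fix k assume k: "k \<in> {..<n}"
      then have "e k \<in> mod_span R P (N \<union> A)"
        by (intro subsetD[OF mod_span_superset]) (simp add: A_def)
      then show "c k x \<odot>\<^bsub>P\<^esub> e k \<in> mod_span R P (N \<union> A)"
        using P.submoduleE(4)[OF S] D(4) k x by simp
    qed simp
    then show ?thesis by (simp add: dual_basis_expansion[OF db x])
  qed
  then have "mod_span R P (N \<union> A) = carrier P" using P.submoduleE(1)[OF S] by auto
  from nakayama[OF R P(1) _ _ this N assms(6)] show ?thesis using sub by (simp add: A_def)
qed

text \<open>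
  A section \<open>\<sigma>\<close> of such a \<open>\<phi>\<close> exists by projectivity and is again the identity modulo the maximal
  ideal, hence surjective; this makes \<open>\<phi>\<close> injective without any appeal to determinants.
\<close>

lemma identity_mod_maximal_bij:
  assumes R: "noetherian_ring R" "local_ring R" and P: "module R P" "fg_projective R P"
    and \<phi>: "\<phi> \<in> mod_hom R P P"
    and id: "\<And>x. x \<in> carrier P \<Longrightarrow> \<phi> x \<ominus>\<^bsub>P\<^esub> x \<in> ideal_smult R (max_ideal R) P"
  shows "bij_betw \<phi> (carrier P) (carrier P)"
proof -
  interpret P: module R P by fact
  interpret m: maximalideal "max_ideal R" R by (rule local_ring_maximalideal[OF R(2)])
  note mP = ideal_smult_submodule[OF P(1) m.is_ideal]
  have surj: "\<psi> ` carrier P = carrier P"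
    if \<psi>: "\<psi> \<in> mod_hom R P P"
      and id: "\<And>x. x \<in> carrier P \<Longrightarrow> x \<ominus>\<^bsub>P\<^esub> \<psi> x \<in> ideal_smult R (max_ideal R) P" for \<psi>
    using submodule_image[OF P(1,1) \<psi> P.carrier_is_submodule] id
    by (intro nakayama_projective[OF R P]) auto
  have id': "x \<ominus>\<^bsub>P\<^esub> \<phi> x \<in> ideal_smult R (max_ideal R) P" if x: "x \<in> carrier P" for x
  proof -
    have "x \<ominus>\<^bsub>P\<^esub> \<phi> x = \<ominus>\<^bsub>P\<^esub> (\<phi> x \<ominus>\<^bsub>P\<^esub> x)"
      using x mod_hom_closed[OF \<phi> x] by (simp add: a_minus_def P.minus_add P.a_comm)
    then show ?thesis using P.submoduleE(3)[OF mP id[OF x]] by simp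
  qed
  have \<phi>_surj: "\<phi> ` carrier P = carrier P" by (rule surj[OF \<phi> id'])
  obtain \<sigma> where \<sigma>: "\<sigma> \<in> mod_hom R P P" "\<And>x. x \<in> carrier P \<Longrightarrow> \<phi> (\<sigma> x) = x"
    using fg_projective_lift[OF P P(1,1) mod_hom_ident \<phi>] \<phi>_surj by blast
  \<comment> \<open>The hypothesis on \<open>\<phi>\<close>, applied at \<open>\<sigma> x\<close>,
    where \<open>\<phi>\<close> takes the value x.\<close>
  have "x \<ominus>\<^bsub>P\<^esub> \<sigma> x \<in> ideal_smult R (max_ideal R) P" if x: "x \<in> carrier P" for x
    using id[OF mod_hom_closed[OF \<sigma>(1) x]] \<sigma>(2)[OF x] by simp
  then have \<sigma>_surj: "\<sigma> ` carrier P = carrier P" by (rule surj[OF \<sigma>(1)])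
  have "inj_on \<phi> (carrier P)"
  proof (rule inj_onI)
    fix x y assume "x \<in> carrier P" "y \<in> carrier P" and eq: "\<phi> x = \<phi> y"
    then have "x \<in> \<sigma> ` carrier P" "y \<in> \<sigma> ` carrier P" by (simp_all only: \<sigma>_surj)
    then obtain x' y' where "x' \<in> carrier P" "y' \<in> carrier P" "x = \<sigma> x'" "y = \<sigma> y'"
      by (elim imageE)
    then show "x = y" using eq \<sigma>(2) by simp
  qed
  then show ?thesis using \<phi>_surj by (simp add: bij_betw_def)
qed

section \<open>Functionals with values in an ideal, and transposes of isomorphisms\<close>

lemma functional_ideal_smult:
  assumes "module R M" "ideal I R" "f \<in> mod_hom R M (regular_mod R)" "x \<in> ideal_smult R I M"
  shows "f x \<in> I"
proof -
  interpret M: module R M by fact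
  interpret I: ideal I R by fact
  have cr: "cring R" by unfold_locales
  interpret reg: module R "regular_mod R" by (rule module_regular[OF cr])
  \<comment> \<open>Negation in \<open>regular_mod R\<close> is rewritten as multiplication by -1,
    so that the ideal axioms of R apply to it.\<close>
  have inv: "\<ominus>\<^bsub>regular_mod R\<^esub> a \<in> I" if "a \<in> I" for a
  proof -
    have a: "a \<in> carrier R" using that by (rule I.a_Hcarr)
    have "\<ominus>\<^bsub>regular_mod R\<^esub> a = (\<ominus>\<^bsub>R\<^esub> \<one>\<^bsub>R\<^esub>) \<odot>\<^bsub>regular_mod R\<^esub> a"
      using a reg.smult_l_minus[of "\<one>\<^bsub>R\<^esub>" a] by simp
    then show ?thesis using I.I_l_closed[OF that] by simp
  qed
  have I: "submodule I R (regular_mod R)"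
    by (rule reg.submoduleI) (use I.a_subset I.I_l_closed inv in auto)
  have "ideal_smult R I (regular_mod R) \<subseteq> I"
    by (rule ideal_smult_least[OF I]) (auto intro: I.I_r_closed)
  then show ?thesis
    using mod_hom_ideal_smult[OF assms(1) module_regular[OF cr] assms(2-4)] by auto
qed

text \<open>Written in terms of the functionals c_k of a dual basis, f has the coefficients f(e_k),
  and these are values of f.\<close>

lemma dual_mem_ideal_smult:
  assumes P: "module R P" "fg_projective R P" and I: "ideal I R"
    and f: "f \<in> carrier (dual_mod R P)" "\<And>x. x \<in> carrier P \<Longrightarrow> f x \<in> I"
  shows "f \<in> ideal_smult R I (dual_mod R P)"
proof -
  interpret P: module R P by fact
  obtain n e c where db: "dual_basis R P n e c" using fg_projective_dual_basis[OF P] .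
  note D = dual_basisD[OF db]
  note dual = module_dual[OF P(1)]
  have "(\<Oplus>\<^bsub>dual_mod R P\<^esub>k\<in>{..<n}. f (e k) \<odot>\<^bsub>dual_mod R P\<^esub> c k) \<in> ideal_smult R I (dual_mod R P)"
    by (rule finsum_submodule[OF dual ideal_smult_submodule[OF dual I]])
      (auto intro!: smult_mem_ideal_smult f(2) D)
  then show ?thesis using dual_basis_functional[OF P(1) db f(1)] by simp
qed

text \<open>\<open>\<psi>\<close> is the biduality map of B followed by the dual of
  \<open>\<theta>\<close>. It is injective because the functionals \<open>\<theta> y\<close> are all
  functionals on B and so separate points. It is surjective because a functional u on A, precomposed
  with the inverse of \<open>\<theta>\<close>, is a functional on the dual of B, hence evaluation at
  a point.\<close>

lemma fg_projective_transpose_bij: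
  assumes A: "module R A" and B: "module R B" "fg_projective R B" and A': "fg_projective R A"
    and \<theta>: "\<theta> \<in> mod_hom R A (dual_mod R B)" "bij_betw \<theta> (carrier A) (carrier (dual_mod R B))"
  defines "\<psi> \<equiv> \<lambda>x. \<lambda>y\<in>carrier A. \<theta> y x"
  shows "\<psi> \<in> mod_hom R B (dual_mod R A)" "bij_betw \<psi> (carrier B) (carrier (dual_mod R A))"
proof -
  interpret A: module R A by fact
  interpret B: module R B by fact
  note dA = module_dual[OF A]
  have mem: "\<psi> x \<in> carrier (dual_mod R A)" if "x \<in> carrier B" for x
    unfolding \<psi>_def dual_mod_def
    by (rule restrict_in_Hom_mod[OF A mod_hom_comp[OF \<theta>(1)[unfolded dual_mod_def] evaluation_hom[OF that]]])
  have \<theta>hom: "\<theta> y \<in> mod_hom R B (regular_mod R)" if "y \<in> carrier A" for y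
    using mod_hom_closed[OF \<theta>(1) that] by (simp add: dual_mod_def Hom_mod_simps)
  show \<psi>: "\<psi> \<in> mod_hom R B (dual_mod R A)"
  proof (rule mod_homI)
    show "\<psi> x \<in> carrier (dual_mod R A)" if "x \<in> carrier B" for x by (rule mem[OF that])
    show "\<psi> (x \<oplus>\<^bsub>B\<^esub> z) = \<psi> x \<oplus>\<^bsub>dual_mod R A\<^esub> \<psi> z" if "x \<in> carrier B" "z \<in> carrier B" for x z
      by (simp add: \<psi>_def dual_mod_def Hom_mod_def that mod_hom_add[OF \<theta>hom] cong: restrict_cong)
    show "\<psi> (a \<odot>\<^bsub>B\<^esub> x) = a \<odot>\<^bsub>dual_mod R A\<^esub> \<psi> x" if "a \<in> carrier R" "x \<in> carrier B" for a x
      by (simp add: \<psi>_def dual_mod_def Hom_mod_def that mod_hom_smult[OF \<theta>hom] cong: restrict_cong)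
  qed
  have "inj_on \<psi> (carrier B)"
  proof (rule mod_hom_inj_onI[OF B(1) dA \<psi>])
    fix x assume x: "x \<in> carrier B" and eq: "\<psi> x = \<zero>\<^bsub>dual_mod R A\<^esub>"
    show "x = \<zero>\<^bsub>B\<^esub>"
    proof (rule fg_projective_separates_points[OF B x])
      fix f assume "f \<in> carrier (dual_mod R B)"
      then obtain y where y: "y \<in> carrier A" "f = \<theta> y" using \<theta>(2) by (auto simp: bij_betw_def)
      then have "f x = \<psi> x y" by (simp add: \<psi>_def)
      then show "f x = \<zero>\<^bsub>R\<^esub>" using y(1) unfolding eq by (simp add: dual_mod_def Hom_mod_simps)
    qed
  qed
  moreover have "u \<in> \<psi> ` carrier B" if u: "u \<in> carrier (dual_mod R A)" for u
  proof -
    have uh: "u \<in> mod_hom R A (regular_mod R)" using u by (simp add: dual_mod_def Hom_mod_simps)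
    note \<theta>i = mod_hom_inv_into[OF A \<theta>]
    obtain x where x: "x \<in> carrier B"
        "\<And>f. f \<in> carrier (dual_mod R B) \<Longrightarrow> u (inv_into (carrier A) \<theta> f) = f x"
      using fg_projective_reflexive[OF B mod_hom_comp[OF \<theta>i uh]] by metis
    have "u = \<psi> x"
    proof (rule Hom_mod_eqI[of _ R A "regular_mod R"])
      fix y assume y: "y \<in> carrier A"
      show "u y = \<psi> x y"
        using x(2)[OF mod_hom_closed[OF \<theta>(1) y]] y bij_betw_inv_into_left[OF \<theta>(2) y]
        by (simp add: \<psi>_def)
    qed (use u mem[OF x(1)] in \<open>simp_all add: dual_mod_def\<close>)
    then show ?thesis using x(1) by blast
  qed
  ultimately show "bij_betw \<psi> (carrier B) (carrier (dual_mod R A))"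
    using mem by (auto simp: bij_betw_def)
qed

section \<open>Chain maps and homotopies\<close>

lemma complexD:
  assumes "is_complex R C"
  shows complex_module: "module R (obj C i)"
    and complex_diff: "diff C i \<in> mod_hom R (obj C i) (obj C (i - 1))"
    and complex_diff_diff: "x \<in> carrier (obj C i) \<Longrightarrow> diff C (i - 1) (diff C i x) = \<zero>\<^bsub>obj C (i - 2)\<^esub>"
  using assms by (auto simp: is_complex_def)

lemma complex_diff_Suc:
  "is_complex R C \<Longrightarrow> diff C (i + 1) \<in> mod_hom R (obj C (i + 1)) (obj C i)"
  using complex_diff[of R C "i + 1"] by simp

lemma complex_diff_diff_Suc:
  "is_complex R C \<Longrightarrow> x \<in> carrier (obj C (i + 1)) \<Longrightarrow> diff C i (diff C (i + 1) x) = \<zero>\<^bsub>obj C (i - 1)\<^esub>"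
  using complex_diff_diff[of R C x "i + 1"] by simp

lemma cycles_submodule:
  assumes "is_complex R C" shows "submodule (cycles C i) R (obj C i)"
  unfolding cycles_def
    by (rule submodule_kernel[OF _ _ complex_diff]) (use assms in \<open>auto intro: complexD\<close>)

lemma boundaries_submodule:
  assumes "is_complex R C" shows "submodule (boundaries C i) R (obj C i)"
  unfolding boundaries_def
  by (rule submodule_image[OF _ _ complex_diff_Suc module.carrier_is_submodule])
    (use assms in \<open>auto intro: complexD\<close>)

lemma boundaries_subset_cycles:
  assumes "is_complex R C" shows "boundaries C i \<subseteq> cycles C i"
  using complex_diff_diff[OF assms, of _ "i + 1"] mod_hom_closed[OF complex_diff_Suc[OF assms]]
  by (auto simp: boundaries_def cycles_def)

lemma cycles_subset: "cycles C i \<subseteq> carrier (obj C i)"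
  by (auto simp: cycles_def)

lemma boundaries_subset:
  "is_complex R C \<Longrightarrow> boundaries C i \<subseteq> carrier (obj C i)"
  by (rule subset_trans[OF boundaries_subset_cycles cycles_subset])

lemma boundaryI: "x \<in> carrier (obj C (i + 1)) \<Longrightarrow> diff C (i + 1) x \<in> boundaries C i"
  by (auto simp: boundaries_def)

lemma boundaryI': "x \<in> carrier (obj C i) \<Longrightarrow> diff C i x \<in> boundaries C (i - 1)"
  by (auto simp: boundaries_def)

text \<open>\<open>homology_mod\<close> divides a record whose carrier is cut down to the cycles, so
  the boundaries must be a submodule of that record and not only of the ambient module.\<close>

lemma submodule_of_submodule:
  assumes "module R M" "submodule Z R M" "submodule B R M" "B \<subseteq> Z"
  shows "submodule B R (M\<lparr>carrier := Z\<rparr>)"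
  using submodule.submodule_is_module[OF assms(3,1)] submodule.submodule_is_module[OF assms(2,1)] assms(4)
  by (intro module.module_incl_imp_submodule) simp_all

lemma cycles_module:
  "is_complex R C \<Longrightarrow> module R (obj C i\<lparr>carrier := cycles C i\<rparr>)"
  by (rule submodule.submodule_is_module[OF cycles_submodule complex_module])

lemma boundaries_submodule_cycles:
  "is_complex R C \<Longrightarrow> submodule (boundaries C i) R (obj C i\<lparr>carrier := cycles C i\<rparr>)"
  by (rule submodule_of_submodule[OF complex_module cycles_submodule boundaries_submodule boundaries_subset_cycles])

lemma module_homology: "is_complex R C \<Longrightarrow> module R (homology_mod C i)"
  unfolding homology_mod_def by (rule module_quot_mod[OF cycles_module boundaries_submodule_cycles])

lemma zero_mod_homology:
  "is_complex R C \<Longrightarrow> zero_mod (homology_mod C i) \<longleftrightarrow> cycles C i = boundaries C i"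
  unfolding homology_mod_def using zero_mod_quot_mod[OF cycles_module boundaries_submodule_cycles]
    by simp

definition chain_map ::
  "('a, 'q) ring_scheme \<Rightarrow> ('a, 'c) chain_complex \<Rightarrow> ('a, 'd) chain_complex \<Rightarrow> (int \<Rightarrow> 'c \<Rightarrow> 'd) \<Rightarrow> bool" where
  "chain_map R C D f \<longleftrightarrow> (\<forall>i. f i \<in> mod_hom R (obj C i) (obj D i)
     \<and> (\<forall>x\<in>carrier (obj C i). f (i - 1) (diff C i x) = diff D i (f i x)))"

lemma chain_mapD:
  assumes "chain_map R C D f"
  shows chain_map_hom: "f i \<in> mod_hom R (obj C i) (obj D i)"
    and chain_map_diff: "x \<in> carrier (obj C i) \<Longrightarrow> f (i - 1) (diff C i x) = diff D i (f i x)"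
  using assms by (auto simp: chain_map_def)

lemma chain_map_closed:
  "chain_map R C D f \<Longrightarrow> x \<in> carrier (obj C i) \<Longrightarrow> f i x \<in> carrier (obj D i)"
  by (rule mod_hom_closed[OF chain_map_hom])

lemma chain_map_ident: "chain_map R C C (\<lambda>i x. x)"
  by (simp add: chain_map_def mod_hom_ident)

lemma chain_map_comp:
  assumes "chain_map R C D f" "chain_map R D E g"
  shows "chain_map R C E (\<lambda>i x. g i (f i x))"
  unfolding chain_map_def
proof (intro allI conjI ballI)
  fix i
  show "(\<lambda>x. g i (f i x)) \<in> mod_hom R (obj C i) (obj E i)"
    by (rule mod_hom_comp[OF chain_map_hom[OF assms(1)] chain_map_hom[OF assms(2)]])
  show "g (i - 1) (f (i - 1) (diff C i x)) = diff E i (g i (f i x))"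
    if x: "x \<in> carrier (obj C i)" for x
    by (simp add: chain_map_diff[OF assms(1) x] chain_map_diff[OF assms(2) chain_map_closed[OF assms(1) x]])
qed

lemma chain_map_cycles:
  assumes "is_complex R C" "is_complex R D" "chain_map R C D f" "x \<in> cycles C i"
  shows "f i x \<in> cycles D i"
proof -
  have x: "x \<in> carrier (obj C i)" "diff C i x = \<zero>\<^bsub>obj C (i - 1)\<^esub>" using assms(4)
    by (auto simp: cycles_def)
  have "diff D i (f i x) = f (i - 1) (diff C i x)" using chain_map_diff[OF assms(3) x(1)] by simp
  also have "\<dots> = \<zero>\<^bsub>obj D (i - 1)\<^esub>" unfolding x(2)
    by (rule mod_hom_zero[OF _ _ chain_map_hom[OF assms(3)]]) (use assms in \<open>auto intro: complexD\<close>)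
  finally show ?thesis using chain_map_closed[OF assms(3) x(1)] by (simp add: cycles_def)
qed

lemma chain_map_boundaries:
  assumes "chain_map R C D f" "x \<in> boundaries C i"
  shows "f i x \<in> boundaries D i"
proof -
  obtain z where z: "z \<in> carrier (obj C (i + 1))" "x = diff C (i + 1) z"
    using assms(2) by (auto simp: boundaries_def)
  have "f i x = diff D (i + 1) (f (i + 1) z)" using chain_map_diff[OF assms(1) z(1)] z(2) by simp
  then show ?thesis using chain_map_closed[OF assms(1) z(1)] by (auto simp: boundaries_def)
qed

definition homotopic ::
  "('a, 'q) ring_scheme \<Rightarrow> ('a, 'c) chain_complex \<Rightarrow> ('a, 'd) chain_complex
     \<Rightarrow> (int \<Rightarrow> 'c \<Rightarrow> 'd) \<Rightarrow> (int \<Rightarrow> 'c \<Rightarrow> 'd) \<Rightarrow> (int \<Rightarrow> 'c \<Rightarrow> 'd) \<Rightarrow> bool" where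
  "homotopic R C D h f g \<longleftrightarrow> (\<forall>i. h i \<in> mod_hom R (obj C i) (obj D (i + 1))
     \<and> (\<forall>x\<in>carrier (obj C i). f i x \<ominus>\<^bsub>obj D i\<^esub> g i x
          = diff D (i + 1) (h i x) \<oplus>\<^bsub>obj D i\<^esub> h (i - 1) (diff C i x)))"

lemma homotopicD:
  assumes "homotopic R C D h f g"
  shows "h i \<in> mod_hom R (obj C i) (obj D (i + 1))"
    and "x \<in> carrier (obj C i) \<Longrightarrow> f i x \<ominus>\<^bsub>obj D i\<^esub> g i x
      = diff D (i + 1) (h i x) \<oplus>\<^bsub>obj D i\<^esub> h (i - 1) (diff C i x)"
  using assms by (auto simp: homotopic_def)

text \<open>The two maps have to be inverse only modulo boundaries, on cycles, in the one degree
  considered. This is the form in which \<open>pullback_homotopic\<close> delivers the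
  information.\<close>

lemma homology_iso:
  assumes C: "is_complex R C" and D: "is_complex R D"
    and a: "chain_map R C D a" and b: "chain_map R D C b"
    and ba: "\<And>x. x \<in> cycles C i \<Longrightarrow> b i (a i x) \<ominus>\<^bsub>obj C i\<^esub> x \<in> boundaries C i"
    and ab: "\<And>y. y \<in> cycles D i \<Longrightarrow> a i (b i y) \<ominus>\<^bsub>obj D i\<^esub> y \<in> boundaries D i"
  shows "mod_iso R (homology_mod C i) (homology_mod D i)"
proof -
  interpret C: module R "obj C i" by (rule complex_module[OF C])
  interpret D: module R "obj D i" by (rule complex_module[OF D])
  let ?Z = "obj C i\<lparr>carrier := cycles C i\<rparr>" and ?Y = "obj D i\<lparr>carrier := cycles D i\<rparr>"
  note BC = boundaries_submodule_cycles[OF C, of i] and BD = boundaries_submodule_cycles[OF D, of i]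
  note ZC = cycles_module[OF C, of i] and ZD = cycles_module[OF D, of i]
  interpret ZD: module R ?Y by (rule ZD)
  have cC: "x \<in> carrier (obj C i)" if "x \<in> cycles C i" for x using that by (simp add: cycles_def)
  have cD: "x \<in> carrier (obj D i)" if "x \<in> cycles D i" for x using that by (simp add: cycles_def)
  have az: "a i x \<in> cycles D i" if "x \<in> cycles C i" for x by (rule chain_map_cycles[OF C D a that])
  have bz: "b i y \<in> cycles C i" if "y \<in> cycles D i" for y by (rule chain_map_cycles[OF D C b that])
  have ah: "a i \<in> mod_hom R ?Z ?Y"
    using chain_map_hom[OF a, of i] az cC by (auto simp: mod_hom_def)
  define q where "q x = boundaries D i +>\<^bsub>?Y\<^esub> a i x" for x
  have qh: "q \<in> mod_hom R ?Z (homology_mod D i)"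
    unfolding q_def homology_mod_def by (rule mod_hom_comp[OF ah coset_hom[OF ZD BD]])
  have coset: "boundaries D i +>\<^bsub>?Y\<^esub> u = boundaries D i +>\<^bsub>?Y\<^esub> v"
    if "u \<in> cycles D i" "v \<in> cycles D i" "u \<ominus>\<^bsub>obj D i\<^esub> v \<in> boundaries D i" for u v
  proof -
    have "boundaries D i +>\<^bsub>obj D i\<^esub> u = boundaries D i +>\<^bsub>obj D i\<^esub> v"
      using coset_eq_iff[OF complex_module[OF D] boundaries_submodule[OF D]] cD that by simp
    \<comment> \<open>A coset depends only on the addition, which the smaller carrier leaves
      unchanged.\<close>
    then show ?thesis by (simp add: a_r_coset_def')
  qed
  have "q ` carrier ?Z = carrier (homology_mod D i)"
  proof (intro equalityI subsetI)
    fix X assume "X \<in> q ` carrier ?Z"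
    then obtain x where "x \<in> carrier ?Z" "X = q x" by blast
    then show "X \<in> carrier (homology_mod D i)" using mod_hom_closed[OF qh] by simp
  next
    fix X assume "X \<in> carrier (homology_mod D i)"
    then obtain y where y: "y \<in> cycles D i" "X = boundaries D i +>\<^bsub>?Y\<^esub> y"
      by (auto simp: homology_mod_def quot_mod_carrier)
    have "q (b i y) = X" unfolding q_def y(2) by (rule coset) (use y ab az bz in auto)
    then show "X \<in> q ` carrier ?Z" using bz[OF y(1)] by force
  qed
  moreover have "{x \<in> carrier ?Z. q x = \<zero>\<^bsub>homology_mod D i\<^esub>} = boundaries C i"
  proof -
    have "q x = \<zero>\<^bsub>homology_mod D i\<^esub> \<longleftrightarrow> x \<in> boundaries C i" if x: "x \<in> cycles C i" for x
    proof -
      have "q x = \<zero>\<^bsub>homology_mod D i\<^esub> \<longleftrightarrow> a i x \<in> boundaries D i"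
        unfolding q_def homology_mod_def using az[OF x] by (intro coset_eq_zero_iff[OF ZD BD]) simp
      also have "\<dots> \<longleftrightarrow> x \<in> boundaries C i"
      proof
        assume "a i x \<in> boundaries D i"
        then have "b i (a i x) \<in> boundaries C i" by (rule chain_map_boundaries[OF b])
        \<comment> \<open>The element x is recovered as the difference of the boundaries b (a x) and
          b (a x) - x.\<close>
        then have "b i (a i x) \<ominus>\<^bsub>obj C i\<^esub> (b i (a i x) \<ominus>\<^bsub>obj C i\<^esub> x) \<in> boundaries C i"
          using ba[OF x]
            by (rule submodule_minus[OF complex_module[OF C] boundaries_submodule[OF C]])
        then show "x \<in> boundaries C i"
          using C.minus_minus_cancel[OF cC[OF bz[OF az[OF x]]] cC[OF x]] by simp
      qed (rule chain_map_boundaries[OF a])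
      finally show ?thesis .
    qed
    then show ?thesis using boundaries_subset_cycles[OF C, of i] by auto
  qed
  ultimately show ?thesis
    unfolding homology_mod_def[of C]
    using quot_mod_iso[OF ZC BC module_homology[OF D] qh] by blast
qed

section \<open>Augmented complexes and the comparison theorem\<close>

definition augmentation ::
  "('a, 'q) ring_scheme \<Rightarrow> ('a, 'c) chain_complex \<Rightarrow> ('a, 'm) module \<Rightarrow> ('c \<Rightarrow> 'm) \<Rightarrow> bool" where
  "augmentation R P M \<epsilon> \<longleftrightarrow> \<epsilon> \<in> mod_hom R (obj P 0) M \<and> \<epsilon> ` carrier (obj P 0) = carrier M
     \<and> {x \<in> carrier (obj P 0). \<epsilon> x = \<zero>\<^bsub>M\<^esub>} = boundaries P 0"

text \<open>Brings the augmentation out as a witness with a name, since comparison maps must be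
  compatible with one particular augmentation on each side.\<close>

lemma resolution_iff:
  "resolution R P M \<longleftrightarrow> is_complex R P \<and> (\<forall>i<0. zero_mod (obj P i))
     \<and> (\<forall>i>0. cycles P i = boundaries P i) \<and> (\<exists>\<epsilon>. augmentation R P M \<epsilon>)"
  by (auto simp: resolution_def augmentation_def)

lemma augmentationD:
  assumes "augmentation R P M \<epsilon>"
  shows "\<epsilon> \<in> mod_hom R (obj P 0) M" "y \<in> carrier M \<Longrightarrow> y \<in> \<epsilon> ` carrier (obj P 0)"
    "x \<in> carrier (obj P 0) \<Longrightarrow> \<epsilon> x = \<zero>\<^bsub>M\<^esub> \<longleftrightarrow> x \<in> boundaries P 0"
  using assms unfolding augmentation_def by blast+

lemma lift_through_differential:
  assumes P: "module R P" "fg_projective R P" and Q: "is_complex R Q"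
    and w: "w \<in> mod_hom R P (obj Q j)" "\<And>x. x \<in> carrier P \<Longrightarrow> w x \<in> boundaries Q j"
  obtains h where "h \<in> mod_hom R P (obj Q (j + 1))" "\<And>x. x \<in> carrier P \<Longrightarrow> diff Q (j + 1) (h x) = w x"
  using fg_projective_lift[OF P complex_module[OF Q] complex_module[OF Q] w(1) complex_diff_Suc[OF Q]]
    w(2)[unfolded boundaries_def] by blast

context
  fixes R :: "('a, 'q) ring_scheme" and P :: "('a, 'c) chain_complex"
    and Q :: "('a, 'd) chain_complex" and M :: "('a, 'm) module" and \<epsilon> \<eta>
  assumes P: "is_complex R P" "\<And>i. fg_projective R (obj P i)" "\<And>i. i < 0 \<Longrightarrow> zero_mod (obj P i)"
    and \<epsilon>: "augmentation R P M \<epsilon>"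
    and Q: "is_complex R Q" "\<And>i. i < 0 \<Longrightarrow> zero_mod (obj Q i)"
      "\<And>i. i > 0 \<Longrightarrow> cycles Q i = boundaries Q i"
    and \<eta>: "augmentation R Q M \<eta>"
    and M: "module R M"
begin

text \<open>Projectivity of P provides each lift, and exactness of Q ensures that the map to be
  lifted lands in the boundaries.\<close>

lemma comparison_map:
  obtains f where "chain_map R P Q f" "\<And>x. x \<in> carrier (obj P 0) \<Longrightarrow> \<eta> (f 0 x) = \<epsilon> x"
proof -
  note mP = complex_module[OF P(1)] and mQ = complex_module[OF Q(1)]
  have int_Suc: "int (Suc n) = int n + 1" for n by simp
  \<comment> \<open>The invariant of the recursion: f composed with the incoming differential of P
    lands in the boundaries of Q, which is what the choice of the next component requires. The
    clause for n = 0 remembers the augmentations, and \<open>V\<close> is the commuting square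
    between consecutive choices.\<close>
  define W where "W n f \<longleftrightarrow> f \<in> mod_hom R (obj P (int n)) (obj Q (int n))
    \<and> (\<forall>x\<in>carrier (obj P (int n + 1)). f (diff P (int n + 1) x) \<in> boundaries Q (int n))
    \<and> (n = 0 \<longrightarrow> (\<forall>x\<in>carrier (obj P 0). \<eta> (f x) = \<epsilon> x))" for n and f :: "'c \<Rightarrow> 'd"
  define V where "V n f f' \<longleftrightarrow> (\<forall>x\<in>carrier (obj P (int n + 1)).
      diff Q (int n + 1) (f' x) = f (diff P (int n + 1) x))" for n and f f' :: "'c \<Rightarrow> 'd"
  have "\<exists>f. \<forall>n. W n (f n) \<and> V n (f n) (f (Suc n))"
  proof (rule dependent_nat_choice)
    obtain f where f: "f \<in> mod_hom R (obj P 0) (obj Q 0)"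
      "\<And>x. x \<in> carrier (obj P 0) \<Longrightarrow> \<eta> (f x) = \<epsilon> x"
      using fg_projective_lift[OF mP P(2) mQ M augmentationD(1)[OF \<epsilon>] augmentationD(1)[OF \<eta>]]
        augmentationD(2)[OF \<eta>] mod_hom_closed[OF augmentationD(1)[OF \<epsilon>]] by blast
    have "f (diff P 1 x) \<in> boundaries Q 0" if x: "x \<in> carrier (obj P 1)" for x
    proof -
      have dx: "diff P 1 x \<in> boundaries P 0" using boundaryI[of x P 0] x by simp
      then have dx': "diff P 1 x \<in> carrier (obj P 0)" using boundaries_subset[OF P(1)] by blast
      then have "\<eta> (f (diff P 1 x)) = \<zero>\<^bsub>M\<^esub>" using f(2) augmentationD(3)[OF \<epsilon> dx'] dx by simp
      then show ?thesis using augmentationD(3)[OF \<eta> mod_hom_closed[OF f(1) dx']] by simp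
    qed
    then show "\<exists>f. W 0 f" using f by (auto simp: W_def)
  next
    fix f n assume W: "W n f"
    then have f: "f \<in> mod_hom R (obj P (int n)) (obj Q (int n))"
      "\<And>x. x \<in> carrier (obj P (int n + 1)) \<Longrightarrow> f (diff P (int n + 1) x) \<in> boundaries Q (int n)"
      by (auto simp: W_def)
    obtain h where h: "h \<in> mod_hom R (obj P (int n + 1)) (obj Q (int n + 1))"
      "\<And>x. x \<in> carrier (obj P (int n + 1)) \<Longrightarrow> diff Q (int n + 1) (h x) = f (diff P (int n + 1) x)"
      using lift_through_differential[OF mP P(2) Q(1)
          mod_hom_comp[OF complex_diff_Suc[OF P(1)] f(1)] f(2)] by blast
    have "h (diff P (int n + 1 + 1) x) \<in> boundaries Q (int n + 1)"
      if x: "x \<in> carrier (obj P (int n + 1 + 1))" for x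
    proof -
      let ?y = "diff P (int n + 1 + 1) x"
      have y: "?y \<in> carrier (obj P (int n + 1))"
        by (rule mod_hom_closed[OF complex_diff_Suc[OF P(1)] x])
      have "diff Q (int n + 1) (h ?y) = f (diff P (int n + 1) ?y)" by (rule h(2)[OF y])
      also have "diff P (int n + 1) ?y = \<zero>\<^bsub>obj P (int n)\<^esub>" using complex_diff_diff_Suc[OF P(1) x]
        by simp
      also have "f \<dots> = \<zero>\<^bsub>obj Q (int n)\<^esub>" by (rule mod_hom_zero[OF mP mQ f(1)])
      finally have "h ?y \<in> cycles Q (int n + 1)"
        using mod_hom_closed[OF h(1) y] by (simp add: cycles_def)
      then show ?thesis using Q(3)[of "int n + 1"] by simp
    qed
    then show "\<exists>h. W (Suc n) h \<and> V n f h" using h unfolding W_def V_def int_Suc by blast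
  qed
  then obtain f where f: "\<And>n. W n (f n)" "\<And>n. V n (f n) (f (Suc n))" by blast
  \<comment> \<open>The recursion covers degrees n >= 0; below, both complexes vanish and zero
    completes the family.\<close>
  define F where "F i = (if i < 0 then \<lambda>x. \<zero>\<^bsub>obj Q i\<^esub> else f (nat i))" for i
  have "chain_map R P Q F"
    unfolding chain_map_def
  proof (intro allI conjI ballI)
    fix i
    show hom: "F i \<in> mod_hom R (obj P i) (obj Q i)"
      using f(1)[of "nat i"] mod_hom_const_zero[OF mQ] by (auto simp: F_def W_def)
    fix x assume x: "x \<in> carrier (obj P i)"
    show "F (i - 1) (diff P i x) = diff Q i (F i x)"
    proof (cases "i \<le> 0")
      case True
      then have "F (i - 1) (diff P i x) = \<zero>\<^bsub>obj Q (i - 1)\<^esub>" by (simp add: F_def)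
      then show ?thesis using Q(2)[of "i - 1"] True
          mod_hom_closed[OF complex_diff[OF Q(1)] mod_hom_closed[OF hom x]]
        by (simp add: zero_mod_def)
    next
      case False
      then have "i = int (nat (i - 1)) + 1" by simp
      then obtain n where n: "i = int n + 1" by blast
      have "nat i = Suc n" using n by simp
      then show ?thesis using f(2)[of n] x n by (simp add: F_def V_def)
    qed
  qed
  moreover have "\<eta> (F 0 x) = \<epsilon> x" if "x \<in> carrier (obj P 0)" for x
    using f(1)[of 0] that by (simp add: F_def W_def)
  ultimately show thesis using that by blast
qed

text \<open>With u = f - g, the components are found by solving d h_{n+1} = u - h_n d recursively.
  The start is possible because f and g induce the same map to M, so u_0 lands in the
  boundaries.\<close>

lemma comparison_homotopy:
  assumes f: "chain_map R P Q f" and g: "chain_map R P Q g"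
    and fg: "\<And>x. x \<in> carrier (obj P 0) \<Longrightarrow> \<eta> (f 0 x) = \<eta> (g 0 x)"
  obtains h where "homotopic R P Q h f g"
proof -
  note mP = complex_module[OF P(1)] and mQ = complex_module[OF Q(1)]
  have int_Suc: "int (Suc n) = int n + 1" for n by simp
  define u where "u i x = f i x \<ominus>\<^bsub>obj Q i\<^esub> g i x" for i x
  have u: "u i \<in> mod_hom R (obj P i) (obj Q i)" for i
    unfolding u_def by (rule mod_hom_diff[OF mQ chain_map_hom[OF f] chain_map_hom[OF g]])
  have du: "diff Q i (u i x) = u (i - 1) (diff P i x)" if x: "x \<in> carrier (obj P i)" for i x
    using mod_hom_minus[OF mQ mQ complex_diff[OF Q(1)] chain_map_closed[OF f x] chain_map_closed[OF g x]]
    by (simp add: u_def chain_map_diff[OF f x] chain_map_diff[OF g x])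
  define W where "W n h \<longleftrightarrow> h \<in> mod_hom R (obj P (int n)) (obj Q (int n + 1))
    \<and> (\<forall>x\<in>carrier (obj P (int n + 1)). u (int n + 1) x \<ominus>\<^bsub>obj Q (int n + 1)\<^esub> h (diff P (int n + 1) x)
          \<in> boundaries Q (int n + 1))
    \<and> (n = 0 \<longrightarrow> (\<forall>x\<in>carrier (obj P 0). diff Q 1 (h x) = u 0 x))" for n and h :: "'c \<Rightarrow> 'd"
  define V where "V n h h' \<longleftrightarrow> (\<forall>x\<in>carrier (obj P (int n + 1)). diff Q (int n + 1 + 1) (h' x)
      = u (int n + 1) x \<ominus>\<^bsub>obj Q (int n + 1)\<^esub> h (diff P (int n + 1) x))" for n and h h' :: "'c \<Rightarrow> 'd"
  \<comment> \<open>Applying d to u - h d gives u d - d h d, which vanishes when d h agrees with u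
    on d x. Hence u - h d takes cycles as values, and these are boundaries in the positive degree i
    + 1.\<close>
  have bound: "u (i + 1) x \<ominus>\<^bsub>obj Q (i + 1)\<^esub> h (diff P (i + 1) x) \<in> boundaries Q (i + 1)"
    if i: "i \<ge> 0" and h: "h \<in> mod_hom R (obj P i) (obj Q (i + 1))"
      and hd: "diff Q (i + 1) (h (diff P (i + 1) x)) = u i (diff P (i + 1) x)"
      and x: "x \<in> carrier (obj P (i + 1))" for i h x
  proof -
    have dx: "diff P (i + 1) x \<in> carrier (obj P i)"
      by (rule mod_hom_closed[OF complex_diff_Suc[OF P(1)] x])
    note cl = mod_hom_closed[OF u x] mod_hom_closed[OF h dx] mod_hom_closed[OF u dx]
    interpret Qi: module R "obj Q i" by (rule mQ)
    have "diff Q (i + 1) (u (i + 1) x \<ominus>\<^bsub>obj Q (i + 1)\<^esub> h (diff P (i + 1) x))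
        = u i (diff P (i + 1) x) \<ominus>\<^bsub>obj Q i\<^esub> u i (diff P (i + 1) x)"
      using mod_hom_minus[OF mQ mQ complex_diff_Suc[OF Q(1)] cl(1,2)] du[OF x] hd by simp
    also have "\<dots> = \<zero>\<^bsub>obj Q i\<^esub>" using Qi.minus_eq_zero_iff cl(3) by simp
    finally have "u (i + 1) x \<ominus>\<^bsub>obj Q (i + 1)\<^esub> h (diff P (i + 1) x) \<in> cycles Q (i + 1)"
      using mod_hom_closed[OF mod_hom_diff[OF mQ u mod_hom_comp[OF complex_diff_Suc[OF P(1)] h]] x]
      by (simp add: cycles_def)
    then show ?thesis using Q(3)[of "i + 1"] i by simp
  qed
  have "\<exists>h. \<forall>n. W n (h n) \<and> V n (h n) (h (Suc n))"
  proof (rule dependent_nat_choice)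
    have "u 0 x \<in> boundaries Q 0" if x: "x \<in> carrier (obj P 0)" for x
    proof -
      note cl = chain_map_closed[OF f x] chain_map_closed[OF g x]
      interpret M: module R M by (rule M)
      have "\<eta> (u 0 x) = \<zero>\<^bsub>M\<^esub>"
        using mod_hom_minus[OF mQ M augmentationD(1)[OF \<eta>] cl] fg[OF x]
          mod_hom_closed[OF augmentationD(1)[OF \<eta>] cl(2)] M.minus_eq_zero_iff by (simp add: u_def)
      then show ?thesis using augmentationD(3)[OF \<eta> mod_hom_closed[OF u x]] by simp
    qed
    then obtain h where h: "h \<in> mod_hom R (obj P 0) (obj Q (0 + 1))"
      "\<And>x. x \<in> carrier (obj P 0) \<Longrightarrow> diff Q (0 + 1) (h x) = u 0 x"
      using lift_through_differential[OF mP P(2) Q(1) u[of 0]] by blast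
    have "u (0 + 1) x \<ominus>\<^bsub>obj Q (0 + 1)\<^esub> h (diff P (0 + 1) x) \<in> boundaries Q (0 + 1)"
      if x: "x \<in> carrier (obj P (0 + 1))" for x
      by (rule bound[OF _ h(1) h(2)[OF mod_hom_closed[OF complex_diff_Suc[OF P(1)] x]] x]) simp
    then show "\<exists>h. W 0 h" using h by (auto simp: W_def)
  next
    fix h n assume W: "W n h"
    then have h: "h \<in> mod_hom R (obj P (int n)) (obj Q (int n + 1))"
      "\<And>x. x \<in> carrier (obj P (int n + 1)) \<Longrightarrow>
        u (int n + 1) x \<ominus>\<^bsub>obj Q (int n + 1)\<^esub> h (diff P (int n + 1) x) \<in> boundaries Q (int n + 1)"
      by (auto simp: W_def)
    obtain k where k: "k \<in> mod_hom R (obj P (int n + 1)) (obj Q (int n + 1 + 1))"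
      "\<And>x. x \<in> carrier (obj P (int n + 1)) \<Longrightarrow> diff Q (int n + 1 + 1) (k x)
        = u (int n + 1) x \<ominus>\<^bsub>obj Q (int n + 1)\<^esub> h (diff P (int n + 1) x)"
      using lift_through_differential[OF mP P(2) Q(1)
          mod_hom_diff[OF mQ u mod_hom_comp[OF complex_diff_Suc[OF P(1)] h(1)]] h(2)] by blast
    have "u (int n + 1 + 1) x \<ominus>\<^bsub>obj Q (int n + 1 + 1)\<^esub> k (diff P (int n + 1 + 1) x)
        \<in> boundaries Q (int n + 1 + 1)" if x: "x \<in> carrier (obj P (int n + 1 + 1))" for x
    proof (rule bound[OF _ k(1) _ x])
      let ?y = "diff P (int n + 1 + 1) x"
      interpret Qn: module R "obj Q (int n + 1)" by (rule mQ)
      have y: "?y \<in> carrier (obj P (int n + 1))"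
        by (rule mod_hom_closed[OF complex_diff_Suc[OF P(1)] x])
      \<comment> \<open>On a boundary y the correction h (d y) disappears, so the equation defining
        k gives d k y = u y, as \<open>bound\<close> demands.\<close>
      have "diff P (int n + 1) ?y = \<zero>\<^bsub>obj P (int n)\<^esub>" using complex_diff_diff_Suc[OF P(1) x] by simp
      then show "diff Q (int n + 1 + 1) (k ?y) = u (int n + 1) ?y"
        using k(2)[OF y] mod_hom_zero[OF mP mQ h(1)] mod_hom_closed[OF u y] Qn.minus_zero_right
          by simp
    qed simp
    then show "\<exists>k. W (Suc n) k \<and> V n h k" using k unfolding W_def V_def int_Suc by blast
  qed
  then obtain h where h: "\<And>n. W n (h n)" "\<And>n. V n (h n) (h (Suc n))" by blast
  define H where "H i = (if i < 0 then \<lambda>x. \<zero>\<^bsub>obj Q (i + 1)\<^esub> else h (nat i))" for i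
  have "homotopic R P Q H f g"
    unfolding homotopic_def
  proof (intro allI conjI ballI)
    fix i
    show hom: "H i \<in> mod_hom R (obj P i) (obj Q (i + 1))" for i
      using h(1)[of "nat i"] mod_hom_const_zero[OF mQ] by (auto simp: H_def W_def)
    fix x assume x: "x \<in> carrier (obj P i)"
    interpret Qi: module R "obj Q i" by (rule mQ)
    have Hd: "H (i - 1) (diff P i x) \<in> carrier (obj Q i)"
      using mod_hom_closed[OF hom mod_hom_closed[OF complex_diff[OF P(1)] x]] by simp
    have dH: "diff Q (i + 1) (H i x) \<in> carrier (obj Q i)"
      by (rule mod_hom_closed[OF complex_diff_Suc[OF Q(1)] mod_hom_closed[OF hom x]])
    note ux = mod_hom_closed[OF u x]
    have "u i x = diff Q (i + 1) (H i x) \<oplus>\<^bsub>obj Q i\<^esub> H (i - 1) (diff P i x)"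
    proof (cases "i < 0")
      case True
      then show ?thesis using Q(2)[OF True] ux Qi.a_closed[OF dH Hd] by (simp add: zero_mod_def)
    next
      case nonneg: False
      show ?thesis
      proof (cases "i = 0")
        case True
        then show ?thesis using h(1)[of 0] x Qi.r_zero[OF ux] by (simp add: H_def W_def)
      next
        case False
        with nonneg have "i = int (nat (i - 1)) + 1" by simp
        then obtain n where n: "i = int n + 1" by blast
        have "nat i = Suc n" using n by simp
        then have "diff Q (i + 1) (H i x) = u i x \<ominus>\<^bsub>obj Q i\<^esub> H (i - 1) (diff P i x)"
          using h(2)[of n] x n by (simp add: H_def V_def)
        then show ?thesis using Qi.plus_minus_cancel[OF ux Hd] Hd dH by (simp add: Qi.a_comm)
      qed
    qed
    then show "f i x \<ominus>\<^bsub>obj Q i\<^esub> g i x = diff Q (i + 1) (H i x) \<oplus>\<^bsub>obj Q i\<^esub> H (i - 1) (diff P i x)"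
      by (simp add: u_def)
  qed
  then show thesis using that by blast
qed

end

text \<open>Each composite of comparison maps is compatible with the augmentation in the same way as
  the identity, so the two are homotopic.\<close>

lemma resolutions_homotopy_equivalent:
  assumes M: "module R M"
    and P: "resolution R P M" "\<And>i. fg_projective R (obj P i)"
    and Q: "resolution R Q M" "\<And>i. fg_projective R (obj Q i)"
  obtains f g h k where "chain_map R P Q f" "chain_map R Q P g"
    "homotopic R P P h (\<lambda>i x. g i (f i x)) (\<lambda>i x. x)"
    "homotopic R Q Q k (\<lambda>i y. f i (g i y)) (\<lambda>i y. y)"
proof -
  obtain \<epsilon> where P': "is_complex R P" "\<And>i. i < 0 \<Longrightarrow> zero_mod (obj P i)"
      "\<And>i. i > 0 \<Longrightarrow> cycles P i = boundaries P i" "augmentation R P M \<epsilon>"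
    using P(1) by (auto simp: resolution_iff)
  obtain \<eta> where Q': "is_complex R Q" "\<And>i. i < 0 \<Longrightarrow> zero_mod (obj Q i)"
      "\<And>i. i > 0 \<Longrightarrow> cycles Q i = boundaries Q i" "augmentation R Q M \<eta>"
    using Q(1) by (auto simp: resolution_iff)
  obtain f where f: "chain_map R P Q f" "\<And>x. x \<in> carrier (obj P 0) \<Longrightarrow> \<eta> (f 0 x) = \<epsilon> x"
    using comparison_map[OF P'(1) P(2) P'(2,4) Q'(1-4) M] by blast
  obtain g where g: "chain_map R Q P g" "\<And>x. x \<in> carrier (obj Q 0) \<Longrightarrow> \<epsilon> (g 0 x) = \<eta> x"
    using comparison_map[OF Q'(1) Q(2) Q'(2,4) P'(1-4) M] by blast
  obtain h where h: "homotopic R P P h (\<lambda>i x. g i (f i x)) (\<lambda>i x. x)"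
    using comparison_homotopy[OF P'(1) P(2) P'(2,4) P'(1-4) M chain_map_comp[OF f(1) g(1)] chain_map_ident]
      f(2) g(2) chain_map_closed[OF f(1)] by (metis (no_types, lifting))
  obtain k where k: "homotopic R Q Q k (\<lambda>i y. f i (g i y)) (\<lambda>i y. y)"
    using comparison_homotopy[OF Q'(1) Q(2) Q'(2,4) Q'(1-4) M chain_map_comp[OF g(1) f(1)] chain_map_ident]
      f(2) g(2) chain_map_closed[OF g(1)] by (metis (no_types, lifting))
  show thesis by (rule that[OF f(1) g(1) h k])
qed

section \<open>Minimal resolutions\<close>

text \<open>Projective in place of free, so that minimality passes to duals and to truncations by
  dual bases, without choosing bases of the new modules.\<close>

definition minimal_complex :: "('a, 'q) ring_scheme \<Rightarrow> ('a, 'c) chain_complex \<Rightarrow> bool" where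
  "minimal_complex R C \<longleftrightarrow> (\<forall>i. fg_projective R (obj C i)
     \<and> boundaries C i \<subseteq> ideal_smult R (max_ideal R) (obj C i))"

text \<open>Write u - id = d h + h d. The first term lies in the maximal ideal times C by
  minimality; so does the second, since the homomorphism h preserves that condition.\<close>

lemma minimal_homotopic_identity_bij:
  assumes R: "noetherian_ring R" "local_ring R"
    and C: "is_complex R C" "minimal_complex R C"
    and u: "chain_map R C C u" and h: "homotopic R C C h u (\<lambda>i x. x)"
  shows "bij_betw (u i) (carrier (obj C i)) (carrier (obj C i))"
proof (rule identity_mod_maximal_bij[OF R complex_module[OF C(1)] _ chain_map_hom[OF u]])
  interpret m: maximalideal "max_ideal R" R by (rule local_ring_maximalideal[OF R(2)])
  note mC = complex_module[OF C(1)]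
  have min: "boundaries C i \<subseteq> ideal_smult R (max_ideal R) (obj C i)" for i
    using C(2) by (simp add: minimal_complex_def)
  show "fg_projective R (obj C i)" using C(2) by (simp add: minimal_complex_def)
  fix x assume x: "x \<in> carrier (obj C i)"
  note H = homotopicD[OF h]
  have "diff C (i + 1) (h i x) \<in> ideal_smult R (max_ideal R) (obj C i)"
    using boundaryI[OF mod_hom_closed[OF H(1) x]] min by blast
  moreover have "h (i - 1) (diff C i x) \<in> ideal_smult R (max_ideal R) (obj C i)"
    using mod_hom_ideal_smult[OF mC mC m.is_ideal H(1)[of "i - 1"]] boundaryI'[OF x] min
      by fastforce
  ultimately show "u i x \<ominus>\<^bsub>obj C i\<^esub> x \<in> ideal_smult R (max_ideal R) (obj C i)"
    using H(2)[OF x] module.submoduleE(5)[OF mC ideal_smult_submodule[OF mC m.is_ideal]] by simp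
qed

lemma minimal_resolution_unique:
  assumes R: "noetherian_ring R" "local_ring R" and M: "module R M"
    and F: "resolution R F M" "minimal_complex R F"
    and D: "resolution R D M" "minimal_complex R D"
  obtains \<theta> where "chain_map R F D \<theta>" "\<And>i. bij_betw (\<theta> i) (carrier (obj F i)) (carrier (obj D i))"
proof -
  have proj: "fg_projective R (obj F i)" "fg_projective R (obj D i)" for i
    using F(2) D(2) by (auto simp: minimal_complex_def)
  have cx: "is_complex R F" "is_complex R D" using F(1) D(1) by (auto simp: resolution_def)
  obtain f g h k where fg: "chain_map R F D f" "chain_map R D F g"
    "homotopic R F F h (\<lambda>i x. g i (f i x)) (\<lambda>i x. x)"
    "homotopic R D D k (\<lambda>i y. f i (g i y)) (\<lambda>i y. y)"
    using resolutions_homotopy_equivalent[OF M F(1) proj(1) D(1) proj(2)] .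
  have gf: "bij_betw (\<lambda>x. g i (f i x)) (carrier (obj F i)) (carrier (obj F i))" for i
    by (rule minimal_homotopic_identity_bij[OF R cx(1) F(2) chain_map_comp[OF fg(1,2)] fg(3)])
  have fg': "bij_betw (\<lambda>y. f i (g i y)) (carrier (obj D i)) (carrier (obj D i))" for i
    by (rule minimal_homotopic_identity_bij[OF R cx(2) D(2) chain_map_comp[OF fg(2,1)] fg(4)])
  have "bij_betw (f i) (carrier (obj F i)) (carrier (obj D i))" for i
    unfolding bij_betw_def
  proof
    show "inj_on (f i) (carrier (obj F i))"
      using bij_betw_imp_inj_on[OF gf[of i]] by (rule inj_on_imageI2[unfolded comp_def])
    show "f i ` carrier (obj F i) = carrier (obj D i)"
      using bij_betw_imp_surj_on[OF fg'[of i]] chain_map_closed[OF fg(1)] chain_map_closed[OF fg(2)]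
      by blast
  qed
  then show thesis using that fg(1) by blast
qed

text \<open>The composite F_i -> P_i -> F_i is bijective and factors through zero. Consequently no
  projective resolution is shorter than the minimal one, which lets the projective dimension be read
  off F.\<close>

lemma minimal_resolution_zero_mod:
  assumes R: "noetherian_ring R" "local_ring R" and M: "module R M"
    and F: "resolution R F M" "minimal_complex R F"
    and P: "projective_resolution R P M" and z: "zero_mod (obj P i)"
  shows "zero_mod (obj F i)"
proof -
  have proj: "fg_projective R (obj F i)" for i using F(2) by (auto simp: minimal_complex_def)
  have cx: "is_complex R F" "is_complex R P"
    using F(1) P by (auto simp: resolution_def projective_resolution_def)
  obtain f g h k where fg: "chain_map R F P f" "chain_map R P F g"
    "homotopic R F F h (\<lambda>i x. g i (f i x)) (\<lambda>i x. x)"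
    "homotopic R P P k (\<lambda>i y. f i (g i y)) (\<lambda>i y. y)"
    using resolutions_homotopy_equivalent[OF M F(1) proj] P unfolding projective_resolution_def
      by blast
  have gf: "bij_betw (\<lambda>x. g i (f i x)) (carrier (obj F i)) (carrier (obj F i))"
    by (rule minimal_homotopic_identity_bij[OF R cx(1) F(2) chain_map_comp[OF fg(1,2)] fg(3)])
  have "g i (f i x) = \<zero>\<^bsub>obj F i\<^esub>" if "x \<in> carrier (obj F i)" for x
    using chain_map_closed[OF fg(1) that] z mod_hom_zero[OF complex_module[OF cx(2)] complex_module[OF cx(1)] chain_map_hom[OF fg(2)]]
    by (simp add: zero_mod_def)
  then have "(\<lambda>x. g i (f i x)) ` carrier (obj F i) \<subseteq> {\<zero>\<^bsub>obj F i\<^esub>}" by blast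
  moreover have "\<zero>\<^bsub>obj F i\<^esub> \<in> carrier (obj F i)"
    using submodule_zero module.carrier_is_submodule complex_module[OF cx(1)] by blast
  ultimately show ?thesis unfolding zero_mod_def using bij_betw_imp_surj_on[OF gf] by blast
qed

section \<open>Ext and projective dimension from a given resolution\<close>

lemma Hom_complex_simps [simp]:
  "obj (Hom_complex R C N) j = Hom_mod R (obj C (- j)) N"
  "diff (Hom_complex R C N) j = (\<lambda>f. \<lambda>x\<in>carrier (obj C (1 - j)). f (diff C (1 - j) x))"
  by (simp_all add: Hom_complex_def)

lemma is_complex_Hom_complex:
  assumes C: "is_complex R C" and N: "module R N"
  shows "is_complex R (Hom_complex R C N)"
  unfolding is_complex_def
proof (intro allI conjI ballI)
  note mC = complex_module[OF C]
  fix j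
  show "module R (obj (Hom_complex R C N) j)" by (simp add: module_Hom_mod mC N)
  note d = complex_diff[OF C, of "1 - j", simplified]
  have d2: "diff C (- j + 1) (diff C (2 - j) x) = \<zero>\<^bsub>obj C (- j)\<^esub>"
    if "x \<in> carrier (obj C (2 - j))" for x
    using complex_diff_diff[OF C that] by (simp add: algebra_simps)
  have dcl: "diff C (1 - j) x \<in> carrier (obj C (- j))" if "x \<in> carrier (obj C (1 - j))" for x
    by (rule mod_hom_closed[OF d that])
  show "diff (Hom_complex R C N) j \<in> mod_hom R (obj (Hom_complex R C N) j) (obj (Hom_complex R C N) (j - 1))"
  proof (rule mod_homI)
    fix f assume "f \<in> carrier (obj (Hom_complex R C N) j)"
    then have "f \<in> mod_hom R (obj C (- j)) N" by (simp add: Hom_mod_simps)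
    then show "diff (Hom_complex R C N) j f \<in> carrier (obj (Hom_complex R C N) (j - 1))"
      using restrict_in_Hom_mod[OF mC mod_hom_comp[OF d]] by simp
  qed (auto simp: Hom_mod_def dcl intro!: restrict_ext)
  fix f assume "f \<in> carrier (obj (Hom_complex R C N) j)"
  then have f: "f \<in> mod_hom R (obj C (- j)) N" by (simp add: Hom_mod_simps)
  have "diff C (2 - j) x \<in> carrier (obj C (1 - j))" if "x \<in> carrier (obj C (2 - j))" for x
    using mod_hom_closed[OF complex_diff[OF C] that] by (simp add: algebra_simps)
  then show "diff (Hom_complex R C N) (j - 1) (diff (Hom_complex R C N) j f)
      = \<zero>\<^bsub>obj (Hom_complex R C N) (j - 2)\<^esub>"
    using d2 mod_hom_zero[OF mC N f]
    by (auto simp: Hom_mod_def algebra_simps intro!: restrict_ext)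
qed

definition pullback ::
  "('a, 'c) chain_complex \<Rightarrow> (int \<Rightarrow> 'c \<Rightarrow> 'd) \<Rightarrow> int \<Rightarrow> ('d \<Rightarrow> 'n) \<Rightarrow> 'c \<Rightarrow> 'n" where
  "pullback C f j \<phi> = (\<lambda>x\<in>carrier (obj C (- j)). \<phi> (f (- j) x))"

lemma pullback_chain_map:
  assumes C: "is_complex R C" and D: "is_complex R D" and N: "module R N" and f: "chain_map R C D f"
  shows "chain_map R (Hom_complex R D N) (Hom_complex R C N) (pullback C f)"
  unfolding chain_map_def
proof (intro allI conjI ballI)
  fix j
  show "pullback C f j \<in> mod_hom R (obj (Hom_complex R D N) j) (obj (Hom_complex R C N) j)"
  proof (rule mod_homI)
    fix \<phi> assume "\<phi> \<in> carrier (obj (Hom_complex R D N) j)"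
    then have "\<phi> \<in> mod_hom R (obj D (- j)) N" by (simp add: Hom_mod_simps)
    then show "pullback C f j \<phi> \<in> carrier (obj (Hom_complex R C N) j)"
      unfolding pullback_def Hom_complex_simps
      by (intro restrict_in_Hom_mod[OF complex_module[OF C]] mod_hom_comp[OF chain_map_hom[OF f]])
  qed (auto simp: pullback_def Hom_mod_def chain_map_closed[OF f] intro!: restrict_ext)
  fix \<phi> assume "\<phi> \<in> carrier (obj (Hom_complex R D N) j)"
  have "diff C (1 - j) x \<in> carrier (obj C (- j))" if "x \<in> carrier (obj C (1 - j))" for x
    using mod_hom_closed[OF complex_diff[OF C] that] by simp
  then show "pullback C f (j - 1) (diff (Hom_complex R D N) j \<phi>) = diff (Hom_complex R C N) j (pullback C f j \<phi>)"
    using chain_map_diff[OF f, of _ "1 - j"] chain_map_closed[OF f, of _ "1 - j"]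
    by (auto simp: pullback_def intro!: restrict_ext)
qed

text \<open>Composing u - id = d h + h d with a cocycle \<open>\<phi>\<close> kills the first term
  and leaves (\<open>\<phi>\<close> h) d. So \<open>\<phi>\<close> h is the cochain that bounds the
  difference.\<close>

lemma pullback_homotopic:
  assumes C: "is_complex R C" and N: "module R N" and u: "chain_map R C C u"
    and h: "homotopic R C C h u (\<lambda>i x. x)" and \<phi>: "\<phi> \<in> cycles (Hom_complex R C N) j"
  shows "pullback C u j \<phi> \<ominus>\<^bsub>obj (Hom_complex R C N) j\<^esub> \<phi> \<in> boundaries (Hom_complex R C N) j"
proof -
  interpret N: module R N by fact
  note mC = complex_module[OF C]
  have \<phi>m: "\<phi> \<in> carrier (Hom_mod R (obj C (- j)) N)" using \<phi> by (simp add: cycles_def)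
  then have \<phi>h: "\<phi> \<in> mod_hom R (obj C (- j)) N" by (simp add: Hom_mod_simps)
  have \<phi>d: "\<phi> (diff C (1 - j) z) = \<zero>\<^bsub>N\<^esub>" if z: "z \<in> carrier (obj C (1 - j))" for z
  proof -
    have "\<phi> (diff C (1 - j) z) = diff (Hom_complex R C N) j \<phi> z" using z by simp
    also have "diff (Hom_complex R C N) j \<phi> = \<zero>\<^bsub>obj (Hom_complex R C N) (j - 1)\<^esub>"
      using \<phi> unfolding cycles_def by blast
    finally show ?thesis using z by (simp add: Hom_mod_simps)
  qed
  note hh = homotopicD(1)[OF h, of "- j - 1", simplified]
  define \<psi> where "\<psi> = (\<lambda>y\<in>carrier (obj C (- j - 1)). \<phi> (h (- j - 1) y))"
  have \<psi>: "\<psi> \<in> carrier (obj (Hom_complex R C N) (j + 1))"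
    using restrict_in_Hom_mod[OF mC mod_hom_comp[OF hh \<phi>h]] by (simp add: \<psi>_def)
  interpret H: module R "Hom_mod R (obj C (- j)) N" by (rule module_Hom_mod[OF mC N])
  have pb: "pullback C u j \<phi> \<in> carrier (Hom_mod R (obj C (- j)) N)"
    using chain_map_closed[OF pullback_chain_map[OF C C N u], of \<phi> j] \<phi>m by simp
  have ev: "(\<alpha> \<ominus>\<^bsub>Hom_mod R (obj C (- j)) N\<^esub> \<beta>) x = \<alpha> x \<ominus>\<^bsub>N\<^esub> \<beta> x"
    if "x \<in> carrier (obj C (- j))" "\<alpha> \<in> carrier (Hom_mod R (obj C (- j)) N)"
      "\<beta> \<in> carrier (Hom_mod R (obj C (- j)) N)" for \<alpha> \<beta> x
    using mod_hom_minus[OF module_Hom_mod[OF mC N] N evaluation_hom[OF that(1)] that(2,3)] .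
  have "pullback C u j \<phi> \<ominus>\<^bsub>obj (Hom_complex R C N) j\<^esub> \<phi> = diff (Hom_complex R C N) (j + 1) \<psi>"
  proof (rule Hom_mod_eqI[of _ R "obj C (- j)" N])
    show "pullback C u j \<phi> \<ominus>\<^bsub>obj (Hom_complex R C N) j\<^esub> \<phi> \<in> carrier (Hom_mod R (obj C (- j)) N)"
      using pb \<phi>m by simp
    show "diff (Hom_complex R C N) (j + 1) \<psi> \<in> carrier (Hom_mod R (obj C (- j)) N)"
      using mod_hom_closed[OF complex_diff_Suc[OF is_complex_Hom_complex[OF C N]] \<psi>] by simp
    fix x assume x: "x \<in> carrier (obj C (- j))"
    note hx = mod_hom_closed[OF homotopicD(1)[OF h] x]
    have dx: "diff C (- j) x \<in> carrier (obj C (- j - 1))"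
      by (rule mod_hom_closed[OF complex_diff[OF C] x])
    note hdx = mod_hom_closed[OF hh dx]
    have "(pullback C u j \<phi> \<ominus>\<^bsub>obj (Hom_complex R C N) j\<^esub> \<phi>) x = \<phi> (u (- j) x) \<ominus>\<^bsub>N\<^esub> \<phi> x"
      using x by (simp add: ev pb \<phi>m) (simp add: pullback_def)
    also have "\<dots> = \<phi> (u (- j) x \<ominus>\<^bsub>obj C (- j)\<^esub> x)"
      by (simp add: mod_hom_minus[OF mC N \<phi>h chain_map_closed[OF u x] x])
    also have "\<dots> = \<phi> (diff C (- j + 1) (h (- j) x)) \<oplus>\<^bsub>N\<^esub> \<phi> (h (- j - 1) (diff C (- j) x))"
      unfolding homotopicD(2)[OF h x]
      by (rule mod_hom_add[OF \<phi>h mod_hom_closed[OF complex_diff_Suc[OF C] hx] hdx])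
    also have "\<dots> = \<phi> (h (- j - 1) (diff C (- j) x))"
      using \<phi>d hx mod_hom_closed[OF \<phi>h hdx] by simp
    also have "\<dots> = diff (Hom_complex R C N) (j + 1) \<psi> x" using x dx by (simp add: \<psi>_def)
    finally show "(pullback C u j \<phi> \<ominus>\<^bsub>obj (Hom_complex R C N) j\<^esub> \<phi>) x
      = diff (Hom_complex R C N) (j + 1) \<psi> x" .
  qed
  then show ?thesis using boundaryI[OF \<psi>] by simp
qed

lemma homology_Hom_complex_iso:
  assumes M: "module R M" and N: "module R N"
    and P: "resolution R P M" "\<And>i. fg_projective R (obj P i)"
    and Q: "resolution R Q M" "\<And>i. fg_projective R (obj Q i)"
  shows "mod_iso R (homology_mod (Hom_complex R P N) j) (homology_mod (Hom_complex R Q N) j)"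
proof -
  have cx: "is_complex R P" "is_complex R Q" using P(1) Q(1) by (auto simp: resolution_def)
  obtain f g h k where fg: "chain_map R P Q f" "chain_map R Q P g"
    "homotopic R P P h (\<lambda>i x. g i (f i x)) (\<lambda>i x. x)"
    "homotopic R Q Q k (\<lambda>i y. f i (g i y)) (\<lambda>i y. y)"
    using resolutions_homotopy_equivalent[OF M P Q] .
  have comp: "pullback P f j (pullback Q g j \<phi>) = pullback P (\<lambda>i x. g i (f i x)) j \<phi>" for \<phi>
    using chain_map_closed[OF fg(1), of _ "- j"] by (auto simp: pullback_def intro!: restrict_ext)
  have comp': "pullback Q g j (pullback P f j \<phi>) = pullback Q (\<lambda>i y. f i (g i y)) j \<phi>" for \<phi>
    using chain_map_closed[OF fg(2), of _ "- j"] by (auto simp: pullback_def intro!: restrict_ext)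
  show ?thesis
  proof (rule homology_iso[OF is_complex_Hom_complex[OF cx(1) N] is_complex_Hom_complex[OF cx(2) N]
        pullback_chain_map[OF cx(2,1) N fg(2)] pullback_chain_map[OF cx N fg(1)]])
    show "pullback P f j (pullback Q g j \<phi>) \<ominus>\<^bsub>obj (Hom_complex R P N) j\<^esub> \<phi>
        \<in> boundaries (Hom_complex R P N) j" if "\<phi> \<in> cycles (Hom_complex R P N) j" for \<phi>
      unfolding comp by (rule pullback_homotopic[OF cx(1) N chain_map_comp[OF fg(1,2)] fg(3) that])
    show "pullback Q g j (pullback P f j \<phi>) \<ominus>\<^bsub>obj (Hom_complex R Q N) j\<^esub> \<phi>
        \<in> boundaries (Hom_complex R Q N) j" if "\<phi> \<in> cycles (Hom_complex R Q N) j" for \<phi>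
      unfolding comp' by (rule pullback_homotopic[OF cx(2) N chain_map_comp[OF fg(2,1)] fg(4) that])
  qed
qed

section \<open>Transport of resolutions; Ext and projective dimension computed from F\<close>

lemma bij_hom_eq_zero_iff:
  assumes "module R M" "module R N" "f \<in> mod_hom R M N" "bij_betw f (carrier M) (carrier N)"
    "x \<in> carrier M"
  shows "f x = \<zero>\<^bsub>N\<^esub> \<longleftrightarrow> x = \<zero>\<^bsub>M\<^esub>"
proof -
  interpret M: module R M by fact
  show ?thesis
    using inj_onD[OF bij_betw_imp_inj_on[OF assms(4)], of x "\<zero>\<^bsub>M\<^esub>"] assms(5)
    by (auto simp: mod_hom_zero[OF assms(1-3)])
qed

text \<open>The two complexes may be compared in some degrees only. \<open>I\<close> is closed
  downwards and contains degrees 0 and 1, which determine the cokernel. Exactness at i transfers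
  when i - 1, i and i + 1 all lie in \<open>I\<close>, and is otherwise demanded of
  \<open>P\<close>. With \<open>I\<close> = \<open>UNIV\<close> this is transport along an
  isomorphism; part (2) uses a proper initial segment.\<close>

lemma resolution_transfer:
  assumes F: "resolution R F M" and P: "is_complex R P"
    and I: "\<And>i. i \<le> 1 \<Longrightarrow> i \<in> I" "\<And>i. i \<in> I \<Longrightarrow> i - 1 \<in> I"
    and \<theta>: "\<And>i. i \<in> I \<Longrightarrow> \<theta> i \<in> mod_hom R (obj F i) (obj P i)"
      "\<And>i. i \<in> I \<Longrightarrow> bij_betw (\<theta> i) (carrier (obj F i)) (carrier (obj P i))"
      "\<And>i x. i \<in> I \<Longrightarrow> x \<in> carrier (obj F i) \<Longrightarrow> \<theta> (i - 1) (diff F i x) = diff P i (\<theta> i x)"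
    and ex: "\<And>i. i > 0 \<Longrightarrow> i + 1 \<notin> I \<Longrightarrow> cycles P i = boundaries P i"
  shows "resolution R P M"
proof -
  obtain \<epsilon> where F': "is_complex R F" "\<And>i. i < 0 \<Longrightarrow> zero_mod (obj F i)"
      "\<And>i. i > 0 \<Longrightarrow> cycles F i = boundaries F i" "augmentation R F M \<epsilon>"
    using F by (auto simp: resolution_iff)
  note mF = complex_module[OF F'(1)] and mP = complex_module[OF P]
  have preimage: "\<exists>x\<in>carrier (obj F i). y = \<theta> i x" if "i \<in> I" "y \<in> carrier (obj P i)" for i y
    using bij_betw_imp_surj_on[OF \<theta>(2)[OF that(1)]] that(2) by blast
  \<comment> \<open>One direction pulls a bounding element back along \<open>\<theta>\<close> in
    degree i + 1 and then cancels \<open>\<theta>\<close> in degree i.\<close>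
  have bd: "\<theta> i x \<in> boundaries P i \<longleftrightarrow> x \<in> boundaries F i"
    if i: "i + 1 \<in> I" and x: "x \<in> carrier (obj F i)" for i x
  proof
    have i': "i \<in> I" using I(2)[OF i] by simp
    have comm: "\<theta> i (diff F (i + 1) z) = diff P (i + 1) (\<theta> (i + 1) z)"
      if "z \<in> carrier (obj F (i + 1))" for z
      using \<theta>(3)[OF i that] by simp
    show "\<theta> i x \<in> boundaries P i" if "x \<in> boundaries F i"
      using that comm mod_hom_closed[OF \<theta>(1)[OF i]] by (auto simp: boundaries_def)
    assume "\<theta> i x \<in> boundaries P i"
    then obtain y where y: "y \<in> carrier (obj P (i + 1))" "\<theta> i x = diff P (i + 1) y"
      by (auto simp: boundaries_def)
    obtain z where z: "z \<in> carrier (obj F (i + 1))" "y = \<theta> (i + 1) z" using preimage[OF i y(1)]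
      by blast
    have "\<theta> i x = \<theta> i (diff F (i + 1) z)" using comm[OF z(1)] y(2) z(2) by simp
    then have "x = diff F (i + 1) z"
      using inj_onD[OF bij_betw_imp_inj_on[OF \<theta>(2)[OF i']]] x
        mod_hom_closed[OF complex_diff_Suc[OF F'(1)] z(1)] by blast
    then show "x \<in> boundaries F i" using boundaryI[OF z(1)] by simp
  qed
  have "zero_mod (obj P i)" if i: "i < 0" for i
  proof -
    have "i \<in> I" using I(1) i by simp
    then have "mod_iso R (obj F i) (obj P i)" using \<theta>(1,2) unfolding mod_iso_def by blast
    then show ?thesis using mod_iso_zero_mod[OF mF mP] F'(2)[OF i] by blast
  qed
  moreover have "cycles P i = boundaries P i" if i: "i > 0" for i
  proof (cases "i + 1 \<in> I")
    case True
    have i': "i \<in> I" using I(2)[OF True] by simp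
    have "y \<in> boundaries P i" if "y \<in> cycles P i" for y
    proof -
      have y: "y \<in> carrier (obj P i)" "diff P i y = \<zero>\<^bsub>obj P (i - 1)\<^esub>" using that
        by (auto simp: cycles_def)
      obtain x where x: "x \<in> carrier (obj F i)" "y = \<theta> i x" using preimage[OF i' y(1)] by blast
      have "\<theta> (i - 1) (diff F i x) = \<zero>\<^bsub>obj P (i - 1)\<^esub>" using \<theta>(3)[OF i' x(1)] x(2) y(2) by simp
      then have "diff F i x = \<zero>\<^bsub>obj F (i - 1)\<^esub>"
        using bij_hom_eq_zero_iff[OF mF mP \<theta>(1,2)[OF I(2)[OF i']]]
          mod_hom_closed[OF complex_diff[OF F'(1)] x(1)] by blast
      then have "x \<in> boundaries F i" using x(1) F'(3)[OF i] unfolding cycles_def by blast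
      then show ?thesis using bd[OF True x(1)] x(2) by simp
    qed
    then show ?thesis using boundaries_subset_cycles[OF P, of i] by blast
  qed (rule ex[OF i])
  moreover have "augmentation R P M (\<lambda>y. \<epsilon> (inv_into (carrier (obj F 0)) (\<theta> 0) y))"
    unfolding augmentation_def
  proof (intro conjI)
    note E = augmentationD[OF F'(4)]
    have I0: "0 \<in> I" and I1: "0 + 1 \<in> I" using I(1) by simp_all
    define \<theta>' where "\<theta>' = inv_into (carrier (obj F 0)) (\<theta> 0)"
    have inv: "\<theta>' \<in> mod_hom R (obj P 0) (obj F 0)"
      unfolding \<theta>'_def by (rule mod_hom_inv_into[OF mF \<theta>(1,2)[OF I0]])
    have l: "\<theta>' (\<theta> 0 x) = x" if "x \<in> carrier (obj F 0)" for x
      using bij_betw_inv_into_left[OF \<theta>(2)[OF I0] that] by (simp add: \<theta>'_def)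
    have r: "\<theta> 0 (\<theta>' y) = y" if "y \<in> carrier (obj P 0)" for y
      using bij_betw_inv_into_right[OF \<theta>(2)[OF I0] that] by (simp add: \<theta>'_def)
    show hom: "(\<lambda>y. \<epsilon> (inv_into (carrier (obj F 0)) (\<theta> 0) y)) \<in> mod_hom R (obj P 0) M"
      using mod_hom_comp[OF inv E(1)] by (simp add: \<theta>'_def)
    show "(\<lambda>y. \<epsilon> (inv_into (carrier (obj F 0)) (\<theta> 0) y)) ` carrier (obj P 0) = carrier M"
    proof (intro equalityI subsetI)
      fix z assume "z \<in> carrier M"
      then obtain x where x: "x \<in> carrier (obj F 0)" "z = \<epsilon> x" using E(2) by blast
      then have "z = \<epsilon> (\<theta>' (\<theta> 0 x))" using l by simp
      then show "z \<in> (\<lambda>y. \<epsilon> (inv_into (carrier (obj F 0)) (\<theta> 0) y)) ` carrier (obj P 0)"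
        using mod_hom_closed[OF \<theta>(1)[OF I0] x(1)] unfolding \<theta>'_def by blast
    qed (use mod_hom_closed[OF hom] in blast)
    have "\<epsilon> (\<theta>' y) = \<zero>\<^bsub>M\<^esub> \<longleftrightarrow> y \<in> boundaries P 0" if y: "y \<in> carrier (obj P 0)" for y
      using E(3)[OF mod_hom_closed[OF inv y]] bd[OF I1 mod_hom_closed[OF inv y]] r[OF y] by simp
    then show "{y \<in> carrier (obj P 0). \<epsilon> (inv_into (carrier (obj F 0)) (\<theta> 0) y) = \<zero>\<^bsub>M\<^esub>} = boundaries P 0"
      using boundaries_subset[OF P, of 0] unfolding \<theta>'_def by blast
  qed
  ultimately show ?thesis using P unfolding resolution_iff by blast
qed

text \<open>\<open>Ext_mod\<close> and \<open>proj_dim\<close> range over complexes with elements of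
  type \<open>nat => 'a\<close>. Choosing coordinates replaces each F_i by some R^n, and the
  differentials are conjugated by the coordinate maps.\<close>

lemma free_resolution_transport:
  fixes F :: "('a, 'c) chain_complex"
  assumes F: "resolution R F M" "\<And>i. fg_free R (obj F i)"
  obtains P :: "('a, nat \<Rightarrow> 'a) chain_complex" where "projective_resolution R P M"
    "\<And>i. zero_mod (obj F i) \<Longrightarrow> zero_mod (obj P i)"
proof -
  have cF: "is_complex R F" using F(1) by (simp add: resolution_def)
  note mF = complex_module[OF cF]
  have cr: "cring R" using mF by (simp add: module_def)
  have "\<forall>i. \<exists>n \<theta>. \<theta> \<in> mod_hom R (obj F i) (free_mod R n)
      \<and> bij_betw \<theta> (carrier (obj F i)) (carrier (free_mod R n))"
    using F(2) unfolding fg_free_def mod_iso_def by blast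
  then obtain n \<theta> where \<theta>: "\<And>i. \<theta> i \<in> mod_hom R (obj F i) (free_mod R (n i))"
    "\<And>i. bij_betw (\<theta> i) (carrier (obj F i)) (carrier (free_mod R (n i)))"
    by metis
  define \<theta>' where "\<theta>' i = inv_into (carrier (obj F i)) (\<theta> i)" for i
  have inv: "\<theta>' i \<in> mod_hom R (free_mod R (n i)) (obj F i)" for i
    unfolding \<theta>'_def by (rule mod_hom_inv_into[OF mF \<theta>])
  have l: "\<theta>' i (\<theta> i x) = x" if "x \<in> carrier (obj F i)" for i x
    using bij_betw_inv_into_left[OF \<theta>(2) that] by (simp add: \<theta>'_def)
  define P where "P = \<lparr>obj = (\<lambda>i. free_mod R (n i)), diff = (\<lambda>i x. \<theta> (i - 1) (diff F i (\<theta>' i x)))\<rparr>"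
  have Ps: "obj P i = free_mod R (n i)" "diff P i x = \<theta> (i - 1) (diff F i (\<theta>' i x))" for i x
    by (simp_all add: P_def)
  have cP: "is_complex R P"
    unfolding is_complex_def
  proof (intro allI conjI ballI)
    fix i
    show "module R (obj P i)" unfolding Ps by (rule module_free[OF cr])
    show "diff P i \<in> mod_hom R (obj P i) (obj P (i - 1))"
      using mod_hom_comp[OF mod_hom_comp[OF inv complex_diff[OF cF]] \<theta>(1), of i]
        by (simp add: P_def)
    fix x assume "x \<in> carrier (obj P i)"
    then have x': "\<theta>' i x \<in> carrier (obj F i)" unfolding Ps by (rule mod_hom_closed[OF inv])
    have "diff P (i - 1) (diff P i x) = \<theta> (i - 2) (diff F (i - 1) (diff F i (\<theta>' i x)))"
      using l[OF mod_hom_closed[OF complex_diff[OF cF] x']] by (simp add: Ps)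
    also have "\<dots> = \<zero>\<^bsub>obj P (i - 2)\<^esub>"
      using complex_diff_diff[OF cF x'] mod_hom_zero[OF mF module_free[OF cr] \<theta>(1)]
        by (simp add: Ps)
    finally show "diff P (i - 1) (diff P i x) = \<zero>\<^bsub>obj P (i - 2)\<^esub>" .
  qed
  have "resolution R P M"
    by (rule resolution_transfer[OF F(1) cP, of UNIV \<theta>]) (simp_all add: Ps \<theta> l)
  then have "projective_resolution R P M"
    by (simp add: projective_resolution_def Ps fg_projective_free)
  moreover have "zero_mod (obj P i)" if "zero_mod (obj F i)" for i
    using mod_iso_zero_mod[OF mF module_free[OF cr]] \<theta> that unfolding Ps mod_iso_def by blast
  ultimately show thesis using that by blast
qed

text \<open>\<open>Ext_mod\<close> uses a resolution picked by \<open>SOME\<close>. The transported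
  F shows that the choice succeeds, and homotopy invariance makes its outcome immaterial up to
  isomorphism.\<close>

lemma Ext_mod_iso:
  fixes F :: "('a, 'c) chain_complex"
  assumes M: "module R M" and N: "module R N"
    and F: "resolution R F M" "\<And>i. fg_free R (obj F i)"
  shows "module R (Ext_mod R i M N)"
    and "mod_iso R (Ext_mod R i M N) (homology_mod (Hom_complex R F N) (- int i))"
proof -
  have cF: "is_complex R F" using F(1) by (simp add: resolution_def)
  have pF: "fg_projective R (obj F i)" for i
    by (rule fg_free_imp_fg_projective[OF complex_module[OF cF] F(2)])
  define P :: "('a, nat \<Rightarrow> 'a) chain_complex" where "P = (SOME P. projective_resolution R P M)"
  have "\<exists>P :: ('a, nat \<Rightarrow> 'a) chain_complex. projective_resolution R P M"
    using free_resolution_transport[OF F] by metis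
  then have P: "projective_resolution R P M" unfolding P_def by (rule someI_ex)
  have Ext: "Ext_mod R i M N = homology_mod (Hom_complex R P N) (- int i)"
    by (simp add: Ext_mod_def P_def)
  have cP: "is_complex R P" using P by (simp add: projective_resolution_def resolution_def)
  show "module R (Ext_mod R i M N)"
    unfolding Ext by (rule module_homology[OF is_complex_Hom_complex[OF cP N]])
  show "mod_iso R (Ext_mod R i M N) (homology_mod (Hom_complex R F N) (- int i))"
    unfolding Ext using P F(1) pF unfolding projective_resolution_def
    by (intro homology_Hom_complex_iso[OF M N]) auto
qed

lemma proj_dim_le:
  assumes F: "resolution R F M" "\<And>i. fg_free R (obj F i)"
    and z: "\<And>i. i > int n \<Longrightarrow> zero_mod (obj F i)"
  shows "proj_dim R M \<le> enat n"
proof -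
  obtain P :: "('a, nat \<Rightarrow> 'a) chain_complex" where "projective_resolution R P M"
    "\<And>i. zero_mod (obj F i) \<Longrightarrow> zero_mod (obj P i)"
    using free_resolution_transport[OF F] by metis
  then have "projective_resolution R P M \<and> (\<forall>i>int n. zero_mod (obj P i))" using z by blast
  then show ?thesis unfolding proj_dim_def by (intro Inf_lower) blast
qed

text \<open>The infimum of a nonempty set of \<open>enat\<close> values is one of them, and the
  empty set would give infinity.\<close>

lemma proj_dim_attained:
  assumes "proj_dim R M = enat n"
  obtains P :: "('a, nat \<Rightarrow> 'a) chain_complex"
    where "projective_resolution R P M" "\<And>i. i > int n \<Longrightarrow> zero_mod (obj P i)"
proof -
  let ?S = "{enat n | n. \<exists>P :: ('a, nat \<Rightarrow> 'a) chain_complex.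
     projective_resolution R P M \<and> (\<forall>i>int n. zero_mod (obj P i))}"
  have "?S \<noteq> {}"
  proof
    assume "?S = {}"
    then have "proj_dim R M = \<infinity>" unfolding proj_dim_def by (simp only:) (simp add: top_enat_def)
    then show False using assms by simp
  qed
  then have "Inf ?S \<in> ?S" by (metis (no_types, lifting) ex_in_conv wellorder_InfI)
  then show thesis using that assms unfolding proj_dim_def by auto
qed

section \<open>Shifts and truncations\<close>

lemma shift_simps [simp]:
  "obj (shift_complex r C) i = obj C (i - r)" "diff (shift_complex r C) i = diff C (i - r)"
  by (simp_all add: shift_complex_def)

lemma is_complex_shift: "is_complex R C \<Longrightarrow> is_complex R (shift_complex r C)"
proof -
  assume C: "is_complex R C"
  have idx: "i - 1 - r = i - r - 1" "i - 2 - r = i - r - 2" for i by simp_all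
  show ?thesis
    unfolding is_complex_def shift_simps idx using complexD[OF C] by blast
qed

lemma cycles_shift: "cycles (shift_complex r C) i = cycles C (i - r)"
  by (simp add: cycles_def algebra_simps)

lemma boundaries_shift: "boundaries (shift_complex r C) i = boundaries C (i - r)"
  by (simp add: boundaries_def algebra_simps)

lemma minimal_shift: "minimal_complex R C \<Longrightarrow> minimal_complex R (shift_complex r C)"
  by (simp add: minimal_complex_def boundaries_shift)

text \<open>
  The complex \<open>C\<^sub>k \<leftarrow> C\<^sub>k\<^sub>+\<^sub>1 \<leftarrow> \<dots>\<close> with \<open>C\<^sub>k\<close> moved to degree \<open>0\<close>. In negative degrees the carrier is
  cut down to \<open>{0}\<close>, so that no zero module of the element type has to be chosen.
\<close>

definition truncation :: "int \<Rightarrow> ('a, 'c) chain_complex \<Rightarrow> ('a, 'c) chain_complex" where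
  "truncation k C =
     \<lparr>obj = (\<lambda>j. if j < 0 then obj C (k + j)\<lparr>carrier := {\<zero>\<^bsub>obj C (k + j)\<^esub>}\<rparr> else obj C (k + j)),
      diff = (\<lambda>j x. if j \<le> 0 then \<zero>\<^bsub>obj C (k + j - 1)\<^esub> else diff C (k + j) x)\<rparr>"

lemma truncation_simps:
  "j \<ge> 0 \<Longrightarrow> obj (truncation k C) j = obj C (k + j)"
  "j > 0 \<Longrightarrow> diff (truncation k C) j = diff C (k + j)"
  "\<zero>\<^bsub>obj (truncation k C) j\<^esub> = \<zero>\<^bsub>obj C (k + j)\<^esub>"
  by (simp_all add: truncation_def)

lemma truncation_zero_mod: "j < 0 \<Longrightarrow> zero_mod (obj (truncation k C) j)"
  by (simp add: truncation_def zero_mod_def)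

lemma is_complex_truncation:
  assumes C: "is_complex R C" shows "is_complex R (truncation k C)"
  unfolding is_complex_def
proof (intro allI conjI ballI)
  note mC = complex_module[OF C]
  fix j
  show m: "module R (obj (truncation k C) j)" for j
    using submodule.submodule_is_module[OF submodule_singleton_zero[OF mC] mC] mC
    by (simp add: truncation_def)
  have idx: "k + (j - 1) = k + j - 1" "k + (j - 2) = k + j - 2" by simp_all
  show "diff (truncation k C) j \<in> mod_hom R (obj (truncation k C) j) (obj (truncation k C) (j - 1))"
  proof (cases "j \<le> 0")
    case True
    then have "diff (truncation k C) j = (\<lambda>x. \<zero>\<^bsub>obj (truncation k C) (j - 1)\<^esub>)"
      by (simp add: truncation_def idx fun_eq_iff)
    then show ?thesis using mod_hom_const_zero[OF m[of "j - 1"]] by metis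
  next
    case False
    then show ?thesis using complex_diff[OF C, of "k + j"] by (simp add: truncation_simps idx)
  qed
  fix x assume x: "x \<in> carrier (obj (truncation k C) j)"
  show "diff (truncation k C) (j - 1) (diff (truncation k C) j x) = \<zero>\<^bsub>obj (truncation k C) (j - 2)\<^esub>"
  proof (cases "j \<le> 1")
    case True
    then show ?thesis by (simp add: truncation_simps(3)) (simp add: truncation_def idx)
  next
    case False
    then show ?thesis using complex_diff_diff[OF C, of x "k + j"] x
      by (simp add: truncation_simps idx)
  qed
qed

lemma boundaries_truncation: "j \<ge> 0 \<Longrightarrow> boundaries (truncation k C) j = boundaries C (k + j)"
  by (simp add: boundaries_def truncation_simps add.assoc)

lemma cycles_truncation: "j > 0 \<Longrightarrow> cycles (truncation k C) j = cycles C (k + j)"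
  by (simp add: cycles_def truncation_simps add_diff_eq)

lemma minimal_truncation:
  assumes C: "is_complex R C" "minimal_complex R C" and R: "local_ring R"
  shows "minimal_complex R (truncation k C)"
  unfolding minimal_complex_def
proof (intro allI conjI)
  interpret m: maximalideal "max_ideal R" R by (rule local_ring_maximalideal[OF R])
  fix j
  note T = is_complex_truncation[OF C(1), of k]
  note mT = complex_module[OF T, of j]
  show "fg_projective R (obj (truncation k C) j)"
  proof (cases "j < 0")
    case True
    then show ?thesis using fg_projective_zero[OF mT truncation_zero_mod] by simp
  next
    case False
    then show ?thesis using C(2) by (simp add: truncation_simps minimal_complex_def)
  qed
  show "boundaries (truncation k C) j \<subseteq> ideal_smult R (max_ideal R) (obj (truncation k C) j)"
  proof (cases "j < 0")
    case True
    then have "boundaries (truncation k C) j \<subseteq> {\<zero>\<^bsub>obj (truncation k C) j\<^esub>}"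
      using boundaries_subset[OF T, of j] truncation_zero_mod[OF True, of k C]
        by (simp add: zero_mod_def)
    then show ?thesis using submodule_zero[OF mT ideal_smult_submodule[OF mT m.is_ideal]] by blast
  next
    case False
    then show ?thesis using C(2)
      by (simp add: boundaries_truncation truncation_simps minimal_complex_def)
  qed
qed

lemma resolution_truncation:
  assumes C: "is_complex R C" and ex: "\<And>i. i > k \<Longrightarrow> cycles C i = boundaries C i"
    and \<epsilon>: "\<epsilon> \<in> mod_hom R (obj C k) N" "\<epsilon> ` carrier (obj C k) = carrier N"
      "{x \<in> carrier (obj C k). \<epsilon> x = \<zero>\<^bsub>N\<^esub>} = boundaries C k"
  shows "resolution R (truncation k C) N"
  unfolding resolution_iff
proof (intro conjI allI impI)
  have "augmentation R (truncation k C) N \<epsilon>"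
    using \<epsilon> by (simp add: augmentation_def boundaries_truncation truncation_simps)
  then show "\<exists>\<epsilon>. augmentation R (truncation k C) N \<epsilon>" by blast
qed (auto simp: is_complex_truncation[OF C] truncation_zero_mod cycles_truncation
      boundaries_truncation ex)

section \<open>The dual of a minimal free resolution\<close>

lemma zero_mod_exact:
  assumes "is_complex R C" "zero_mod (obj C i)" shows "cycles C i = boundaries C i"
proof -
  have "x = \<zero>\<^bsub>obj C i\<^esub>" if "x \<in> cycles C i" for x
    using that assms(2) cycles_subset[of C i] by (auto simp: zero_mod_def)
  then have "cycles C i \<subseteq> boundaries C i"
    using submodule_zero[OF complex_module[OF assms(1)] boundaries_submodule[OF assms(1)]] by blast
  then show ?thesis using boundaries_subset_cycles[OF assms(1), of i] by blast
qed

lemma zero_mod_cycles: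
  assumes "is_complex R C" "zero_mod (obj C (i - 1))" shows "cycles C i = carrier (obj C i)"
  using mod_hom_closed[OF complex_diff[OF assms(1)], of _ i] assms(2)
    by (auto simp: cycles_def zero_mod_def)

lemma zero_mod_Hom_mod:
  assumes M: "module R M" and N: "module R N" and z: "zero_mod M" shows "zero_mod (Hom_mod R M N)"
proof -
  have "f = \<zero>\<^bsub>Hom_mod R M N\<^esub>" if f: "f \<in> carrier (Hom_mod R M N)" for f
  proof (rule Hom_mod_eqI[OF f])
    show zc: "\<zero>\<^bsub>Hom_mod R M N\<^esub> \<in> carrier (Hom_mod R M N)"
      by (rule submodule_zero[OF module_Hom_mod module.carrier_is_submodule[OF module_Hom_mod]]) fact+
    fix x assume "x \<in> carrier M"
    then have "x = \<zero>\<^bsub>M\<^esub>" using z by (simp add: zero_mod_def)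
    moreover have "f \<in> mod_hom R M N" "\<zero>\<^bsub>Hom_mod R M N\<^esub> \<in> mod_hom R M N"
      using f zc by (auto simp: Hom_mod_simps(1))
    then have "f \<zero>\<^bsub>M\<^esub> = \<zero>\<^bsub>N\<^esub>" "\<zero>\<^bsub>Hom_mod R M N\<^esub> \<zero>\<^bsub>M\<^esub> = \<zero>\<^bsub>N\<^esub>"
      by (auto intro: mod_hom_zero[OF M N])
    ultimately show "f x = \<zero>\<^bsub>Hom_mod R M N\<^esub> x" by simp
  qed
  then show ?thesis
    using submodule_zero[OF module_Hom_mod module.carrier_is_submodule[OF module_Hom_mod]] M N
    unfolding zero_mod_def by blast
qed

text \<open>The converse of \<open>quot_mod_iso\<close>: composition with the projection turns an
  isomorphism from the cokernel into an augmentation.\<close>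

lemma quot_mod_iso_augmentation:
  assumes A: "module R A" and B: "submodule B R A" and N: "module R N"
    and iso: "mod_iso R (quot_mod A B) N"
  obtains \<epsilon> where "\<epsilon> \<in> mod_hom R A N" "\<epsilon> ` carrier A = carrier N"
    "{x \<in> carrier A. \<epsilon> x = \<zero>\<^bsub>N\<^esub>} = B"
proof -
  obtain \<phi> where \<phi>: "\<phi> \<in> mod_hom R (quot_mod A B) N" "bij_betw \<phi> (carrier (quot_mod A B)) (carrier N)"
    using iso by (auto simp: mod_iso_def)
  show thesis
  proof (rule that)
    show "(\<lambda>x. \<phi> (B +>\<^bsub>A\<^esub> x)) \<in> mod_hom R A N" by (rule mod_hom_comp[OF coset_hom[OF A B] \<phi>(1)])
    show "(\<lambda>x. \<phi> (B +>\<^bsub>A\<^esub> x)) ` carrier A = carrier N"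
      using bij_betw_imp_surj_on[OF \<phi>(2)] unfolding quot_mod_carrier image_image .
    have "\<phi> (B +>\<^bsub>A\<^esub> x) = \<zero>\<^bsub>N\<^esub> \<longleftrightarrow> x \<in> B" if x: "x \<in> carrier A" for x
      using bij_hom_eq_zero_iff[OF module_quot_mod[OF A B] N \<phi> mod_hom_closed[OF coset_hom[OF A B] x]]
        coset_eq_zero_iff[OF A B x] by simp
    then show "{x \<in> carrier A. \<phi> (B +>\<^bsub>A\<^esub> x) = \<zero>\<^bsub>N\<^esub>} = B"
      using module.submoduleE(1)[OF A B] by blast
  qed
qed

text \<open>A boundary of the dual complex has the form \<open>\<psi>\<close> d. Minimality puts the
  values of d into the maximal ideal times C, so \<open>\<psi>\<close> d takes values in the maximal
  ideal, and a dual basis turns this into the required membership.\<close>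

lemma minimal_Hom_complex:
  assumes R: "local_ring R" and C: "is_complex R C" "minimal_complex R C"
  shows "minimal_complex R (Hom_complex R C (regular_mod R))" (is "minimal_complex R ?H")
  unfolding minimal_complex_def
proof (intro allI conjI subsetI)
  interpret m: maximalideal "max_ideal R" R by (rule local_ring_maximalideal[OF R])
  have reg: "module R (regular_mod R)" using R by (intro module_regular) (simp add: local_ring_def)
  note mC = complex_module[OF C(1)]
  have C': "fg_projective R (obj C i)" "boundaries C i \<subseteq> ideal_smult R (max_ideal R) (obj C i)"
    for i
    using C(2) by (auto simp: minimal_complex_def)
  fix j
  show "fg_projective R (obj ?H j)"
    using fg_projective_dual[OF mC C'(1)] by (simp add: dual_mod_def)
  fix f assume f: "f \<in> boundaries ?H j"
  then obtain \<psi> where \<psi>: "\<psi> \<in> carrier (obj ?H (j + 1))" "f = diff ?H (j + 1) \<psi>"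
    by (auto simp: boundaries_def)
  have fc: "f \<in> carrier (dual_mod R (obj C (- j)))"
    using subsetD[OF boundaries_subset[OF is_complex_Hom_complex[OF C(1) reg]] f]
      by (simp add: dual_mod_def)
  have "\<psi> \<in> mod_hom R (obj C (- j - 1)) (regular_mod R)"
    using \<psi>(1) by (simp add: Hom_mod_simps)
  then have "f x \<in> max_ideal R" if x: "x \<in> carrier (obj C (- j))" for x
    using functional_ideal_smult[OF mC m.is_ideal, of \<psi> "- j - 1"] boundaryI'[OF x] C'(2)[of "- j - 1"]
      \<psi>(2) x by auto
  then show "f \<in> ideal_smult R (max_ideal R) (obj ?H j)"
    using dual_mem_ideal_smult[OF mC C'(1) m.is_ideal fc] by (simp add: dual_mod_def)
qed

text \<open>A functional on the cokernel of d_{i+1} is a functional on C_i that vanishes on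
  boundaries, and vanishing there is the cycle condition of H in degree -i.\<close>

lemma dual_syzygy_iso:
  fixes C :: "('a, 'c) chain_complex"
  assumes C: "is_complex R C"
  defines "H \<equiv> Hom_complex R C (regular_mod R)"
  shows "mod_iso R (obj H (- int i)\<lparr>carrier := cycles H (- int i)\<rparr>) (dual_mod R (syzygy C i))"
proof -
  let ?A = "obj C (int i)" and ?B = "boundaries C (int i)"
  note A = complex_module[OF C, of "int i"] and B = boundaries_submodule[OF C, of "int i"]
  have cr: "cring R" using A by (simp add: module_def)
  note reg = module_regular[OF cr]
  note S = module_quot_mod[OF A B]
  have Hi: "obj H (- int i) = Hom_mod R ?A (regular_mod R)" by (simp add: H_def)
  have cyc: "f \<in> cycles H (- int i) \<longleftrightarrow> f \<in> carrier (Hom_mod R ?A (regular_mod R)) \<and> (\<forall>x\<in>?B. f x = \<zero>\<^bsub>R\<^esub>)" for f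
  proof -
    have "diff H (- int i) f = \<zero>\<^bsub>obj H (- int i - 1)\<^esub>
        \<longleftrightarrow> (\<forall>x\<in>carrier (obj C (int i + 1)). f (diff C (int i + 1) x) = \<zero>\<^bsub>R\<^esub>)"
      by (auto simp: H_def Hom_mod_def restrict_def fun_eq_iff add.commute)
    then show ?thesis by (auto simp: cycles_def Hi boundaries_def)
  qed
  define \<pi> where "\<pi> u = (\<lambda>x\<in>carrier ?A. u (?B +>\<^bsub>?A\<^esub> x))" for u :: "'c set \<Rightarrow> 'a"
  have pin: "\<pi> u \<in> cycles H (- int i)" if u: "u \<in> carrier (dual_mod R (syzygy C i))" for u
  proof -
    have uh: "u \<in> mod_hom R (quot_mod ?A ?B) (regular_mod R)"
      using u by (simp add: dual_mod_def syzygy_def Hom_mod_simps)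
    have "\<pi> u \<in> carrier (Hom_mod R ?A (regular_mod R))"
      unfolding \<pi>_def by (rule restrict_in_Hom_mod[OF A mod_hom_comp[OF coset_hom[OF A B] uh]])
    moreover have "\<pi> u x = \<zero>\<^bsub>R\<^esub>" if x: "x \<in> ?B" for x
    proof -
      have "x \<in> carrier ?A" using x boundaries_subset[OF C] by blast
      then show ?thesis
        using coset_eq_zero_iff[OF A B, of x] x mod_hom_zero[OF S reg uh] by (simp add: \<pi>_def)
    qed
    ultimately show ?thesis by (simp add: cyc)
  qed
  have hom: "\<pi> \<in> mod_hom R (dual_mod R (syzygy C i)) (obj H (- int i)\<lparr>carrier := cycles H (- int i)\<rparr>)"
  proof (rule mod_homI)
    have q: "?B +>\<^bsub>?A\<^esub> x \<in> carrier (syzygy C i)" if "x \<in> carrier ?A" for x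
      using that by (simp add: syzygy_def quot_mod_carrier)
    show "\<pi> (u \<oplus>\<^bsub>dual_mod R (syzygy C i)\<^esub> v)
        = \<pi> u \<oplus>\<^bsub>obj H (- int i)\<lparr>carrier := cycles H (- int i)\<rparr>\<^esub> \<pi> v" for u v
      by (simp add: Hi) (auto simp: \<pi>_def Hom_mod_def dual_mod_def q intro!: restrict_ext)
    show "\<pi> (a \<odot>\<^bsub>dual_mod R (syzygy C i)\<^esub> u)
        = a \<odot>\<^bsub>obj H (- int i)\<lparr>carrier := cycles H (- int i)\<rparr>\<^esub> \<pi> u" for a u
      by (simp add: Hi) (auto simp: \<pi>_def Hom_mod_def dual_mod_def q intro!: restrict_ext)
  qed (simp add: pin)
  have mS: "module R (dual_mod R (syzygy C i))" unfolding syzygy_def by (rule module_dual[OF S])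
  have inj: "inj_on \<pi> (carrier (dual_mod R (syzygy C i)))"
  proof (rule inj_onI)
    fix u v assume u: "u \<in> carrier (dual_mod R (syzygy C i))"
      and v: "v \<in> carrier (dual_mod R (syzygy C i))"
      and eq: "\<pi> u = \<pi> v"
    show "u = v"
    proof (rule Hom_mod_eqI[of _ R "syzygy C i" "regular_mod R"])
      fix X assume "X \<in> carrier (syzygy C i)"
      then obtain x where x: "x \<in> carrier ?A" "X = ?B +>\<^bsub>?A\<^esub> x"
        by (auto simp: syzygy_def quot_mod_carrier)
      then show "u X = v X" using fun_cong[OF eq, of x] by (simp add: \<pi>_def)
    qed (use u v in \<open>simp_all add: dual_mod_def\<close>)
  qed
  have "f \<in> \<pi> ` carrier (dual_mod R (syzygy C i))" if f: "f \<in> cycles H (- int i)" for f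
  proof -
    have f': "f \<in> carrier (Hom_mod R ?A (regular_mod R))" "\<And>x. x \<in> ?B \<Longrightarrow> f x = \<zero>\<^bsub>regular_mod R\<^esub>"
      using f by (auto simp: cyc)
    then obtain h where h: "h \<in> mod_hom R (quot_mod ?A ?B) (regular_mod R)"
        "\<And>x. x \<in> carrier ?A \<Longrightarrow> h (?B +>\<^bsub>?A\<^esub> x) = f x"
      using quot_mod_lift[OF A B reg, of f] by (auto simp: Hom_mod_simps(1))
    let ?u = "restrict h (carrier (quot_mod ?A ?B))"
    have u: "?u \<in> carrier (dual_mod R (syzygy C i))"
      unfolding dual_mod_def syzygy_def by (rule restrict_in_Hom_mod[OF S h(1)])
    have "\<pi> ?u \<in> carrier (Hom_mod R ?A (regular_mod R))" using pin[OF u] by (simp add: cyc)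
    then have "f = \<pi> ?u"
      by (rule Hom_mod_eqI[OF f'(1)]) (simp add: \<pi>_def quot_mod_carrier h(2))
    then show ?thesis using u by blast
  qed
  then have "\<pi> ` carrier (dual_mod R (syzygy C i)) = cycles H (- int i)" using pin by blast
  then have "mod_iso R (dual_mod R (syzygy C i)) (obj H (- int i)\<lparr>carrier := cycles H (- int i)\<rparr>)"
    using hom inj unfolding mod_iso_def bij_betw_def by (intro bexI[of _ \<pi>]) simp_all
  then show ?thesis by (rule mod_iso_sym[OF mS])
qed

lemma grade_less_Ext_zero:
  assumes "grade R M = enat g" "i < g" shows "zero_mod (Ext_mod R i M (regular_mod R))"
proof (rule ccontr)
  assume "\<not> zero_mod (Ext_mod R i M (regular_mod R))"
  then have "grade R M \<le> enat i" unfolding grade_def by (intro Inf_lower) blast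
  then show False using assms by simp
qed

lemma grade_Ext_nonzero:
  assumes "grade R M = enat g" shows "\<not> zero_mod (Ext_mod R g M (regular_mod R))"
proof -
  let ?S = "{enat i | i. \<not> zero_mod (Ext_mod R i M (regular_mod R))}"
  have "?S \<noteq> {}"
  proof
    assume "?S = {}"
    then have "grade R M = \<infinity>" unfolding grade_def by (simp only:) (simp add: top_enat_def)
    then show False using assms by simp
  qed
  then have "Inf ?S \<in> ?S" by (metis (no_types, lifting) ex_in_conv wellorder_InfI)
  then show ?thesis using assms unfolding grade_def by auto
qed

section \<open>Ext, self-duality and syzygies for a fixed minimal free resolution F of M\<close>

context
  fixes R :: "('a, 'q) ring_scheme" and M :: "('a, 'm) module" and F :: "('a, 'c) chain_complex"
    and H :: "('a, 'c \<Rightarrow> 'a) chain_complex"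
  assumes R: "noetherian_ring R" "local_ring R" and M: "module R M" "\<not> zero_mod M"
    and minimal: "minimal_free_resolution R F M"
  defines "H \<equiv> Hom_complex R F (regular_mod R)"
begin

lemma resolution_F: "resolution R F M" and fg_free_F: "fg_free R (obj F i)"
  using minimal by (auto simp: minimal_free_resolution_def)

lemma complex_F: "is_complex R F" using resolution_F by (simp add: resolution_def)

lemma module_F: "module R (obj F i)" by (rule complex_module[OF complex_F])

lemma projective_F: "fg_projective R (obj F i)"
  by (rule fg_free_imp_fg_projective[OF module_F fg_free_F])

lemma negative_F: "i < 0 \<Longrightarrow> zero_mod (obj F i)"
  using resolution_F by (simp add: resolution_def)

lemma exact_F: "i > 0 \<Longrightarrow> cycles F i = boundaries F i"
  using resolution_F by (simp add: resolution_def)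

lemma minimal_F: "minimal_complex R F"
  using minimal projective_F by (simp add: minimal_complex_def minimal_free_resolution_def)

lemma module_regular_R: "module R (regular_mod R)"
  using R(2) by (intro module_regular) (simp add: local_ring_def)

lemma complex_H: "is_complex R H"
  unfolding H_def by (rule is_complex_Hom_complex[OF complex_F module_regular_R])

lemma minimal_H: "minimal_complex R H"
  unfolding H_def by (rule minimal_Hom_complex[OF R(2) complex_F minimal_F])

lemma obj_H: "obj H j = dual_mod R (obj F (- j))"
  by (simp add: H_def dual_mod_def)

lemma zero_mod_H: "zero_mod (obj F (- j)) \<Longrightarrow> zero_mod (obj H j)"
  unfolding obj_H dual_mod_def by (rule zero_mod_Hom_mod[OF module_F module_regular_R])

lemma Ext_homology:
  "mod_iso R (Ext_mod R i M (regular_mod R)) (homology_mod H (- int i))"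
  unfolding H_def by (rule Ext_mod_iso(2)[OF M(1) module_regular_R resolution_F fg_free_F])

lemma module_Ext: "module R (Ext_mod R i M (regular_mod R))"
  by (rule Ext_mod_iso(1)[OF M(1) module_regular_R resolution_F fg_free_F])

lemma Ext_zero_iff:
  "zero_mod (Ext_mod R i M (regular_mod R)) \<longleftrightarrow> cycles H (- int i) = boundaries H (- int i)"
  using mod_iso_zero_mod[OF module_Ext module_homology[OF complex_H] Ext_homology]
    zero_mod_homology[OF complex_H] by simp

lemma F_0_nonzero: "\<not> zero_mod (obj F 0)"
proof
  assume z: "zero_mod (obj F 0)"
  obtain \<epsilon> where \<epsilon>: "augmentation R F M \<epsilon>" using resolution_F by (auto simp: resolution_iff)
  have "carrier M = {\<epsilon> \<zero>\<^bsub>obj F 0\<^esub>}" using \<epsilon> z by (auto simp: augmentation_def zero_mod_def)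
  then show False
    using M mod_hom_zero[OF module_F M(1) augmentationD(1)[OF \<epsilon>]] by (simp add: zero_mod_def)
qed

lemma proj_dim_zero_mod:
  assumes "proj_dim R M = enat r" "i > int r" shows "zero_mod (obj F i)"
proof -
  obtain P :: "('a, nat \<Rightarrow> 'a) chain_complex"
    where P: "projective_resolution R P M" "\<And>i. i > int r \<Longrightarrow> zero_mod (obj P i)"
    using proj_dim_attained[OF assms(1)] by metis
  show ?thesis
    by (rule minimal_resolution_zero_mod[OF R M(1) resolution_F minimal_F P(1) P(2)[OF assms(2)]])
qed

lemma Ext_proj_dim_nonzero:
  assumes "proj_dim R M = enat r" shows "\<not> zero_mod (Ext_mod R r M (regular_mod R))"
proof
  assume "zero_mod (Ext_mod R r M (regular_mod R))"
  then have ex: "cycles H (- int r) = boundaries H (- int r)" by (simp add: Ext_zero_iff)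
  interpret m: maximalideal "max_ideal R" R by (rule local_ring_maximalideal[OF R(2)])
  note mH = complex_module[OF complex_H]
  have "zero_mod (obj H (- int r - 1))"
    using proj_dim_zero_mod[OF assms] by (intro zero_mod_H) simp
  \<comment> \<open>H vanishes in degree -r-1, so all of H_{-r} consists of cycles. If Ext^r
    vanished they would all be boundaries, hence by minimality lie in the maximal ideal times
    H_{-r}; Nakayama with the zero submodule then gives H_{-r} = 0.\<close>
  then have "cycles H (- int r) = carrier (obj H (- int r))" by (rule zero_mod_cycles[OF complex_H])
  then have le: "carrier (obj H (- int r)) \<subseteq> ideal_smult R (max_ideal R) (obj H (- int r))"
    using minimal_H ex unfolding minimal_complex_def by metis
  interpret Hr: module R "obj H (- int r)" by (rule mH)
  have "{\<zero>\<^bsub>obj H (- int r)\<^esub>} = carrier (obj H (- int r))"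
  proof (rule nakayama_projective[OF R mH _ submodule_singleton_zero[OF mH]])
    show "fg_projective R (obj H (- int r))" using minimal_H by (simp add: minimal_complex_def)
    show "\<exists>y\<in>{\<zero>\<^bsub>obj H (- int r)\<^esub>}. x \<ominus>\<^bsub>obj H (- int r)\<^esub> y
        \<in> ideal_smult R (max_ideal R) (obj H (- int r))" if "x \<in> carrier (obj H (- int r))" for x
      using that le Hr.minus_zero_right by auto
  qed
  \<comment> \<open>The vanishing passes from the dual back to F_r because functionals separate the
    points of a projective module.\<close>
  then have dual0: "f = \<zero>\<^bsub>dual_mod R (obj F (int r))\<^esub>"
    if "f \<in> carrier (dual_mod R (obj F (int r)))" for f
    using that unfolding obj_H by auto
  have "x = \<zero>\<^bsub>obj F (int r)\<^esub>" if x: "x \<in> carrier (obj F (int r))" for x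
  proof (rule fg_projective_separates_points[OF module_F projective_F x])
    fix f assume "f \<in> carrier (dual_mod R (obj F (int r)))"
    from dual0[OF this] x show "f x = \<zero>\<^bsub>R\<^esub>" by (simp add: dual_mod_def Hom_mod_simps(2))
  qed
  then have z: "zero_mod (obj F (int r))"
    using submodule_zero[OF module_F module.carrier_is_submodule[OF module_F]]
    unfolding zero_mod_def by blast
  show False
  \<comment> \<open>For r = 0 the vanishing of F_0 contradicts that M is nonzero; for r > 0 it makes
    F a resolution of length r - 1.\<close>
  proof (cases r)
    case 0
    then show False using z F_0_nonzero by simp
  next
    case (Suc s)
    have "zero_mod (obj F i)" if "i > int s" for i
      using proj_dim_zero_mod[OF assms, of i] z that Suc by (cases "i = int r") auto
    then have "proj_dim R M \<le> enat s" by (rule proj_dim_le[OF resolution_F fg_free_F])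
    then show False using assms Suc by simp
  qed
qed

text \<open>Stated for every shift r, because part (2) applies it to r = m+n-1 before this number is
  known to be the projective dimension.\<close>

lemma self_dual_iff_resolution:
  "complex_iso R F (shift_complex (int r) H) \<longleftrightarrow> resolution R (shift_complex (int r) H) M"
proof
  assume "complex_iso R F (shift_complex (int r) H)"
  then obtain \<theta> where "\<And>i. \<theta> i \<in> mod_hom R (obj F i) (obj (shift_complex (int r) H) i)"
    "\<And>i. bij_betw (\<theta> i) (carrier (obj F i)) (carrier (obj (shift_complex (int r) H) i))"
    "\<And>i x. x \<in> carrier (obj F i) \<Longrightarrow> \<theta> (i - 1) (diff F i x) = diff (shift_complex (int r) H) i (\<theta> i x)"
    unfolding complex_iso_def by blast
  then show "resolution R (shift_complex (int r) H) M"
    by (intro resolution_transfer[OF resolution_F is_complex_shift[OF complex_H], of UNIV \<theta>]) auto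
next
  assume "resolution R (shift_complex (int r) H) M"
  then obtain \<theta> where "chain_map R F (shift_complex (int r) H) \<theta>"
    "\<And>i. bij_betw (\<theta> i) (carrier (obj F i)) (carrier (obj (shift_complex (int r) H) i))"
    using minimal_resolution_unique[OF R M(1) resolution_F minimal_F _ minimal_shift[OF minimal_H]]
      by metis
  then show "complex_iso R F (shift_complex (int r) H)"
    unfolding complex_iso_def chain_map_def by blast
qed

text \<open>The shifted complex has homology Ext^{r-i} in degree i. In degree 0 all of H_{-r}
  consists of cycles, so the cokernel of the incoming differential is the whole of Ext^r.\<close>

lemma resolution_iff_Ext:
  assumes top: "\<And>i. i > int r \<Longrightarrow> zero_mod (obj F i)"
  shows "resolution R (shift_complex (int r) H) M \<longleftrightarrow>
    mod_iso R (Ext_mod R r M (regular_mod R)) M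
    \<and> (\<forall>i. i \<noteq> r \<longrightarrow> zero_mod (Ext_mod R i M (regular_mod R)))" (is "?L \<longleftrightarrow> ?iso \<and> ?van")
proof -
  note mH = complex_module[OF complex_H]
  have low: "zero_mod (obj H j)" if "j < - int r" for j using top that by (intro zero_mod_H) simp
  have "cycles H (- int r) = carrier (obj H (- int r))"
    by (rule zero_mod_cycles[OF complex_H low]) simp
  then have hom: "homology_mod H (- int r) = quot_mod (obj H (- int r)) (boundaries H (- int r))"
    by (simp add: homology_mod_def)
  have aug: "(\<exists>\<epsilon>. augmentation R (shift_complex (int r) H) M \<epsilon>) \<longleftrightarrow> ?iso"
  proof -
    have "(\<exists>\<epsilon>. augmentation R (shift_complex (int r) H) M \<epsilon>) \<longleftrightarrow> mod_iso R (homology_mod H (- int r)) M"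
    proof
      assume "\<exists>\<epsilon>. augmentation R (shift_complex (int r) H) M \<epsilon>"
      then obtain \<epsilon> where "\<epsilon> \<in> mod_hom R (obj H (- int r)) M" "\<epsilon> ` carrier (obj H (- int r)) = carrier M"
        "{x \<in> carrier (obj H (- int r)). \<epsilon> x = \<zero>\<^bsub>M\<^esub>} = boundaries H (- int r)"
        by (auto simp: augmentation_def boundaries_shift)
      then show "mod_iso R (homology_mod H (- int r)) M"
        unfolding hom by (rule quot_mod_iso[OF mH boundaries_submodule[OF complex_H] M(1)])
    next
      assume "mod_iso R (homology_mod H (- int r)) M"
      then obtain \<epsilon> where "\<epsilon> \<in> mod_hom R (obj H (- int r)) M" "\<epsilon> ` carrier (obj H (- int r)) = carrier M"
        "{x \<in> carrier (obj H (- int r)). \<epsilon> x = \<zero>\<^bsub>M\<^esub>} = boundaries H (- int r)"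
        unfolding hom using quot_mod_iso_augmentation[OF mH boundaries_submodule[OF complex_H] M(1)]
          by blast
      then have "augmentation R (shift_complex (int r) H) M \<epsilon>"
        by (simp add: augmentation_def boundaries_shift)
      then show "\<exists>\<epsilon>. augmentation R (shift_complex (int r) H) M \<epsilon>" by blast
    qed
    also have "\<dots> \<longleftrightarrow> ?iso"
      using mod_iso_trans[OF Ext_homology[of r]] mod_iso_trans[OF mod_iso_sym[OF module_Ext Ext_homology[of r]]]
      by blast
    finally show ?thesis .
  qed
  have "(\<forall>i>0. cycles (shift_complex (int r) H) i = boundaries (shift_complex (int r) H) i) \<longleftrightarrow> ?van"
  proof
    assume L: "\<forall>i>0. cycles (shift_complex (int r) H) i = boundaries (shift_complex (int r) H) i"
    show ?van
    proof (intro allI impI)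
      fix i assume "i \<noteq> r"
      then consider "i < r" | "i > r" by linarith
      then have "cycles H (- int i) = boundaries H (- int i)"
      proof cases
        case 1
        then show ?thesis using L[rule_format, of "int r - int i"]
          by (simp add: cycles_shift boundaries_shift)
      next
        case 2
        then show ?thesis by (intro zero_mod_exact[OF complex_H low]) simp
      qed
      then show "zero_mod (Ext_mod R i M (regular_mod R))" by (simp add: Ext_zero_iff)
    qed
  next
    assume V: ?van
    show "\<forall>i>0. cycles (shift_complex (int r) H) i = boundaries (shift_complex (int r) H) i"
    proof (intro allI impI)
      fix i :: int assume i: "i > 0"
      have "cycles H (i - int r) = boundaries H (i - int r)"
      \<comment> \<open>Degrees i <= r carry Ext^{r-i}, with r - i different from r because i > 0.
        Degrees i > r consist of duals of F in negative degrees.\<close>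
      proof (cases "i \<le> int r")
        case True
        then have "nat (int r - i) \<noteq> r" and eq: "- int (nat (int r - i)) = i - int r" using i
          by auto
        with V have "zero_mod (Ext_mod R (nat (int r - i)) M (regular_mod R))" by blast
        then show ?thesis unfolding Ext_zero_iff eq .
      next
        case False
        then show ?thesis by (intro zero_mod_exact[OF complex_H zero_mod_H] negative_F) simp
      qed
      then show "cycles (shift_complex (int r) H) i = boundaries (shift_complex (int r) H) i"
        by (simp add: cycles_shift boundaries_shift)
    qed
  qed
  moreover have "\<forall>i<0. zero_mod (obj (shift_complex (int r) H) i)" using low by simp
  ultimately show ?thesis
    unfolding resolution_iff using aug is_complex_shift[OF complex_H] by blast
qed

lemma self_dual_iff_totally_self_dual:
  assumes pd: "proj_dim R M = enat r" and g: "grade R M = enat g"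
  shows "self_dual R F M \<longleftrightarrow> totally_self_dual R M"
    and "self_dual R F M \<Longrightarrow> g = r"
proof -
  have sd: "self_dual R F M \<longleftrightarrow> mod_iso R (Ext_mod R r M (regular_mod R)) M
    \<and> (\<forall>i. i \<noteq> r \<longrightarrow> zero_mod (Ext_mod R i M (regular_mod R)))"
    using resolution_iff_Ext[OF proj_dim_zero_mod[OF pd]] self_dual_iff_resolution[of r]
    by (simp add: self_dual_def pd H_def)
  then show "self_dual R F M \<Longrightarrow> g = r" using grade_Ext_nonzero[OF g] by blast
  have tsd: "totally_self_dual R M \<longleftrightarrow> mod_iso R (Ext_mod R g M (regular_mod R)) M
    \<and> (\<forall>i. i \<noteq> g \<longrightarrow> zero_mod (Ext_mod R i M (regular_mod R)))"
    using g M(2) by (simp add: totally_self_dual_def)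
  show "self_dual R F M \<longleftrightarrow> totally_self_dual R M"
  proof (cases "g = r")
    case True
    then show ?thesis unfolding sd tsd by simp
  next
    \<comment> \<open>Ext is nonzero in degree g by definition of the grade and in degree r by
      \<open>Ext_proj_dim_nonzero\<close>, whereas either property concentrates Ext in a single
      degree, r or g.\<close>
    case False
    then have "\<not> self_dual R F M" "\<not> totally_self_dual R M"
      using sd tsd grade_Ext_nonzero[OF g] Ext_proj_dim_nonzero[OF pd] by metis+
    then show ?thesis by simp
  qed
qed

lemma self_dual_syzygies:
  assumes iso: "complex_iso R F (shift_complex (int g) H)" and i: "i < g"
  shows "mod_iso R (dual_mod R (syzygy F i)) (syzygy F (g + 1 - i))"
proof -
  \<comment> \<open>The degree of F that \<open>\<theta>\<close> matches with H_{-i}. It is positive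
    since i < g, so cycles of F are boundaries in degrees k and k + 1.\<close>
  define k where "k = int g - int i"
  have k: "k > 0" "int (g + 1 - i) = k + 1" "k - int g = - int i" "k - 1 - int g = - int i - 1"
    using i by (auto simp: k_def)
  obtain \<theta> where \<theta>: "\<And>i. \<theta> i \<in> mod_hom R (obj F i) (obj H (i - int g))"
    "\<And>i. bij_betw (\<theta> i) (carrier (obj F i)) (carrier (obj H (i - int g)))"
    "\<And>i x. x \<in> carrier (obj F i) \<Longrightarrow> \<theta> (i - 1) (diff F i x) = diff H (i - int g) (\<theta> i x)"
    using iso unfolding complex_iso_def shift_simps by blast
  note mH = complex_module[OF complex_H]
  have \<theta>cyc: "\<theta> k w \<in> cycles H (- int i) \<longleftrightarrow> w \<in> cycles F k" if w: "w \<in> carrier (obj F k)" for w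
  proof -
    have "\<theta> k w \<in> cycles H (- int i) \<longleftrightarrow> \<theta> (k - 1) (diff F k w) = \<zero>\<^bsub>obj H (k - 1 - int g)\<^esub>"
      using \<theta>(3)[OF w] mod_hom_closed[OF \<theta>(1) w] unfolding k(3,4) by (simp add: cycles_def)
    also have "\<dots> \<longleftrightarrow> diff F k w = \<zero>\<^bsub>obj F (k - 1)\<^esub>"
      by (rule bij_hom_eq_zero_iff[OF module_F mH \<theta>(1,2) mod_hom_closed[OF complex_diff[OF complex_F] w]])
    finally show ?thesis using w by (simp add: cycles_def)
  qed
  let ?Z = "obj H (- int i)\<lparr>carrier := cycles H (- int i)\<rparr>" and ?S = "dual_mod R (syzygy F i)"
  note mZ = cycles_module[OF complex_H, of "- int i"]
  have mS: "module R ?S"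
    unfolding syzygy_def
      by (rule module_dual[OF module_quot_mod[OF module_F boundaries_submodule[OF complex_F]]])
  obtain \<kappa> where \<kappa>: "\<kappa> \<in> mod_hom R ?Z ?S" "bij_betw \<kappa> (cycles H (- int i)) (carrier ?S)"
    using dual_syzygy_iso[OF complex_F, of i, folded H_def] by (auto simp: mod_iso_def)
  have dx: "diff F (k + 1) x \<in> cycles F k" if "x \<in> carrier (obj F (k + 1))" for x
    using boundaryI[OF that] boundaries_subset_cycles[OF complex_F] by blast
  note dx' = subsetD[OF cycles_subset dx]
  have \<theta>d: "(\<lambda>x. \<theta> k (diff F (k + 1) x)) \<in> mod_hom R (obj F (k + 1)) ?Z"
    using mod_hom_comp[OF complex_diff_Suc[OF complex_F] \<theta>(1)[of k, unfolded k(3)]] dx \<theta>cyc dx'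
    by (auto simp: mod_hom_def)
  \<comment> \<open>d maps F_{k+1} onto the cycles of F_k, \<open>\<theta>\<close> carries these to
    the cycles of H_{-i}, and \<open>\<kappa>\<close> identifies the latter with the dual syzygy.
    The kernel of the composite is the kernel of d, that is, the boundaries in degree k + 1.\<close>
  define q where "q x = \<kappa> (\<theta> k (diff F (k + 1) x))" for x
  have q: "q \<in> mod_hom R (obj F (k + 1)) ?S" unfolding q_def by (rule mod_hom_comp[OF \<theta>d \<kappa>(1)])
  have "mod_iso R (quot_mod (obj F (k + 1)) (boundaries F (k + 1))) ?S"
  proof (rule quot_mod_iso[OF module_F boundaries_submodule[OF complex_F] mS q])
    have "y \<in> q ` carrier (obj F (k + 1))" if y: "y \<in> carrier ?S" for y
    proof -
      obtain z where z: "z \<in> cycles H (- int i)" "y = \<kappa> z"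
        using y unfolding bij_betw_imp_surj_on[OF \<kappa>(2), symmetric] by blast
      have "z \<in> carrier (obj H (k - int g))" using z(1) k(3) by (simp add: cycles_def)
      then obtain w where w: "w \<in> carrier (obj F k)" "z = \<theta> k w"
        unfolding bij_betw_imp_surj_on[OF \<theta>(2)[of k], symmetric] by blast
      then have "w \<in> boundaries F k" using \<theta>cyc[OF w(1)] z(1) exact_F[OF k(1)] by simp
      then show ?thesis using z w by (auto simp: boundaries_def q_def)
    qed
    then show "q ` carrier (obj F (k + 1)) = carrier ?S" using mod_hom_closed[OF q] by blast
    have "q x = \<zero>\<^bsub>?S\<^esub> \<longleftrightarrow> x \<in> boundaries F (k + 1)" if x: "x \<in> carrier (obj F (k + 1))" for x
    proof -
      have "q x = \<zero>\<^bsub>?S\<^esub> \<longleftrightarrow> \<theta> k (diff F (k + 1) x) = \<zero>\<^bsub>?Z\<^esub>"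
        unfolding q_def using \<kappa> mod_hom_closed[OF \<theta>d x]
          by (intro bij_hom_eq_zero_iff[OF mZ mS]) simp_all
      also have "\<dots> \<longleftrightarrow> \<theta> k (diff F (k + 1) x) = \<zero>\<^bsub>obj H (k - int g)\<^esub>" by (simp add: k(3))
      also have "\<dots> \<longleftrightarrow> diff F (k + 1) x = \<zero>\<^bsub>obj F k\<^esub>"
        by (rule bij_hom_eq_zero_iff[OF module_F mH \<theta>(1,2) dx'[OF x]])
      also have "\<dots> \<longleftrightarrow> x \<in> boundaries F (k + 1)" using exact_F[of "k + 1"] k(1) x
        by (auto simp: cycles_def)
      finally show ?thesis .
    qed
    then show "{x \<in> carrier (obj F (k + 1)). q x = \<zero>\<^bsub>?S\<^esub>} = boundaries F (k + 1)"
      using boundaries_subset[OF complex_F, of "k + 1"] by blast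
  qed
  then have "mod_iso R (syzygy F (g + 1 - i)) ?S" unfolding syzygy_def k(2) .
  moreover have "module R (syzygy F (g + 1 - i))"
    unfolding syzygy_def by (rule module_quot_mod[OF module_F boundaries_submodule[OF complex_F]])
  ultimately show ?thesis by (metis mod_iso_sym)
qed

section \<open>Part (2): an isomorphism between a dual syzygy and a syzygy\<close>

lemma exact_H_below_grade:
  assumes g: "grade R M = enat g" and j: "j > - int g"
  shows "cycles H j = boundaries H j"
proof (cases "j \<le> 0")
  case True
  then have "nat (- j) < g" "- int (nat (- j)) = j" using j by auto
  then show ?thesis using grade_less_Ext_zero[OF g, of "nat (- j)"] by (simp add: Ext_zero_iff)
next
  case False
  then show ?thesis by (intro zero_mod_exact[OF complex_H zero_mod_H] negative_F) simp
qed

text \<open>The dual syzygy is the module of cycles of H in degree -m, and d maps H_{1-m} onto it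
  because Ext^m vanishes; so d serves as the augmentation. Here H_{1-m} is the dual of F_{m-1}. For
  m = 0 it is zero, in accordance with the vanishing of the dual of M.\<close>

lemma dual_syzygy_truncation:
  assumes g: "grade R M = enat g" and mn: "m < g"
    and iso: "mod_iso R (dual_mod R (syzygy F m)) (syzygy F n)"
  shows "resolution R (truncation (1 - int m) H) (syzygy F n)"
proof -
  let ?Z = "obj H (- int m)\<lparr>carrier := cycles H (- int m)\<rparr>"
  note mZ = cycles_module[OF complex_H, of "- int m"]
  have mS: "module R (syzygy F i)" for i
    unfolding syzygy_def by (rule module_quot_mod[OF module_F boundaries_submodule[OF complex_F]])
  obtain \<kappa> where \<kappa>: "\<kappa> \<in> mod_hom R ?Z (syzygy F n)" "bij_betw \<kappa> (cycles H (- int m)) (carrier (syzygy F n))"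
    using mod_iso_trans[OF dual_syzygy_iso[OF complex_F, of m, folded H_def] iso]
      by (auto simp: mod_iso_def)
  have d: "diff H (1 - int m) \<in> mod_hom R (obj H (1 - int m)) (obj H (- int m))"
    using complex_diff[OF complex_H, of "1 - int m"] by simp
  have dx: "diff H (1 - int m) x \<in> cycles H (- int m)" if "x \<in> carrier (obj H (1 - int m))" for x
    using boundaryI'[OF that] boundaries_subset_cycles[OF complex_H, of "- int m"] by auto
  have dZ: "diff H (1 - int m) \<in> mod_hom R (obj H (1 - int m)) ?Z"
    using d dx by (auto simp: mod_hom_def)
  define \<epsilon> where "\<epsilon> x = \<kappa> (diff H (1 - int m) x)" for x
  have \<epsilon>: "\<epsilon> \<in> mod_hom R (obj H (1 - int m)) (syzygy F n)"
    unfolding \<epsilon>_def by (rule mod_hom_comp[OF dZ \<kappa>(1)])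
  show ?thesis
  proof (rule resolution_truncation[OF complex_H _ \<epsilon>])
    show "cycles H i = boundaries H i" if "i > 1 - int m" for i
      using that mn by (intro exact_H_below_grade[OF g]) simp
    \<comment> \<open>Exactness at -m makes \<open>\<epsilon>\<close> surjective; exactness at 1 - m
      identifies its kernel with the boundaries.\<close>
    have ex: "cycles H (- int m) = boundaries H (- int m)" "cycles H (1 - int m) = boundaries H (1 - int m)"
      using mn by (intro exact_H_below_grade[OF g]; simp)+
    have "y \<in> \<epsilon> ` carrier (obj H (1 - int m))" if y: "y \<in> carrier (syzygy F n)" for y
    proof -
      obtain z where z: "z \<in> cycles H (- int m)" "y = \<kappa> z"
        using y unfolding bij_betw_imp_surj_on[OF \<kappa>(2), symmetric] by blast
      then obtain x where "x \<in> carrier (obj H (- int m + 1))" "z = diff H (- int m + 1) x"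
        unfolding ex boundaries_def by blast
      then show ?thesis using z(2) by (simp add: \<epsilon>_def)
    qed
    then show "\<epsilon> ` carrier (obj H (1 - int m)) = carrier (syzygy F n)" using mod_hom_closed[OF \<epsilon>]
      by blast
    have "\<epsilon> x = \<zero>\<^bsub>syzygy F n\<^esub> \<longleftrightarrow> x \<in> cycles H (1 - int m)"
      if x: "x \<in> carrier (obj H (1 - int m))" for x
    proof -
      have "\<epsilon> x = \<zero>\<^bsub>syzygy F n\<^esub> \<longleftrightarrow> diff H (1 - int m) x = \<zero>\<^bsub>?Z\<^esub>"
        unfolding \<epsilon>_def using \<kappa> dx[OF x] by (intro bij_hom_eq_zero_iff[OF mZ mS]) simp_all
      then show ?thesis using x by (simp add: cycles_def)
    qed
    then show "{x \<in> carrier (obj H (1 - int m)). \<epsilon> x = \<zero>\<^bsub>syzygy F n\<^esub>} = boundaries H (1 - int m)"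
      using cycles_subset[of H "1 - int m"] unfolding ex(2)[symmetric] by blast
  qed
qed

lemma syzygy_truncation: "resolution R (truncation (int n) F) (syzygy F n)"
proof (rule resolution_truncation[OF complex_F])
  note A = module_F[of "int n"] and B = boundaries_submodule[OF complex_F, of "int n"]
  show "cycles F i = boundaries F i" if "i > int n" for i using that by (intro exact_F) simp
  show "(\<lambda>x. boundaries F (int n) +>\<^bsub>obj F (int n)\<^esub> x) \<in> mod_hom R (obj F (int n)) (syzygy F n)"
    unfolding syzygy_def by (rule coset_hom[OF A B])
  show "(\<lambda>x. boundaries F (int n) +>\<^bsub>obj F (int n)\<^esub> x) ` carrier (obj F (int n)) = carrier (syzygy F n)"
    by (simp add: syzygy_def quot_mod_carrier)
  show "{x \<in> carrier (obj F (int n)). boundaries F (int n) +>\<^bsub>obj F (int n)\<^esub> x = \<zero>\<^bsub>syzygy F n\<^esub>}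
      = boundaries F (int n)"
    using coset_eq_zero_iff[OF A B] boundaries_subset[OF complex_F, of "int n"] unfolding syzygy_def
      by blast
qed

lemma self_dual_of_dual_syzygy:
  assumes g: "grade R M = enat g" and m: "m < g" and n: "n < g"
    and iso: "mod_iso R (dual_mod R (syzygy F m)) (syzygy F n)"
  shows "2 \<le> m \<and> 2 \<le> n \<and> proj_dim R M = enat g \<and> g = m + n - 1 \<and> self_dual R F M"
proof -
  let ?T = "truncation (int n) F" and ?U = "truncation (1 - int m) H"
  have mS: "module R (syzygy F n)"
    unfolding syzygy_def by (rule module_quot_mod[OF module_F boundaries_submodule[OF complex_F]])
  obtain \<theta> where \<theta>: "chain_map R ?T ?U \<theta>" "\<And>j. bij_betw (\<theta> j) (carrier (obj ?T j)) (carrier (obj ?U j))"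
    using minimal_resolution_unique[OF R mS syzygy_truncation
        minimal_truncation[OF complex_F minimal_F R(2)] dual_syzygy_truncation[OF g m iso]
        minimal_truncation[OF complex_H minimal_H R(2)]] by metis
  have objU: "obj ?U j = dual_mod R (obj F (int m - 1 - j))" if "j \<ge> 0" for j
    using that by (simp add: truncation_simps obj_H)
  have \<theta>_hom: "\<theta> j \<in> mod_hom R (obj F (int n + j)) (dual_mod R (obj F (int m - 1 - j)))"
    and \<theta>_bij: "bij_betw (\<theta> j) (carrier (obj F (int n + j))) (carrier (dual_mod R (obj F (int m - 1 - j))))"
    if "j \<ge> 0" for j
    using chain_map_hom[OF \<theta>(1), of j] \<theta>(2)[of j] that unfolding objU[OF that]
    by (simp_all add: truncation_simps)
  \<comment> \<open>Commutation with the differentials, read as an adjunction: pairing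
    \<open>\<theta>\<close> (d y) with x equals pairing \<open>\<theta>\<close> y with d x. No signs
    occur, since \<open>Hom_complex\<close> introduces none, so the transposes commute with the
    differentials as well.\<close>
  have \<theta>_diff: "\<theta> j (diff F (int n + j + 1) y) x = \<theta> (j + 1) y (diff F (int m - 1 - j) x)"
    if j: "j \<ge> 0" and y: "y \<in> carrier (obj F (int n + j + 1))"
      and x: "x \<in> carrier (obj F (int m - 1 - j))"
    for j x y
  proof -
    have "\<theta> j (diff F (int n + (j + 1)) y) = diff H (1 - int m + (j + 1)) (\<theta> (j + 1) y)"
      using chain_map_diff[OF \<theta>(1), of y "j + 1"] j y by (simp add: truncation_simps add.assoc)
    then show ?thesis using x by (simp add: H_def algebra_simps)
  qed
  \<comment> \<open>F_{n+j} is isomorphic to the dual of F_{m-1-j}, and m-1-j is negative once j >=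
    m.\<close>
  have F_top: "zero_mod (obj F i)" if i: "i \<ge> int (m + n)" for i
  proof -
    define j where "j = i - int n"
    have j: "j \<ge> 0" "int m - 1 - j < 0" "int n + j = i" using i by (auto simp: j_def)
    have "zero_mod (dual_mod R (obj F (int m - 1 - j)))"
      unfolding dual_mod_def
        by (rule zero_mod_Hom_mod[OF module_F module_regular_R negative_F[OF j(2)]])
    moreover have "mod_iso R (obj F i) (dual_mod R (obj F (int m - 1 - j)))"
      using \<theta>_hom[OF j(1)] \<theta>_bij[OF j(1)] unfolding j(3) mod_iso_def by blast
    ultimately show ?thesis using mod_iso_zero_mod[OF module_F module_dual[OF module_F]] by blast
  qed
  \<comment> \<open>This guards the subtraction on natural numbers in \<open>p\<close>: for m = n =
    0 the bound just shown would make F_0 vanish.\<close>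
  have mn: "m + n \<ge> 1"
  proof (rule ccontr)
    assume "\<not> m + n \<ge> 1"
    then show False using F_top[of 0] F_0_nonzero by simp
  qed
  define p where "p = m + n - 1"
  have p: "int p = int m + int n - 1" using mn by (simp add: p_def)
  have top: "zero_mod (obj F i)" if "i > int p" for i using F_top[of i] that p by simp
  have "proj_dim R M \<le> enat p" by (rule proj_dim_le[OF resolution_F fg_free_F top])
  then obtain r where r: "proj_dim R M = enat r" "r \<le> p"
    by (cases "proj_dim R M") auto
  have "g \<le> r"
    using grade_less_Ext_zero[OF g] Ext_proj_dim_nonzero[OF r(1)] by (meson not_less)
  then have "g \<le> p" using r(2) by simp
  then have two: "2 \<le> m" "2 \<le> n" using m n by (auto simp: p_def)

  \<comment> \<open>\<open>\<theta>\<close> with index m-1-i runs from F_{p-i} to the dual of F_i.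
    Its transpose runs from F_i to the dual of F_{p-i}, which is degree i of H shifted by p.\<close>
  define \<psi> where "\<psi> i x = (\<lambda>y\<in>carrier (obj F (int p - i)). \<theta> (int m - 1 - i) y x)" for i x
  have idx: "int n + (int m - 1 - i) = int p - i" "int m - 1 - (int m - 1 - i) = i" for i
    using p by simp_all
  have \<psi>: "\<psi> i \<in> mod_hom R (obj F i) (dual_mod R (obj F (int p - i)))"
      "bij_betw (\<psi> i) (carrier (obj F i)) (carrier (dual_mod R (obj F (int p - i))))"
    if "i \<le> int m - 1" for i
    using fg_projective_transpose_bij[OF module_F module_F projective_F projective_F
        \<theta>_hom[of "int m - 1 - i", unfolded idx] \<theta>_bij[of "int m - 1 - i", unfolded idx]] that
    unfolding \<psi>_def by simp_all
  have "resolution R (shift_complex (int p) H) M"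
  proof (rule resolution_transfer[OF resolution_F is_complex_shift[OF complex_H], of "{..int m - 1}" \<psi>])
    fix i x assume i: "i \<in> {..int m - 1}" and x: "x \<in> carrier (obj F i)"
    have "\<psi> (i - 1) (diff F i x) = diff H (i - int p) (\<psi> i x)"
    proof (rule Hom_mod_eqI[of _ R "obj F (int p - (i - 1))" "regular_mod R"])
      show "\<psi> (i - 1) (diff F i x) \<in> carrier (Hom_mod R (obj F (int p - (i - 1))) (regular_mod R))"
        using mod_hom_closed[OF \<psi>(1)[of "i - 1"] mod_hom_closed[OF complex_diff[OF complex_F] x]] i
        by (simp add: dual_mod_def)
      have "\<psi> i x \<in> carrier (obj H (i - int p))"
        using mod_hom_closed[OF \<psi>(1)[of i] x] i by (simp add: obj_H)
      from mod_hom_closed[OF complex_diff[OF complex_H] this]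
      show "diff H (i - int p) (\<psi> i x) \<in> carrier (Hom_mod R (obj F (int p - (i - 1))) (regular_mod R))"
        by (simp add: obj_H dual_mod_def algebra_simps)
      fix y assume y: "y \<in> carrier (obj F (int p - (i - 1)))"
      have y': "y \<in> carrier (obj F (int p - i + 1))" using y by (simp add: algebra_simps)
      have dy: "diff F (int p - i + 1) y \<in> carrier (obj F (int p - i))"
        by (rule mod_hom_closed[OF complex_diff_Suc[OF complex_F] y'])
      have "\<psi> (i - 1) (diff F i x) y = \<theta> (int m - 1 - i + 1) y (diff F i x)"
        using y by (simp add: \<psi>_def algebra_simps)
      also have "\<dots> = \<theta> (int m - 1 - i) (diff F (int p - i + 1) y) x"
        using \<theta>_diff[of "int m - 1 - i" y x, unfolded idx] i x y' by simp
      also have "\<dots> = diff H (i - int p) (\<psi> i x) y"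
        using y' dy by (simp add: H_def \<psi>_def algebra_simps)
      finally show "\<psi> (i - 1) (diff F i x) y = diff H (i - int p) (\<psi> i x) y" .
    qed
    then show "\<psi> (i - 1) (diff F i x) = diff (shift_complex (int p) H) i (\<psi> i x)" by simp
  next
    \<comment> \<open>Outside the segment i >= m - 1, so i - p >= -n > -g and exactness below the
      grade applies.\<close>
    fix i :: int assume "i > 0" "i + 1 \<notin> {..int m - 1}"
    then show "cycles (shift_complex (int p) H) i = boundaries (shift_complex (int p) H) i"
      unfolding cycles_shift boundaries_shift using p n
      by (intro exact_H_below_grade[OF g]) simp
  qed (use two \<psi> in \<open>simp_all add: obj_H\<close>)
  \<comment> \<open>A resolution by the dual shifted by p leaves Ext^p as the only possibly nonzero
    Ext, and Ext^g is nonzero; hence g = p, and g <= r <= p then pins down r.\<close>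
  then have "complex_iso R F (shift_complex (int p) H)" "g = p"
    using self_dual_iff_resolution[of p] resolution_iff_Ext[OF top] grade_Ext_nonzero[OF g]
      by blast+
  moreover from this have "r = p" using \<open>g \<le> r\<close> r(2) by simp
  ultimately show ?thesis using two r(1) by (simp add: self_dual_def H_def p_def)
qed

end

theorem theorem1p1:
  fixes R :: "('a, 'q) ring_scheme"
    and M :: "('a, 'm) module"
    and F :: "('a, 'c) chain_complex"
    and g :: nat
  assumes "noetherian_ring R" and "local_ring R"
    and "module R M" and "fin_gen R M" and "\<not> zero_mod M"
    and "grade R M = enat g"
    and "minimal_free_resolution R F M"
  shows "(proj_dim R M < \<infinity> \<longrightarrow>
            (self_dual R F M \<longleftrightarrow> totally_self_dual R M)
          \<and> (self_dual R F M \<longrightarrow>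
               (\<forall>i<g. mod_iso R (dual_mod R (syzygy F i)) (syzygy F (g + 1 - i)))))
       \<and> (\<forall>m n. m < g \<and> n < g \<and> mod_iso R (dual_mod R (syzygy F m)) (syzygy F n) \<longrightarrow>
            2 \<le> m \<and> 2 \<le> n \<and> proj_dim R M = enat g \<and> g = m + n - 1 \<and> self_dual R F M)"
proof (intro conjI impI allI)
  note ctx = assms(1,2,3,5,7)
  assume "proj_dim R M < \<infinity>"
  then obtain r where r: "proj_dim R M = enat r" by (cases "proj_dim R M") auto
  show "self_dual R F M \<longleftrightarrow> totally_self_dual R M"
    by (rule self_dual_iff_totally_self_dual(1)[OF ctx r assms(6)])
  fix i assume sd: "self_dual R F M" and i: "i < g"
  \<comment> \<open>Self-duality is defined with the projective dimension as shift, whereas the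
    syzygy formula is indexed by the grade; the two agree for a self-dual F.\<close>
  have "complex_iso R F (shift_complex (int g) (Hom_complex R F (regular_mod R)))"
    using sd r self_dual_iff_totally_self_dual(2)[OF ctx r assms(6) sd] by (simp add: self_dual_def)
  then show "mod_iso R (dual_mod R (syzygy F i)) (syzygy F (g + 1 - i))"
    using i by (rule self_dual_syzygies[OF ctx])
next
  fix m n assume "m < g \<and> n < g \<and> mod_iso R (dual_mod R (syzygy F m)) (syzygy F n)"
  then have *: "m < g" "n < g" "mod_iso R (dual_mod R (syzygy F m)) (syzygy F n)" by auto
  note main = self_dual_of_dual_syzygy[OF assms(1,2,3,5,7,6) *]
  from main show "2 \<le> m" "2 \<le> n" "proj_dim R M = enat g" "g = m + n - 1" "self_dual R F M" by blast+
qed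

end
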